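(* There are only finitely many tuples $(x,y,m,q,p)$ with $x,y\in\mathbb{N}$, $\gcd(x,y)=1$, $m\in\mathbb{N}$, $p>3$ and $q$ odd primes, satisfying $$x^2+q^{2m}=2y^p,$$ such that $y$ is not a sum of two consecutive squares, i.e. there is no integer $t$ with $y=t^2+(t+1)^2$.
   Context: $\mathbb{N}$ denotes the set of positive integers. *)

theory Defs
  imports "HOL-Computational_Algebra.Primes"
begin

end

(*
Write X = x + i q^m. Unique factorization in Z[i] gives X = (1 + i) w^p with |w|^2 = y. For a suitable
unit k, the number k (1 + i) w = b + a i has a^2 + b^2 = 2 y and Im (b + a i)^p = +-2^((p-1)/2) q^m.
The left side is divisible by a, which is odd, so |a| is a power of q; |a| = 1 means precisely that y
is a sum of two consecutive squares. If |a| > 1, a look at the expansion modulo q shows that q^m <= p |a|.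
Hence |X^2 / |X|^2 - 1| is about |w|^(1-p): the unit number u = i^p w / cnj w, which has height about |w|, is
extremely close to a p-th root of unity.

For fixed p there are only finitely many such w: one very good approximation u0 = cis(phi0) to the root z yields,
through the Pade approximants of (1 - t)^(1/p) at t = 1 - u0^(-p), a dense sequence of good
approximations to z, and these repel any second solution with much larger |w|.

For large p there are none: this is a lower bound for the linear form p log u - 2 pi i r in two
logarithms, proved by Schneider's method. The pigeonhole principle provides integers d(k,l), not all zero, for which
the function sum d(k,l) (p z choose k) exp(2 pi i l z) is tiny on a disc. At z = (r s + p t) / p it is close to
sum d(k,l) (r s + p t choose k) u^(l s), so Liouville's inequality makes these numbers vanish,
contrary to a zero estimate.
*)
theory Submission
  imports Defs "HOL-Complex_Analysis.Complex_Analysis" "HOL-Number_Theory.Cong"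
    "HOL-Real_Asymp.Real_Asymp" "Jordan_Normal_Form.Determinant"
begin

subsection \<open>Gaussian integers\<close>

text \<open>Neither half of the argument covers both ranges. The Pade half is ineffective: it bounds
  |w| only in terms of one large near root that is assumed to exist, so it says nothing about
  growing p. Its closeness |w|^(1-p) has to beat heights of size |w|^(p n) in the n-th approximant,
  and p = 5 just leaves room for this. The other half must bound p uniformly in w, whose height is
  unbounded. The key is to let T grow like L ln |w|: in logarithms, every cost of the construction
  is then O(T L) = O(L^2 ln |w|), while the closeness to be refuted is worth (p - 1) ln |w|. The
  factor ln |w| cancels, and since L of order log p suffices, p = O(log^2 p) remains. That log p is
  the price of the functions (p z choose k): the factor p makes them integral at all points x / p,
  but lets them grow like (8 p)^K. Smallness is obtained on a whole disc at once, from Taylor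
  coefficients, so no extrapolation from zeros is needed.\<close>

definition gauss :: "complex set" where
  "gauss = {z. Re z \<in> \<int> \<and> Im z \<in> \<int>}"

lemma gauss_of_int [simp, intro]: "of_int n \<in> gauss"
  and gauss_of_nat [simp, intro]: "of_nat k \<in> gauss"
  and gauss_numeral [simp, intro]: "numeral j \<in> gauss"
  and gauss_0 [simp, intro]: "0 \<in> gauss"
  and gauss_1 [simp, intro]: "1 \<in> gauss"
  and gauss_ii [simp, intro]: "\<i> \<in> gauss"
  by (auto simp: gauss_def)

lemma gauss_add [simp, intro]: "a \<in> gauss \<Longrightarrow> b \<in> gauss \<Longrightarrow> a + b \<in> gauss"
  and gauss_diff [simp, intro]: "a \<in> gauss \<Longrightarrow> b \<in> gauss \<Longrightarrow> a - b \<in> gauss"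
  and gauss_mult [simp, intro]: "a \<in> gauss \<Longrightarrow> b \<in> gauss \<Longrightarrow> a * b \<in> gauss"
  and gauss_uminus [simp, intro]: "a \<in> gauss \<Longrightarrow> - a \<in> gauss"
  and gauss_cnj [simp, intro]: "a \<in> gauss \<Longrightarrow> cnj a \<in> gauss"
  by (auto simp: gauss_def)

lemma gauss_power [simp, intro]: "a \<in> gauss \<Longrightarrow> a ^ n \<in> gauss"
  by (induction n) auto

lemma gauss_sum [intro]: "(\<And>i. i \<in> I \<Longrightarrow> f i \<in> gauss) \<Longrightarrow> sum f I \<in> gauss"
  by (induction I rule: infinite_finite_induct) auto

lemma gaussE:
  assumes "z \<in> gauss"
  obtains a b :: int where "z = Complex (of_int a) (of_int b)"
  using assms by (auto simp: gauss_def complex_eq_iff elim!: Ints_cases)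

lemma gauss_ComplexI [simp, intro]: "Complex (of_int a) (of_int b) \<in> gauss"
  by (auto simp: gauss_def)

lemma gauss_norm_sq:
  assumes "z \<in> gauss"
  obtains n :: nat where "(cmod z)\<^sup>2 = real n"
proof -
  obtain a b :: int where z: "z = Complex (of_int a) (of_int b)" using gaussE[OF assms] .
  have "(cmod z)\<^sup>2 = of_int (a\<^sup>2 + b\<^sup>2)"
    by (simp add: z cmod_power2)
  also have "\<dots> = real (nat (a\<^sup>2 + b\<^sup>2))" by simp
  finally show ?thesis by (rule that)
qed

lemma gauss_norm_ge_1:
  assumes "z \<in> gauss" "z \<noteq> 0"
  shows "1 \<le> cmod z"
proof -
  obtain n where n: "(cmod z)\<^sup>2 = real n" using gauss_norm_sq[OF assms(1)] .
  with assms(2) have "n \<noteq> 0" by (metis of_nat_0 norm_eq_zero power_eq_0_iff)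
  then have "1\<^sup>2 \<le> (cmod z)\<^sup>2" using n by simp
  then show ?thesis by (rule power2_le_imp_le) simp
qed

lemma gauss_division:
  assumes "a \<in> gauss" "b \<in> gauss" "b \<noteq> 0"
  obtains q where "q \<in> gauss" "cmod (a - q * b) < cmod b"
proof -
  define q where "q = Complex (of_int (round (Re (a / b)))) (of_int (round (Im (a / b))))"
  define d where "d = a / b - q"
  have 1: "\<bar>Re d\<bar> \<le> 1/2" "\<bar>Im d\<bar> \<le> 1/2"
    using of_int_round_abs_le[of "Re (a / b)"] of_int_round_abs_le[of "Im (a / b)"]
    by (auto simp: d_def q_def abs_minus_commute)
  have "(cmod d)\<^sup>2 = (Re d)\<^sup>2 + (Im d)\<^sup>2" by (simp add: cmod_power2)
  also have "\<dots> \<le> (1/2)\<^sup>2 + (1/2)\<^sup>2"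
    using 1 by (intro add_mono) (metis abs_ge_zero power2_abs power_mono)+
  also have "\<dots> < 1\<^sup>2" by (simp add: power2_eq_square)
  finally have "cmod d < 1" by (rule power2_less_imp_less) simp
  moreover have "a - q * b = d * b" using assms(3) by (simp add: d_def field_simps)
  ultimately have "cmod (a - q * b) < cmod b"
    using assms(3) by (simp add: norm_mult)
  moreover have "q \<in> gauss" by (simp add: q_def)
  ultimately show ?thesis by (intro that)
qed

text \<open>An element of least positive norm generates the ideal (a, b). Divisibility is expressed
  by the cofactors a' and b' because \<open>dvd\<close> on the field \<open>complex\<close> is
  trivial.\<close>

lemma gauss_bezout:
  assumes "a \<in> gauss" "b \<in> gauss" "b \<noteq> 0"
  obtains w r s a' b' where "w \<in> gauss" "r \<in> gauss" "s \<in> gauss" "a' \<in> gauss" "b' \<in> gauss"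
    "w = r * a + s * b" "a = w * a'" "b = w * b'"
proof -
  define J where "J = {r * a + s * b | r s. r \<in> gauss \<and> s \<in> gauss}"
  have J_gauss: "J \<subseteq> gauss" using assms by (auto simp: J_def)
  have "a \<in> J" unfolding J_def by (rule CollectI, rule exI[of _ 1], rule exI[of _ 0]) auto
  have "b \<in> J" unfolding J_def by (rule CollectI, rule exI[of _ 0], rule exI[of _ 1]) auto
  have J_diff: "x - q * y \<in> J" if xy: "x \<in> J" "y \<in> J" "q \<in> gauss" for x y q
  proof -
    obtain r s r' s' where "x = r * a + s * b" "y = r' * a + s' * b"
      "r \<in> gauss" "s \<in> gauss" "r' \<in> gauss" "s' \<in> gauss"
      using xy by (auto simp: J_def)
    then have "x - q * y = (r - q * r') * a + (s - q * s') * b"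
      "r - q * r' \<in> gauss" "s - q * s' \<in> gauss"
      using xy(3) by (auto simp: algebra_simps)
    then show ?thesis unfolding J_def by blast
  qed
  define m where "m = (\<lambda>z. nat \<lfloor>(cmod z)\<^sup>2\<rfloor>)"
  obtain w where w: "w \<in> J" "w \<noteq> 0" and min: "\<And>z. z \<in> J \<Longrightarrow> z \<noteq> 0 \<Longrightarrow> m w \<le> m z"
    using ex_has_least_nat[of "\<lambda>z. z \<in> J \<and> z \<noteq> 0" b m] \<open>b \<in> J\<close> assms(3) by auto
  have dvd: "\<exists>c\<in>gauss. x = w * c" if "x \<in> J" for x
  proof -
    have "x \<in> gauss" "w \<in> gauss" using that w J_gauss by auto
    then obtain q where q: "q \<in> gauss" "cmod (x - q * w) < cmod w"
      using gauss_division w(2) by metis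
    let ?z = "x - q * w"
    have "?z \<in> J" using J_diff that w q by auto
    have "?z = 0"
    proof (rule ccontr)
      assume "?z \<noteq> 0"
      then have "m w \<le> m ?z" using min \<open>?z \<in> J\<close> by blast
      moreover obtain n where n: "(cmod w)\<^sup>2 = real n" using gauss_norm_sq \<open>w \<in> gauss\<close> by blast
      moreover obtain k where k: "(cmod ?z)\<^sup>2 = real k"
        using gauss_norm_sq \<open>?z \<in> J\<close> J_gauss by blast
      ultimately have "(cmod w)\<^sup>2 \<le> (cmod ?z)\<^sup>2" by (simp add: m_def)
      then have "cmod w \<le> cmod ?z" by (rule power2_le_imp_le) simp
      with q show False by simp
    qed
    then show ?thesis using q by (auto simp: mult.commute)
  qed
  obtain r s where rs: "w = r * a + s * b" "r \<in> gauss" "s \<in> gauss" using w by (auto simp: J_def)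
  obtain a' b' where "a = w * a'" "a' \<in> gauss" "b = w * b'" "b' \<in> gauss"
    using dvd[OF \<open>a \<in> J\<close>] dvd[OF \<open>b \<in> J\<close>] by blast
  then show ?thesis using that rs w J_gauss by blast
qed

text \<open>The ideal generated by \<open>z\<close> and \<open>y\<close> is principal, and its \<open>p\<close>-th power is generated by \<open>z\<close>.\<close>

lemma gauss_nth_power:
  fixes y p :: nat
  assumes z: "z \<in> gauss" and norm: "z * cnj z = of_nat y ^ p" and p: "p > 0" and y: "odd y"
    and cop: "r0 \<in> gauss" "s0 \<in> gauss" "r0 * z + s0 * cnj z = 2"
  obtains w e where "w \<in> gauss" "e \<in> gauss" "w * cnj w = of_nat y" "e * cnj e = 1" "z = e * w ^ p"
proof -
  let ?y = "of_nat y :: complex"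
  have y0: "y > 0" using y by (cases y) auto
  obtain w r s z' y' where w: "w \<in> gauss" "r \<in> gauss" "s \<in> gauss" "z' \<in> gauss" "y' \<in> gauss"
    "w = r * z + s * ?y" "z = w * z'" "?y = w * y'"
    using gauss_bezout[OF z gauss_of_nat, of y] y0 by (metis of_nat_eq_0_iff neq0_conv)
  have w0: "w \<noteq> 0" using w(8) y0 by auto
  obtain p' where p': "p = Suc p'" using p by (cases p) auto
  \<comment> \<open>Every term of the product is divisible by y, the one with z * cnj z = y^p
    because p > 0; so y divides w * cnj w.\<close>
  have "w * cnj w = (r * z + s * ?y) * (cnj r * cnj z + cnj s * ?y)"
    by (subst (1 2) w(6)) simp
  also have "\<dots> = r * cnj r * (z * cnj z) + ?y * (r * z * cnj s + s * cnj r * cnj z + s * cnj s * ?y)"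
    by (simp add: algebra_simps)
  also have "\<dots> = ?y * (r * cnj r * ?y ^ p' + (r * z * cnj s + s * cnj r * cnj z + s * cnj s * ?y))"
    unfolding norm p' by (simp add: algebra_simps)
  finally obtain n1 where n1: "n1 \<in> gauss" "w * cnj w = ?y * n1"
    using z w by (metis gauss_add gauss_cnj gauss_mult gauss_of_nat gauss_power)
  obtain k where k: "y = 2 * k + 1" using y by (elim oddE)
  \<comment> \<open>w and cnj w are coprime: 2 is a combination of z and cnj z, y = 2 k + 1, and w
    divides z and y, so 1 is a combination of w and cnj w. As w and cnj w both divide y, so does
    their product; hence n1 and n2 are units.\<close>
  have "1 = ?y - of_nat k * (r0 * z + s0 * cnj z)"
    unfolding cop k by simp
  also have "\<dots> = w * (y' - of_nat k * r0 * z') + cnj w * (- of_nat k * s0 * cnj z')"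
    by (subst (1 2) w(7), subst w(8)) (simp add: algebra_simps)
  finally have "?y = ?y * (w * (y' - of_nat k * r0 * z') + cnj w * (- of_nat k * s0 * cnj z'))"
    by simp
  also have "\<dots> = (?y * w) * (y' - of_nat k * r0 * z') + (?y * cnj w) * (- of_nat k * s0 * cnj z')"
    by (simp add: algebra_simps)
  also have "?y * w = w * cnj w * cnj y'"
    using arg_cong[OF w(8), of cnj] by simp
  also have "?y * cnj w = w * cnj w * y'"
    using w(8) by simp
  finally have "?y = w * cnj w * (cnj y' * (y' - of_nat k * r0 * z') + y' * (- of_nat k * s0 * cnj z'))"
    by (simp add: algebra_simps)
  then obtain n2 where n2: "n2 \<in> gauss" "?y = w * cnj w * n2"
    using w cop by (metis gauss_add gauss_cnj gauss_mult gauss_of_nat gauss_uminus gauss_diff)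
  have "?y * (n1 * n2) = ?y * 1"
    by (subst mult.assoc[symmetric], subst n1(2)[symmetric], subst n2(2)[symmetric]) simp
  then have n12: "n1 * n2 = 1"
    using y0 by (subst (asm) mult_left_cancel) auto
  then have nn: "cmod n1 * cmod n2 = 1" using n12 by (metis norm_mult norm_one)
  have "n1 \<noteq> 0" "n2 \<noteq> 0" using n12 by auto
  then have "cmod n1 \<ge> 1" "cmod n2 \<ge> 1" using gauss_norm_ge_1 n1 n2 by auto
  then have "cmod n1 = 1" using nn mult_left_mono[of 1 "cmod n2" "cmod n1"] by simp
  have ww: "w * cnj w = ?y"
  proof -
    have "of_real ((cmod w)\<^sup>2) = ?y * n1" using n1(2) complex_norm_square by simp
    then have "cmod (of_real ((cmod w)\<^sup>2)) = cmod (?y * n1)" by simp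
    then have "(cmod w)\<^sup>2 = real y" using \<open>cmod n1 = 1\<close> by (simp add: norm_mult norm_power)
    then show ?thesis by (metis complex_norm_square of_real_of_nat_eq)
  qed
  \<comment> \<open>Modulo z the p-th power of r z + s y is s^p y^p, and y^p = z * cnj z; so z
    divides w^p.\<close>
  have dvd: "\<exists>c\<in>gauss. (r * z + s * ?y) ^ n = z * c + (s * ?y) ^ n" for n
  proof (induction n)
    case (Suc n)
    then obtain c where c: "c \<in> gauss" "(r * z + s * ?y) ^ n = z * c + (s * ?y) ^ n" by blast
    have "(r * z + s * ?y) ^ Suc n = z * (r * (z * c + (s * ?y) ^ n) + s * ?y * c) + (s * ?y) ^ Suc n"
      by (simp add: c(2) algebra_simps)
    moreover have "r * (z * c + (s * ?y) ^ n) + s * ?y * c \<in> gauss"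
      using w(2,3) z c(1) by simp
    ultimately show ?case by blast
  qed (auto intro: bexI[of _ 0])
  obtain c where c: "c \<in> gauss" "w ^ p = z * c + (s * ?y) ^ p"
    using dvd[of p] w(6) by metis
  define f where "f = c + s ^ p * cnj z"
  have f: "f \<in> gauss" "w ^ p = z * f"
    using c(1) w(3) z by (auto simp: f_def c(2) power_mult_distrib norm[symmetric] algebra_simps)
  have zz: "z * cnj z \<noteq> 0" unfolding norm using y0 by simp
  have "w ^ p * cnj (w ^ p) = z * cnj z * (f * cnj f)" by (simp add: f(2) algebra_simps)
  moreover have "w ^ p * cnj (w ^ p) = z * cnj z"
    unfolding norm by (simp add: power_mult_distrib[symmetric] ww)
  ultimately have ff: "f * cnj f = 1" using zz by (metis mult_cancel_left2)
  have "z = cnj f * w ^ p"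
    using ff by (simp add: f(2) mult.left_commute mult.commute)
  then show ?thesis
    using that[of w "cnj f"] f(1) w(1) ww ff by (simp add: mult.commute)
qed

lemma gauss_unit_power4:
  assumes "e \<in> gauss" "e * cnj e = 1"
  shows "e ^ 4 = 1"
proof -
  obtain a b :: int where e: "e = Complex (of_int a) (of_int b)" using gaussE[OF assms(1)] .
  have "of_int (a\<^sup>2 + b\<^sup>2) = (1 :: real)"
    using arg_cong[OF assms(2), of Re] by (simp add: e power2_eq_square)
  then have ab: "a\<^sup>2 + b\<^sup>2 = 1" by (simp only: of_int_eq_1_iff)
  have sq: "a\<^sup>2 \<ge> 0" "b\<^sup>2 \<ge> 0" by auto
  consider "a\<^sup>2 = 0" "b\<^sup>2 = 1" | "a\<^sup>2 = 1" "b\<^sup>2 = 0" using ab sq by linarith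
  then have "e\<^sup>2 = 1 \<or> e\<^sup>2 = -1"
  proof cases
    case 1
    have "e\<^sup>2 = - of_int (b\<^sup>2)" using 1(1)
      by (simp add: e complex_eq_iff power2_eq_square)
    then show ?thesis using 1 by simp
  next
    case 2
    have "e\<^sup>2 = of_int (a\<^sup>2)" using 2(2)
      by (simp add: e complex_eq_iff power2_eq_square)
    then show ?thesis using 2 by simp
  qed
  moreover have "e ^ 4 = e\<^sup>2 * e\<^sup>2" by (simp flip: power_add)
  ultimately show ?thesis
    by (elim disjE) (simp_all only: mult_minus_left mult_1 minus_minus)
qed

text \<open>p^2 = 1 modulo 4, so a fourth root of unity e is the p-th power of e^p. This absorbs the
  unit in front of w^p, and it makes \<i> the p-th power of \<i>^p.\<close>

lemma power4_unit_odd: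
  fixes e :: complex
  assumes "e ^ 4 = 1" "odd p"
  shows "(e ^ p) ^ p = e"
proof -
  obtain j where p: "p = 2 * j + 1" using assms(2) by (elim oddE)
  have "p * p = 4 * (j * j + j) + 1" by (simp add: p algebra_simps)
  then have "(e ^ p) ^ p = e ^ (4 * (j * j + j) + 1)"
    by (simp only: power_mult[symmetric])
  also have "\<dots> = (e ^ 4) ^ (j * j + j) * e" by (simp only: power_add power_mult power_one_right)
  finally show ?thesis by (simp add: assms(1))
qed

lemma gauss_parametrization:
  fixes x y Q p :: nat
  assumes eq: "x\<^sup>2 + Q\<^sup>2 = 2 * y ^ p" and cop: "coprime x Q" and Q: "odd Q" and p: "odd p"
    and y: "odd y"
  obtains w where "w \<in> gauss" "w * cnj w = of_nat y"
    "Complex (of_nat x) (of_nat Q) = (1 + \<i>) * w ^ p"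
proof -
  have p0: "p > 0" using p by (cases p) auto
  have "even (x\<^sup>2 + Q\<^sup>2)" using eq by simp
  then have x: "odd x" using Q by simp
  obtain j where j: "x = 2 * j + 1" using x by (elim oddE)
  obtain k where k: "Q = 2 * k + 1" using Q by (elim oddE)
  \<comment> \<open>z = X / (1 + i) for X = x + i Q; the division is exact because x and Q are
    odd.\<close>
  define z where "z = Complex (of_int (int j + int k + 1)) (of_int (int k - int j))"
  have z: "z \<in> gauss" unfolding z_def by (rule gauss_ComplexI)
  have X: "Complex (of_nat x) (of_nat Q) = (1 + \<i>) * z"
    by (simp add: z_def complex_eq_iff j k)
  have "2 * (z * cnj z) = ((1 + \<i>) * z) * cnj ((1 + \<i>) * z)"
    by (simp add: algebra_simps)
  also have "\<dots> = of_nat (x\<^sup>2 + Q\<^sup>2)"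
    unfolding X[symmetric] by (simp add: complex_eq_iff power2_eq_square)
  finally have norm: "z * cnj z = of_nat y ^ p" by (simp add: eq)
  obtain s t :: int where st: "s * int x + t * int Q = 1"
    using bezout_int[of "int x" "int Q"] cop by auto
  \<comment> \<open>This is X + cnj X, and \<open>X2\<close> is the same for - i X, as (1 - i) / (1
    + i) = - i. Bezout for x and Q then combines z and cnj z to 2.\<close>
  have X1: "(1 + \<i>) * z + (1 - \<i>) * cnj z = 2 * of_nat x"
    by (simp add: z_def complex_eq_iff j k)
  have X2: "(1 - \<i>) * z + (1 + \<i>) * cnj z = 2 * of_nat Q"
    by (simp add: z_def complex_eq_iff j k)
  define r0 s0 where "r0 = of_int s * (1 + \<i>) + of_int t * (1 - \<i>)"
    and "s0 = of_int s * (1 - \<i>) + of_int t * (1 + \<i>)"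
  have "r0 * z + s0 * cnj z = of_int s * ((1 + \<i>) * z + (1 - \<i>) * cnj z)
      + of_int t * ((1 - \<i>) * z + (1 + \<i>) * cnj z)"
    by (simp add: r0_def s0_def algebra_simps)
  also have "\<dots> = 2 * of_int (s * int x + t * int Q)" unfolding X1 X2 by simp
  finally have bez: "r0 * z + s0 * cnj z = 2" unfolding st by simp
  have "r0 \<in> gauss" "s0 \<in> gauss" by (simp_all add: r0_def s0_def)
  then obtain w e where w: "w \<in> gauss" "e \<in> gauss" "w * cnj w = of_nat y" "e * cnj e = 1" "z = e * w ^ p"
    using gauss_nth_power[OF z norm p0 y _ _ bez] by blast
  define w' where "w' = e ^ p * w"
  have "w' ^ p = (e ^ p) ^ p * w ^ p" by (simp add: w'_def power_mult_distrib)
  also have "\<dots> = z" using power4_unit_odd[OF gauss_unit_power4[OF w(2,4)] p] w(5) by simp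
  finally have 1: "w' ^ p = z" .
  have "w' * cnj w' = (e * cnj e) ^ p * (w * cnj w)"
    by (simp add: w'_def power_mult_distrib)
  then have 2: "w' * cnj w' = of_nat y" by (simp add: w)
  have 3: "w' \<in> gauss" using w(1,2) by (simp add: w'_def)
  show ?thesis using that[OF 3 2] 1 X by simp
qed

text \<open>In the expansion in powers of a i the terms k = 0 and k = 2 are real, k = 1 gives p a
  b^(p-1), and all others contain a^3. If p divides a, then p divides t: the binomial coefficients
  for 3 <= k < p are multiples of p, and the term k = p still contains a^(p-3).\<close>

lemma Im_gauss_power:
  fixes a b :: int and p :: nat
  assumes p: "prime p" "p > 3"
  obtains t :: int where "Im (Complex (of_int b) (of_int a) ^ p) = of_int (a * (int p * b ^ (p - 1) + a\<^sup>2 * t))"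
    "int p dvd a \<Longrightarrow> int p dvd t"
proof -
  define c where "c = (\<lambda>k. \<lfloor>Im (\<i> ^ k)\<rfloor>)"
  have c: "Im (\<i> ^ k) = of_int (c k)" for k
  proof -
    have "\<i> ^ k \<in> gauss" by simp
    then show ?thesis unfolding c_def gauss_def by (auto elim!: Ints_cases)
  qed
  define f where "f = (\<lambda>k. int (p choose k) * a ^ k * b ^ (p - k) * c k)"
  have ba: "Complex (of_int b) (of_int a) = of_int a * \<i> + of_int b"
    by (simp add: complex_eq_iff)
  have trm: "Im (of_nat (p choose k) * (of_int a * \<i>) ^ k * of_int b ^ (p - k)) = of_int (f k)" for k
  proof -
    have "of_nat (p choose k) * (of_int a * \<i>) ^ k * of_int b ^ (p - k)
       = of_real (of_int (int (p choose k) * a ^ k * b ^ (p - k))) * \<i> ^ k"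
      by (simp add: power_mult_distrib algebra_simps)
    moreover have "Im (of_real r * z) = r * Im z" for r z by simp
    ultimately show ?thesis by (simp only: c f_def of_int_mult)
  qed
  have "Im (Complex (of_int b) (of_int a) ^ p) = of_int (\<Sum>k\<le>p. f k)"
    unfolding ba binomial_ring by (simp add: trm del: times_complex.simps)
  also have "(\<Sum>k\<le>p. f k) = (\<Sum>k<3. f k) + (\<Sum>k=3..p. f k)"
  proof -
    have "{..p} = {..<3} \<union> {3..p}" using p(2) by auto
    then show ?thesis by (simp add: sum.union_disjoint ivl_disj_int)
  qed
  also have "(\<Sum>k<3. f k) = a * (int p * b ^ (p - 1))"
    by (simp add: f_def c_def eval_nat_numeral)
  also have "(\<Sum>k=3..p. f k) = a ^ 3 * (\<Sum>k=3..p. int (p choose k) * a ^ (k - 3) * b ^ (p - k) * c k)"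
    unfolding sum_distrib_left
  proof (rule sum.cong)
    fix k assume "k \<in> {3..p}"
    then have "a ^ k = a ^ 3 * a ^ (k - 3)" by (simp flip: power_add)
    then show "f k = a ^ 3 * (int (p choose k) * a ^ (k - 3) * b ^ (p - k) * c k)"
      by (simp add: f_def)
  qed simp
  also have "a * (int p * b ^ (p - 1)) + a ^ 3 * (\<Sum>k=3..p. int (p choose k) * a ^ (k - 3) * b ^ (p - k) * c k)
    = a * (int p * b ^ (p - 1) + a\<^sup>2 * (\<Sum>k=3..p. int (p choose k) * a ^ (k - 3) * b ^ (p - k) * c k))"
    by (simp add: algebra_simps eval_nat_numeral)
  finally show ?thesis
  proof (rule that)
    assume pa: "int p dvd a"
    show "int p dvd (\<Sum>k=3..p. int (p choose k) * a ^ (k - 3) * b ^ (p - k) * c k)"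
    proof (rule dvd_sum)
      fix k assume k: "k \<in> {3..p}"
      show "int p dvd int (p choose k) * a ^ (k - 3) * b ^ (p - k) * c k"
      proof (cases "k = p")
        case True
        have "int p dvd a ^ (p - 3)" using pa p(2) by (simp add: dvd_power_iff dvd_trans[OF pa dvd_power])
        then show ?thesis using True by (intro dvd_mult2 dvd_mult) auto
      next
        case False
        then have "p dvd (p choose k)" using k p by (intro dvd_choose_prime) auto
        then have "int p dvd int (p choose k)" by simp
        then show ?thesis by (intro dvd_mult2)
      qed
    qed
  qed
qed

text \<open>(1 + i)^(2h) = 2^h i^h is real only for even h; for odd h the factor i^(2h+1)
  compensates, as 3h + 1 is even. With p = 2h + 1 this makes the p-th power of \<kappa> (1 + i) w
  equal to +-2^h X.\<close>

lemma one_plus_i_power: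
  fixes h :: nat
  obtains \<kappa> \<sigma> :: complex where "\<kappa> = 1 \<or> \<kappa> = \<i>" "\<sigma> = 1 \<or> \<sigma> = -1"
    "\<kappa> ^ (2 * h + 1) * (1 + \<i>) ^ (2 * h) = \<sigma> * 2 ^ h"
proof -
  have "(1 + \<i>) ^ 2 = 2 * \<i>" by (simp add: power2_eq_square algebra_simps)
  then have *: "(1 + \<i>) ^ (2 * h) = 2 ^ h * \<i> ^ h" 
    by (simp only: power_mult power_mult_distrib)
  show ?thesis
  proof (cases "even h")
    case True
    then obtain k where k: "h = 2 * k" by (elim evenE)
    have "\<i> ^ h = (-1) ^ k" by (simp add: k power_mult)
    then show ?thesis using * that[of 1 "(-1) ^ k"] by (cases "even k") auto
  next
    case False
    then obtain k where k: "h = 2 * k + 1" by (elim oddE)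
    have "\<i> ^ (2 * h + 1) * \<i> ^ h = \<i> ^ (2 * (3 * k + 2))"
      unfolding k by (simp only: power_add[symmetric]) (simp add: algebra_simps)
    also have "\<dots> = (-1) ^ (3 * k + 2)" by (simp add: power_mult)
    finally have **: "\<i> ^ (2 * h + 1) * \<i> ^ h = (-1) ^ (3 * k + 2)" .
    have "\<i> ^ (2 * h + 1) * (1 + \<i>) ^ (2 * h) = (\<i> ^ (2 * h + 1) * \<i> ^ h) * 2 ^ h"
      by (simp only: *) (simp add: mult_ac)
    also have "\<dots> = (-1) ^ (3 * k + 2) * 2 ^ h" unfolding ** ..
    finally have "\<i> ^ (2 * h + 1) * (1 + \<i>) ^ (2 * h) = (-1) ^ (3 * k + 2) * 2 ^ h" .
    moreover have "(-1) ^ (3 * k + 2) = (1 :: complex) \<or> (-1) ^ (3 * k + 2) = (-1 :: complex)"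
      by (cases "even k") auto
    ultimately show ?thesis using that[of \<i> "(-1) ^ (3 * k + 2)"] by blast
  qed
qed

subsection \<open>Descent to near roots of unity\<close>

lemma odd_y_and_coprime:
  fixes x y m q p :: nat
  assumes eq: "x\<^sup>2 + q ^ (2 * m) = 2 * y ^ p" and cop: "coprime x y"
    and p: "p > 3" and q: "prime q" "odd q" and m: "m > 0"
  shows "odd y" "coprime x (q ^ m)" "\<not> q dvd y"
proof -
  have eq': "x\<^sup>2 + (q ^ m)\<^sup>2 = 2 * y ^ p" using eq by (simp add: power_mult mult.commute)
  have "odd (q ^ m)" using q by simp
  moreover have "even (x\<^sup>2 + (q ^ m)\<^sup>2)" using eq' by simp
  ultimately have "odd x" by simp
  then obtain j where j: "x = 2 * j + 1" by (elim oddE)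
  obtain k where k: "q ^ m = 2 * k + 1" using \<open>odd (q ^ m)\<close> by (elim oddE)
  have "2 * y ^ p = 2 * (2 * (j\<^sup>2 + j + k\<^sup>2 + k) + 1)"
    unfolding eq'[symmetric] j k by (simp add: power2_eq_square algebra_simps)
  then have "y ^ p = 2 * (j\<^sup>2 + j + k\<^sup>2 + k) + 1" by (subst (asm) mult_left_cancel) auto
  then have "odd (y ^ p)" by simp
  then show "odd y" using p by simp
  show nqy: "\<not> q dvd y"
  proof
    assume qy: "q dvd y"
    have "y dvd y ^ p" using p by (intro dvd_power) auto
    then have "q dvd 2 * y ^ p" using qy by (metis dvd_mult dvd_trans)
    moreover have "q dvd q ^ (2 * m)" using m by (intro dvd_power) auto
    ultimately have "q dvd x\<^sup>2" unfolding eq[symmetric] using dvd_add_left_iff by blast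
    then have "q dvd x" using q prime_dvd_power by blast
    then show False using cop qy q by (meson coprime_common_divisor not_prime_unit)
  qed
  have "\<not> q dvd x"
  proof
    assume "q dvd x"
    then have "q dvd x\<^sup>2 + q ^ (2 * m)" using m by (auto intro!: dvd_add dvd_power simp: power2_eq_square)
    then have "q dvd 2 * y ^ p" unfolding eq .
    then show False using q nqy
      by (metis prime_dvd_mult_iff prime_dvd_power primes_dvd_imp_eq two_is_prime_nat)
  qed
  then show "coprime x (q ^ m)" using q by (metis coprime_commute coprime_power_left_iff prime_imp_coprime)
qed

text \<open>|a| = q^k with k > 0, and the cofactor U of a satisfies |U| = 2^h q^(m-k). As q divides
  a but not b, a factor q of U = p b^(p-1) + a^2 t forces q = p; then p^2 divides a^2 t but not p
  b^(p-1), so it does not divide U. Hence q^(m-k) <= p.\<close>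

lemma prime_power_le_of_Im:
  fixes y m q p :: nat
  assumes p: "prime p" "p > 3" and q: "prime q" "odd q" and y: "odd y" "\<not> q dvd y"
    and ns: "\<nexists>t::int. int y = t\<^sup>2 + (t + 1)\<^sup>2"
    and ab: "a\<^sup>2 + b\<^sup>2 = 2 * int y"
    and Im: "\<bar>Im (Complex (of_int b) (of_int a) ^ p)\<bar> = 2 ^ h * real q ^ m"
  shows "real q ^ m \<le> real p * \<bar>of_int a\<bar>"
proof -
  obtain t where t: "Im (Complex (of_int b) (of_int a) ^ p) = of_int (a * (int p * b ^ (p - 1) + a\<^sup>2 * t))"
    "int p dvd a \<Longrightarrow> int p dvd t"
    using Im_gauss_power[OF p] by blast
  define U where "U = int p * b ^ (p - 1) + a\<^sup>2 * t"
  have "real_of_int \<bar>a * U\<bar> = real_of_int (2 ^ h * int q ^ m)"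
    using Im unfolding t(1) U_def[symmetric] by simp
  then have aU: "\<bar>a\<bar> * \<bar>U\<bar> = 2 ^ h * int q ^ m" by (simp only: of_int_eq_iff abs_mult)
  have oa: "odd a"
  proof
    assume "even a"
    then have "even (b\<^sup>2)" using ab by (metis dvd_triv_left even_add even_power zero_less_numeral)
    then have "even b" by simp
    from \<open>even a\<close> \<open>even b\<close> obtain a' b' where "a = 2 * a'" "b = 2 * b'" by (elim evenE)
    then have "int y = 2 * (a'\<^sup>2 + b'\<^sup>2)" using ab by (simp add: power2_eq_square)
    then have "even (int y)" by simp
    then show False using y by simp
  qed
  have na: "\<bar>a\<bar> \<noteq> 1"
  proof
    assume a1: "\<bar>a\<bar> = 1"
    then have "a\<^sup>2 = 1" by (metis power2_abs one_power2)
    moreover have "even (a\<^sup>2 + b\<^sup>2)" unfolding ab by simp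
    ultimately have "odd (b\<^sup>2)" by (metis even_add odd_one)
    then have "odd b" by simp
    then obtain s where s: "b = 2 * s + 1" by (elim oddE)
    have "2 * int y = 2 * (s\<^sup>2 + (s + 1)\<^sup>2)"
      unfolding ab[symmetric] \<open>a\<^sup>2 = 1\<close> s by (simp add: power2_eq_square algebra_simps)
    then have "int y = s\<^sup>2 + (s + 1)\<^sup>2" by (subst (asm) mult_left_cancel) auto
    then show False using ns by blast
  qed
  have "coprime a (2 ^ h)" using oa by simp
  moreover have "a dvd 2 ^ h * int q ^ m" using aU by (metis abs_dvd_iff dvd_triv_left)
  ultimately have "a dvd int q ^ m" using coprime_dvd_mult_right_iff by blast
  then have "nat \<bar>a\<bar> dvd q ^ m" by (metis int_dvd_int_iff abs_dvd_iff int_nat_eq abs_ge_zero of_nat_power nat_0_le)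
  then obtain k where k: "k \<le> m" "nat \<bar>a\<bar> = q ^ k" using divides_primepow_nat[OF q(1)] by blast
  have ak: "\<bar>a\<bar> = int q ^ k" using k(2) by (metis abs_ge_zero int_nat_eq of_nat_power)
  have k0: "k > 0" using na ak by (cases k) auto
  have qa: "int q dvd a" using ak k0 by (metis abs_dvd_iff dvd_abs_iff dvd_power)
  have "int q ^ m = int q ^ k * int q ^ (m - k)" using k(1) by (simp flip: power_add)
  then have "int q ^ k * \<bar>U\<bar> = int q ^ k * (2 ^ h * int q ^ (m - k))" using aU ak by simp
  moreover have q0: "int q ^ k \<noteq> 0" using q by (auto simp: prime_gt_0_nat)
  ultimately have U: "\<bar>U\<bar> = 2 ^ h * int q ^ (m - k)" by (subst (asm) mult_left_cancel) auto
  have qb: "\<not> int q dvd b"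
  proof
    assume "int q dvd b"
    then have "int q dvd a\<^sup>2 + b\<^sup>2" using qa by (simp add: power2_eq_square)
    then have "int q dvd 2 * int y" unfolding ab .
    then have "q dvd 2 * y" by (metis int_dvd_int_iff of_nat_mult of_nat_numeral)
    then show False using q y by (metis prime_dvd_mult_iff primes_dvd_imp_eq two_is_prime_nat dvd_refl)
  qed
  have le: "q ^ (m - k) \<le> p"
  proof (cases "m - k")
    case 0
    then show ?thesis using p by simp
  next
    case (Suc j)
    then have "int q dvd \<bar>U\<bar>" unfolding U by simp
    then have "int q dvd U" by simp
    then have "int q dvd int p * b ^ (p - 1)"
      unfolding U_def using qa by (metis dvd_add_left_iff dvd_mult2 power2_eq_square)
    then have "int q dvd int p"
      using qb q(1) by (metis prime_dvd_mult_iff prime_dvd_power prime_nat_int_transfer)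
    then have [simp]: "q = p" using p q by (simp add: primes_dvd_imp_eq)
    have "j = 0"
    proof (rule ccontr)
      assume "j \<noteq> 0"
      then have "int p * int p dvd int p ^ (m - k)" using Suc by (cases j) auto
      then have "int p * int p dvd \<bar>U\<bar>" unfolding U by simp
      then have "int p * int p dvd int p * b ^ (p - 1) + a\<^sup>2 * t" by (simp add: U_def)
      moreover have "int p * int p dvd a\<^sup>2 * t"
        using qa by (auto simp: power2_eq_square intro: dvd_mult2 mult_dvd_mono)
      ultimately have "int p * int p dvd int p * b ^ (p - 1)" using dvd_add_left_iff by blast
      then have "int p dvd b ^ (p - 1)" using p by (simp add: dvd_mult_cancel_left)
      then show False using qb p by (metis \<open>q = p\<close> prime_dvd_power prime_nat_int_transfer)
    qed
    then show ?thesis using Suc by simp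
  qed
  have "real q ^ m = real q ^ k * real (q ^ (m - k))" using k(1) by (simp flip: power_add)
  also have "real q ^ k = \<bar>of_int a\<bar>" using arg_cong[OF ak, of real_of_int] by simp
  also have "\<bar>real_of_int a\<bar> * real (q ^ (m - k)) \<le> \<bar>of_int a\<bar> * real p"
    using le by (intro mult_left_mono) (simp_all del: of_nat_power)
  finally show ?thesis by (simp add: mult.commute)
qed

text \<open>For a solution \<open>X = x + i q\<^sup>m = (1 + i) w\<^sup>p\<close> with \<open>p\<close> odd, this is a \<open>p\<close>-th root of \<open>X / cnj X\<close>,
  because \<open>(1 + i) / (1 - i) = i = (i\<^sup>p)\<^sup>p\<close>.\<close>

definition unit_quot :: "nat \<Rightarrow> complex \<Rightarrow> complex" where
  "unit_quot p w = \<i> ^ p * w / cnj w"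

text \<open>What is kept of a solution. The bound comes from |X / cnj X - 1| = 2 q^m / |X|, |X| =
  sqrt 2 |w|^p and q^m <= p |a| <= sqrt 2 p |w|, which eliminates q and m. That the p-th power
  differs from 1 reflects q^m > 0.\<close>

definition near_root :: "nat \<Rightarrow> complex \<Rightarrow> bool" where
  "near_root p w \<longleftrightarrow> w \<in> gauss \<and> 1 < cmod w \<and> unit_quot p w ^ p \<noteq> 1 \<and>
     cmod (unit_quot p w ^ p - 1) \<le> 2 * real p / cmod w ^ (p - 1)"

lemma solution_imp_near_root:
  fixes x y m q p :: nat
  assumes eq: "x\<^sup>2 + q ^ (2 * m) = 2 * y ^ p" and cop: "coprime x y"
    and p: "prime p" "p > 3" and q: "prime q" "odd q" and m: "m > 0"
    and ns: "\<nexists>t::int. int y = t\<^sup>2 + (t + 1)\<^sup>2"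
  obtains w where "near_root p w" "(cmod w)\<^sup>2 = real y"
proof -
  note oy = odd_y_and_coprime[OF eq cop p(2) q m]
  have op: "odd p" using p by (simp add: prime_odd_nat)
  define Q where "Q = q ^ m"
  have Q: "odd Q" "coprime x Q" using q oy by (auto simp: Q_def)
  have eqQ: "x\<^sup>2 + Q\<^sup>2 = 2 * y ^ p" using eq by (simp add: Q_def power_mult mult.commute)
  obtain w where w: "w \<in> gauss" "w * cnj w = of_nat y"
    "Complex (of_nat x) (of_nat Q) = (1 + \<i>) * w ^ p"
    using gauss_parametrization[OF eqQ Q(2,1) op oy(1)] by blast
  have "q \<ge> 3" using q prime_ge_2_nat[OF q(1)] by (cases "q = 2") auto
  then have Q3: "Q \<ge> 3" unfolding Q_def using m by (metis le_trans self_le_power one_le_numeral)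
  have y3: "y \<ge> 3"
  proof (rule ccontr)
    assume "\<not> y \<ge> 3"
    then have "y = 1" using oy(1) by (cases "y = 0"; cases "y = 2") auto
    then have "Q\<^sup>2 \<le> 2" using eqQ by simp
    moreover have "3\<^sup>2 \<le> Q\<^sup>2" using Q3 by (intro power_mono) auto
    ultimately show False by simp
  qed
  have cw: "(cmod w)\<^sup>2 = real y"
    using w(2) by (metis complex_norm_square of_real_eq_iff of_real_of_nat_eq)
  have w0: "w \<noteq> 0" "cmod w > 0" using cw y3 by auto
  obtain h where h: "p = 2 * h + 1" using op by (elim oddE)
  obtain \<kappa> \<sigma> :: complex where ks: "\<kappa> = 1 \<or> \<kappa> = \<i>" "\<sigma> = 1 \<or> \<sigma> = -1"
    "\<kappa> ^ (2 * h + 1) * (1 + \<i>) ^ (2 * h) = \<sigma> * 2 ^ h"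
    using one_plus_i_power by blast
  define \<beta> where "\<beta> = \<kappa> * (1 + \<i>) * w"
  have "\<beta> \<in> gauss" unfolding \<beta>_def using w ks(1) by auto
  then obtain b a where ba: "\<beta> = Complex (of_int b) (of_int a)" by (rule gaussE)
  have nk: "cmod \<kappa> = 1" using ks(1) by auto
  have n1i: "cmod (1 + \<i>) = sqrt 2" by (simp add: cmod_def)
  have nb: "(cmod \<beta>)\<^sup>2 = 2 * real y"
    by (simp add: \<beta>_def norm_mult nk n1i power_mult_distrib cw)
  have "real_of_int (a\<^sup>2 + b\<^sup>2) = real_of_int (2 * int y)"
    using nb unfolding ba cmod_power2 by simp
  then have ab: "a\<^sup>2 + b\<^sup>2 = 2 * int y" by (simp only: of_int_eq_iff)
  have "\<beta> ^ p = (\<kappa> ^ (2 * h + 1) * (1 + \<i>) ^ (2 * h)) * ((1 + \<i>) * w ^ p)"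
    by (simp add: \<beta>_def h power_mult_distrib mult_ac)
  also have "\<dots> = \<sigma> * of_real (2 ^ h) * Complex (of_nat x) (of_nat Q)" unfolding ks(3) w(3) by simp
  finally have bp: "\<beta> ^ p = \<sigma> * of_real (2 ^ h) * Complex (of_nat x) (of_nat Q)" .
  have "\<bar>Im (\<sigma> * of_real (2 ^ h) * Complex (of_nat x) (of_nat Q))\<bar> = 2 ^ h * real Q"
    using ks(2)
  proof (elim disjE)
    assume "\<sigma> = 1"
    then show ?thesis by (simp del: of_real_power)
  next
    assume "\<sigma> = -1"
    then show ?thesis by (simp del: of_real_power)
  qed
  then have "\<bar>Im (\<beta> ^ p)\<bar> = 2 ^ h * real Q" unfolding bp .
  then have "\<bar>Im (Complex (of_int b) (of_int a) ^ p)\<bar> = 2 ^ h * real q ^ m"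
    unfolding ba Q_def by simp
  then have Qle: "real Q \<le> real p * \<bar>of_int a\<bar>"
    unfolding Q_def of_nat_power by (rule prime_power_le_of_Im[OF p q oy(1,3) ns ab])
  have "\<bar>of_int a\<bar> \<le> cmod \<beta>" using abs_Im_le_cmod[of \<beta>] by (simp add: ba)
  also have "cmod \<beta> = sqrt 2 * cmod w" by (simp add: \<beta>_def norm_mult nk n1i)
  finally have Qle: "real Q \<le> real p * (sqrt 2 * cmod w)"
    using Qle by (smt (verit) mult_left_mono of_nat_0_le_iff)
  define X where "X = Complex (of_nat x) (of_nat Q)"
  have X0: "X \<noteq> 0" "cnj X \<noteq> 0" using Q3 by (auto simp: X_def complex_eq_iff)
  have cX: "cmod X = sqrt 2 * cmod w ^ p"
    unfolding X_def w(3) norm_mult norm_power n1i ..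
  define u where "u = unit_quot p w"
  have "u ^ p = (\<i> ^ p) ^ p * w ^ p / cnj w ^ p"
    by (simp add: u_def unit_quot_def power_mult_distrib power_divide)
  also have "(\<i> ^ p) ^ p = \<i>" by (rule power4_unit_odd[OF _ op]) simp
  also have "\<i> * w ^ p / cnj w ^ p = X / cnj X"
  proof -
    have "(1 + \<i>) = \<i> * (1 - \<i>)" by (simp add: algebra_simps)
    then have "X = \<i> * ((1 - \<i>) * w ^ p)" unfolding X_def w(3) by (simp only: mult.assoc)
    moreover have "cnj X = (1 - \<i>) * cnj w ^ p" unfolding X_def w(3) by simp
    moreover have "1 - \<i> \<noteq> 0" by (simp add: complex_eq_iff)
    ultimately show ?thesis using w0 by (simp add: field_simps)
  qed
  finally have up: "u ^ p = X / cnj X" .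
  have "u ^ p - 1 = (X - cnj X) / cnj X" using X0 by (simp add: up field_simps)
  then have nup: "cmod (u ^ p - 1) = 2 * real Q / (sqrt 2 * cmod w ^ p)"
    by (simp add: norm_divide cX complex_diff_cnj) (simp add: X_def norm_mult)
  have "u ^ p \<noteq> 1"
  proof
    assume "u ^ p = 1"
    then have "2 * real Q / (sqrt 2 * cmod w ^ p) = 0" using nup by simp
    then show False using Q3 w0 by simp
  qed
  moreover have "cmod (u ^ p - 1) \<le> 2 * real p / cmod w ^ (p - 1)"
  proof -
    have "2 * real Q / (sqrt 2 * cmod w ^ p) \<le> 2 * (real p * (sqrt 2 * cmod w)) / (sqrt 2 * cmod w ^ p)"
      using Qle w0 by (intro divide_right_mono mult_left_mono) auto
    also have "\<dots> = 2 * real p / cmod w ^ (p - 1)"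
      using w0 p by (cases p) (simp_all add: field_simps)
    finally show ?thesis unfolding nup .
  qed
  moreover have "1 < cmod w"
  proof (rule power2_less_imp_less)
    show "1\<^sup>2 < (cmod w)\<^sup>2" using cw y3 by simp
  qed simp
  ultimately show ?thesis using that[OF _ cw] w(1) unfolding near_root_def u_def by blast
qed

subsection \<open>Roots of unity and binomial denominators\<close>

lemma sin_ge_quarter:
  fixes x :: real
  assumes "0 \<le> x" "x \<le> pi / 2"
  shows "x / 4 \<le> sin x"
proof (cases "x \<le> pi / 3")
  case True
  have "sin 0 - 0 / 2 \<le> sin x - x / 2"
  proof (rule DERIV_nonneg_imp_nondecreasing[of 0 x "\<lambda>x. sin x - x / 2"])
    fix t assume t: "0 \<le> t" "t \<le> x"
    have "cos (pi / 3) \<le> cos t" using t True pi_gt_zero by (intro cos_monotone_0_pi_le) auto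
    then have "cos t - 1 / 2 \<ge> 0" by (simp add: cos_60)
    moreover have "((\<lambda>x. sin x - x / 2) has_real_derivative cos t - 1 / 2) (at t)"
      by (auto intro!: derivative_eq_intros)
    ultimately show "\<exists>y. ((\<lambda>x. sin x - x / 2) has_real_derivative y) (at t) \<and> 0 \<le> y" by blast
  qed (use assms in auto)
  then show ?thesis using assms by simp
next
  case False
  have "sin (pi / 6) \<le> sin x" using False assms by (intro sin_monotone_2pi_le) auto
  then show ?thesis using assms pi_less_4 by (simp add: sin_30)
qed

lemma cis_minus_1_ge:
  assumes "\<bar>t\<bar> \<le> pi"
  shows "\<bar>t\<bar> / 4 \<le> cmod (cis t - 1)"
proof -
  have "cmod (cis t - 1) = 2 * \<bar>sin (t / 2)\<bar>"
    using dist_exp_i_1[of t] by (simp add: cis_conv_exp)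
  also have "\<bar>sin (t / 2)\<bar> = \<bar>sin (\<bar>t\<bar> / 2)\<bar>" by (cases "t \<ge> 0") auto
  finally show ?thesis using sin_ge_quarter[of "\<bar>t\<bar> / 2"] assms by simp
qed

lemma cmod_cis_diff_le: "cmod (cis a - cis b) \<le> \<bar>a - b\<bar>"
proof -
  have "cis a - cis b = cis b * (cis (a - b) - 1)"
    by (simp add: algebra_simps cis_mult)
  then have "cmod (cis a - cis b) = 2 * \<bar>sin ((a - b) / 2)\<bar>"
    using dist_exp_i_1[of "a - b"] by (simp add: norm_mult cis_conv_exp[of "a - b"])
  also have "\<dots> \<le> 2 * \<bar>(a - b) / 2\<bar>" by (intro mult_left_mono abs_sin_x_le_abs_x) auto
  finally show ?thesis by simp
qed

text \<open>r is the integer nearest to p \<phi> / (2 pi). It can be p itself, since an argument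
  just below 2 pi rounds up.\<close>

lemma near_root_of_unity:
  assumes "cmod u = 1" "p > 0" "cmod (u ^ p - 1) \<le> \<eta>"
  obtains r :: nat and \<phi> :: real where "r \<le> p" "u = cis \<phi>" "0 \<le> \<phi>" "\<phi> < 2 * pi"
    "\<bar>real p * \<phi> - 2 * pi * real r\<bar> \<le> 4 * \<eta>"
proof -
  define \<phi> where "\<phi> = Arg2pi u"
  have \<phi>: "0 \<le> \<phi>" "\<phi> < 2 * pi" by (auto simp: \<phi>_def Arg2pi_ge_0 Arg2pi_lt_2pi)
  have u: "u = cis \<phi>" using assms(1) Arg2pi_eq[of u] by (simp add: \<phi>_def cis_conv_exp)
  define v where "v = real p * \<phi> / (2 * pi)"
  define r where "r = nat (round v)"
  have v: "0 \<le> v" "v \<le> real p" using \<phi> assms(2) by (auto simp: v_def field_simps)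
  have "round v \<ge> 0" using round_mono[OF v(1)] by simp
  have rr: "real r = of_int (round v)" using \<open>round v \<ge> 0\<close> by (simp add: r_def)
  have "round v \<le> round (real p)" using v(2) by (rule round_mono)
  then have rp: "r \<le> p" by (simp add: r_def)
  define t where "t = real p * \<phi> - 2 * pi * real r"
  have "t = 2 * pi * (v - real r)" by (simp add: t_def v_def field_simps)
  moreover have "\<bar>v - real r\<bar> \<le> 1 / 2"
    unfolding rr using of_int_round_abs_le[of v] by (simp add: abs_minus_commute)
  ultimately have "\<bar>t\<bar> \<le> 2 * pi * (1 / 2)" by (simp add: abs_mult del: times_divide_eq_right)
  then have "\<bar>t\<bar> / 4 \<le> cmod (cis t - 1)" by (intro cis_minus_1_ge) simp
  also have "cis t = u ^ p"
  proof -
    have "cis t = cis (real p * \<phi>) / cis (2 * pi * real r)" by (simp only: t_def cis_divide)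
    also have "cis (2 * pi * real r) = 1" by (simp add: cis_multiple_2pi)
    finally show ?thesis by (simp add: u Complex.DeMoivre)
  qed
  finally have "\<bar>t\<bar> \<le> 4 * \<eta>" using assms(3) by simp
  then show ?thesis using that[OF rp u \<phi>] by (simp add: t_def)
qed

text \<open>The sum is the divided difference of x^j, the coefficient of degree card S - 1 in the
  polynomial that interpolates x^j on S. For j < card S - 1 that polynomial is x^j itself.\<close>

lemma sum_power_div_prod_diff:
  fixes S :: "'a :: field set"
  assumes S: "finite S" "j < card S - 1"
  shows "(\<Sum>x\<in>S. x ^ j / (\<Prod>t\<in>S-{x}. x - t)) = 0"
proof -
  define W where "W = (\<lambda>x. \<Prod>t\<in>S-{x}. x - t)"
  define P where "P = (\<lambda>x. \<Prod>t\<in>S-{x}. [:-t, 1:])"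
  have W0: "W x \<noteq> 0" for x using S by (auto simp: W_def)
  have degP: "degree (P x) = card S - 1" if "x \<in> S" for x
    unfolding P_def using S that by (subst degree_prod_eq_sum_degree) auto
  have lcP: "Polynomial.coeff (P x) (card S - 1) = 1" if "x \<in> S" for x
  proof -
    have "lead_coeff (P x) = 1" unfolding P_def lead_coeff_prod by simp
    then show ?thesis by (simp only: degP[OF that])
  qed
  have polyP: "poly (P x) y = (if x = y then W x else 0)" if "x \<in> S" "y \<in> S" for x y
    using S that by (auto simp: P_def W_def poly_prod intro!: prod.cong)
  define Q where "Q = (\<Sum>x\<in>S. Polynomial.smult (x ^ j / W x) (P x)) - Polynomial.monom 1 j"
  have "poly Q y = 0" if "y \<in> S" for y
  proof -
    have "poly (\<Sum>x\<in>S. Polynomial.smult (x ^ j / W x) (P x)) y = (\<Sum>x\<in>S. if x = y then y ^ j else 0)"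
      unfolding poly_sum using that W0 by (intro sum.cong) (auto simp: polyP)
    then show ?thesis using that S by (simp add: Q_def poly_monom)
  qed
  moreover have "degree Q < card S"
  proof -
    have "degree (\<Sum>x\<in>S. Polynomial.smult (x ^ j / W x) (P x)) \<le> card S - 1"
      using S degP by (intro degree_sum_le) (auto intro: order.trans[OF Polynomial.degree_smult_le])
    then have "degree Q \<le> card S - 1"
      unfolding Q_def using S by (intro degree_diff_le) (auto simp: degree_monom_eq)
    then show ?thesis using S by linarith
  qed
  ultimately have "Q = 0"
  proof (rule_tac ccontr)
    assume "\<And>y. y \<in> S \<Longrightarrow> poly Q y = 0" and deg: "degree Q < card S" and "Q \<noteq> 0"
    then have "card S \<le> card {y. poly Q y = 0}"
      by (intro card_mono poly_roots_finite) auto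
    also have "\<dots> \<le> degree Q" using \<open>Q \<noteq> 0\<close> by (rule card_poly_roots_bound)
    finally show False using deg by simp
  qed
  then have "0 = Polynomial.coeff Q (card S - 1)" by simp
  also have "\<dots> = (\<Sum>x\<in>S. x ^ j / W x)"
    using S lcP by (simp add: Q_def coeff_sum)
  finally show ?thesis by (simp add: W_def)
qed

text \<open>Weak form of Legendre's formula: the multiples of p up to k contribute p^j j! with j = k
  div p, and all other factors are coprime to p. As 2 j <= k, induction gives the exponent j + e <=
  2 j <= k.\<close>

lemma fact_factor_prime:
  fixes p k :: nat
  assumes p: "prime p"
  obtains e m where "fact k = p ^ e * m" "coprime m p" "e \<le> k"
proof (induction k arbitrary: thesis rule: less_induct)
  case (less k)
  show ?case
  proof (cases "k < p")
    case True
    then have "coprime (fact k) p"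
      using p by (metis coprime_commute prime_dvd_fact_iff prime_imp_coprime not_le)
    then show ?thesis using less.prems[of 0 "fact k"] by simp
  next
    case False
    define j where "j = k div p"
    have p2: "p \<ge> 2" using p by (rule prime_ge_2_nat)
    have j: "j < k" "2 * j \<le> k"
    proof -
      have "2 * j \<le> p * j" using p2 by simp
      also have "\<dots> \<le> k" by (simp add: j_def)
      finally show "2 * j \<le> k" .
      then show "j < k" using False p2 by (cases j) auto
    qed
    obtain e m where em: "fact j = p ^ e * m" "coprime m p" "e \<le> j" using less.IH[OF j(1)] by blast
    define A where "A = {i\<in>{1..k}. \<not> p dvd i}"
    have "fact k = (\<Prod>i\<in>{1..k}. i)" by (simp add: fact_prod)
    also have "{1..k} = A \<union> (\<lambda>i. p * i) ` {1..j}"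
    proof -
      have "i \<in> (\<lambda>i. p * i) ` {1..j}" if "p dvd i" "i \<in> {1..k}" for i
        using that p2 by (auto elim!: dvdE simp: j_def less_eq_div_iff_mult_less_eq mult.commute)
      moreover have "p * i \<le> k" if "i \<le> j" for i
        using that p2 by (simp add: j_def less_eq_div_iff_mult_less_eq mult.commute)
      ultimately show ?thesis using p2 by (auto simp: A_def)
    qed
    also have "(\<Prod>i\<in>A \<union> (\<lambda>i. p * i) ` {1..j}. i) = \<Prod>A * (\<Prod>i\<in>{1..j}. p * i)"
      using p2 by (subst prod.union_disjoint) (auto simp: A_def prod.reindex inj_on_def)
    also have "(\<Prod>i\<in>{1..j}. p * i) = p ^ j * fact j"
      by (simp add: prod.distrib fact_prod)
    finally have "fact k = p ^ (j + e) * (\<Prod>A * m)" by (simp add: em(1) power_add mult_ac)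
    moreover have "coprime (\<Prod>A * m) p"
    proof -
      have "coprime (\<Prod>A) p"
        by (rule prod_coprime_left) (use p in \<open>auto simp: A_def, metis coprime_commute prime_imp_coprime\<close>)
      then show ?thesis using em(2) by simp
    qed
    moreover have "j + e \<le> k" using j(2) em(3) by simp
    ultimately show ?thesis by (rule less.prems)
  qed
qed

text \<open>The p-part of k! is covered by p^k. Modulo the part m coprime to p, multiplying each
  factor by the inverse x of p turns the progression into k consecutive integers, whose product is
  divisible by k!.\<close>

lemma fact_dvd_prod_progression:
  fixes c :: int
  assumes p: "prime p"
  shows "fact k dvd int p ^ k * (\<Prod>i<k. c + int p * int i)"
proof -
  obtain e m where em: "fact k = p ^ e * m" "coprime m p" "e \<le> k" using fact_factor_prime[OF p] .
  have fk: "(fact k :: int) = int p ^ e * int m"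
    using arg_cong[OF em(1), of int] by simp
  have cop: "coprime (int p) (int m)" using em(2) by (simp add: coprime_commute)
  then obtain x where x: "[int p * x = 1] (mod int m)" using cong_solve_coprime_int by blast
  have "[x ^ k * (\<Prod>i<k. c + int p * int i) = (\<Prod>i<k. x * c + int i)] (mod int m)"
  proof -
    have "x ^ k * (\<Prod>i<k. c + int p * int i) = (\<Prod>i<k. x * (c + int p * int i))"
      by (simp add: prod.distrib)
    also have "[\<dots> = (\<Prod>i<k. x * c + int i)] (mod int m)"
    proof (rule cong_prod)
      fix i
      have "[x * c + (int p * x) * int i = x * c + 1 * int i] (mod int m)"
        by (intro cong_add cong_mult x cong_refl)
      then show "[x * (c + int p * int i) = x * c + int i] (mod int m)"
        by (simp add: algebra_simps)
    qed
    finally show ?thesis .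
  qed
  moreover have "int m dvd (\<Prod>i<k. x * c + int i)"
  proof -
    have "(fact k :: int) dvd pochhammer (x * c) k" by (rule fact_dvd_pochhammer)
    then have "int m dvd pochhammer (x * c) k" unfolding fk by (rule dvd_mult_right)
    then show ?thesis by (simp add: pochhammer_prod atLeast0LessThan)
  qed
  ultimately have "int m dvd x ^ k * (\<Prod>i<k. c + int p * int i)" using cong_dvd_iff by blast
  moreover have "coprime (int m) (x ^ k)"
  proof -
    have "coprime (int p * x) (int m)" using x by (metis cong_imp_coprime cong_sym coprime_1_left)
    then show ?thesis by (simp add: coprime_commute)
  qed
  ultimately have "int m dvd (\<Prod>i<k. c + int p * int i)" using coprime_dvd_mult_right_iff by blast
  moreover have "int p ^ e dvd int p ^ k" using em(3) by (rule le_imp_power_dvd)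
  ultimately show ?thesis unfolding fk by (intro mult_dvd_mono)
qed

text \<open>One factor p^k clears the fractions in the falling factorial, the other pays for the
  p-part of k!.\<close>

lemma gbinomial_fraction_denominator:
  fixes N s :: int
  assumes p: "prime p"
  shows "real p ^ (2 * k) * ((of_int N + of_int s / real p) gchoose k) \<in> \<int>"
proof -
  have p0: "real p \<noteq> 0" using p by (simp add: prime_gt_0_nat)
  define c where "c = - (int p * N + s)"
  obtain d where d: "int p ^ k * (\<Prod>i<k. c + int p * int i) = fact k * d"
    using fact_dvd_prod_progression[OF p, of k c] by (auto elim: dvdE)
  have "real p ^ k * (\<Prod>i<k. of_int N + of_int s / real p - real i)
      = (\<Prod>i<k. real p * (of_int N + of_int s / real p - real i))" by (simp add: prod.distrib)
  also have "\<dots> = (\<Prod>i<k. (-1) * of_int (c + int p * int i))"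
    using p0 by (intro prod.cong) (auto simp: c_def field_simps)
  also have "\<dots> = (-1) ^ k * of_int (\<Prod>i<k. c + int p * int i)"
    by (subst prod.distrib) simp
  finally have *: "real p ^ k * (\<Prod>i<k. of_int N + of_int s / real p - real i)
     = (-1) ^ k * of_int (\<Prod>i<k. c + int p * int i)" .
  have "fact k * (real p ^ (2 * k) * ((of_int N + of_int s / real p) gchoose k))
     = real p ^ k * (real p ^ k * (\<Prod>i<k. of_int N + of_int s / real p - real i))"
    unfolding mult_2 power_add atLeast0LessThan[symmetric] gbinomial_mult_fact[symmetric]
    by (simp only: mult_ac)
  also have "\<dots> = (-1) ^ k * of_int (int p ^ k * (\<Prod>i<k. c + int p * int i))"
    unfolding * by simp
  also have "\<dots> = fact k * ((-1) ^ k * of_int d)" unfolding d by simp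
  finally have "real p ^ (2 * k) * ((of_int N + of_int s / real p) gchoose k) = of_int ((-1) ^ k * d)" by simp
  then show ?thesis by (metis Ints_of_int)
qed

lemma gbinomial_near_nat_le:
  fixes \<nu> :: real
  assumes "\<bar>\<nu>\<bar> \<le> 1" "k \<le> n"
  shows "\<bar>(real n + \<nu>) gchoose k\<bar> \<le> 2 ^ (n + 1)"
proof -
  have "fact k * \<bar>(real n + \<nu>) gchoose k\<bar> = \<bar>\<Prod>i<k. real n + \<nu> - real i\<bar>"
    using arg_cong[OF gbinomial_mult_fact[of k "real n + \<nu>"], of abs]
    by (simp add: abs_mult atLeast0LessThan)
  also have "\<dots> = (\<Prod>i<k. \<bar>real n + \<nu> - real i\<bar>)" by (rule abs_prod)
  also have "\<dots> \<le> (\<Prod>i<k. real (n + 1) - real i)"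
    using assms by (intro prod_mono) auto
  also have "\<dots> = fact k * (real (n + 1) gchoose k)"
    by (simp only: gbinomial_mult_fact atLeast0LessThan)
  also have "real (n + 1) gchoose k = real ((n + 1) choose k)" by (rule binomial_gbinomial[symmetric])
  finally have "\<bar>(real n + \<nu>) gchoose k\<bar> \<le> real ((n + 1) choose k)" by simp
  also have "\<dots> \<le> real (2 ^ (n + 1))" using binomial_le_pow2[of "n + 1" k] by (simp only: of_nat_le_iff)
  finally show ?thesis by simp
qed

subsection \<open>Pade approximants to binomial functions\<close>

text \<open>Up to a common factor, \<open>pade_coeff \<nu> n h\<close> and \<open>- pade_coeff (-\<nu>) n h\<close> are the weights of the divided
  difference at the nodes \<open>h\<close> and \<open>h + \<nu>\<close>, \<open>h \<le> n\<close>. Divided differences kill polynomials of low degree, so applying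
  this one to \<open>s \<mapsto> exp (z s)\<close> gives a function of \<open>z\<close> that vanishes to order \<open>2 n + 1\<close> at \<open>0\<close>.\<close>

definition pade_coeff :: "real \<Rightarrow> nat \<Rightarrow> nat \<Rightarrow> real" where
  "pade_coeff \<nu> n h = ((real n - \<nu>) gchoose (n - h)) * ((real n + \<nu>) gchoose h)"

lemma prod_lessThan_add:
  fixes f :: "nat \<Rightarrow> 'a :: comm_monoid_mult"
  shows "prod f {..<a + b} = prod f {..<a} * (\<Prod>i<b. f (a + i))"
  by (induction b) (simp_all add: mult_ac)

lemma prod_diff_nat:
  assumes "h \<le> n"
  shows "(\<Prod>j\<in>{..n}-{h}. real h - real j) = (-1) ^ (n - h) * fact h * fact (n - h)"
proof -
  have 1: "(\<Prod>j<h. real h - real j) = fact h"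
    using gbinomial_mult_fact[of h "real h"]
    by (simp add: atLeast0LessThan binomial_gbinomial[symmetric])
  have "(\<Prod>j\<in>{h<..n}. real h - real j) = (\<Prod>i<n - h. real h - real (h + 1 + i))"
    using assms by (intro prod.reindex_bij_witness[of _ "\<lambda>i. h + 1 + i" "\<lambda>j. j - h - 1"]) auto
  also have "\<dots> = (\<Prod>i<n - h. (-1) * real (Suc i))" by (intro prod.cong) auto
  also have "\<dots> = (-1) ^ (n - h) * fact (n - h)"
    by (subst prod.distrib) (simp add: fact_prod_Suc atLeast0LessThan)
  finally have 2: "(\<Prod>j\<in>{h<..n}. real h - real j) = (-1) ^ (n - h) * fact (n - h)" .
  have eq: "{..n} - {h} = {..<h} \<union> {h<..n}" using assms by auto
  have "(\<Prod>j\<in>{..n}-{h}. real h - real j) = (\<Prod>j<h. real h - real j) * (\<Prod>j\<in>{h<..n}. real h - real j)"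
    unfolding eq by (rule prod.union_disjoint) auto
  then show ?thesis by (simp add: 1 2)
qed

text \<open>Up to sign, the groups of n - h, n + 1 and h factors join to one run of 2 n + 1
  consecutive factors, so the right side is independent of h. Hence \<open>pade_coeff\<close> is a
  common constant divided by the product of the differences between one node and all the
  others.\<close>

lemma pade_coeff_weight:
  assumes "h \<le> n"
  shows "pade_coeff \<nu> n h * ((\<Prod>j\<in>{..n}-{h}. real h - real j) * (\<Prod>j\<le>n. real h - \<nu> - real j))
    = (-1) ^ n * (\<Prod>i<2 * n + 1. real n - \<nu> - real i)"
proof -
  let ?f = "\<lambda>i::nat. real n - \<nu> - real i"
  have 1: "fact (n - h) * ((real n - \<nu>) gchoose (n - h)) = (\<Prod>i<n - h. ?f i)"
    by (simp add: gbinomial_mult_fact atLeast0LessThan)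
  have 2: "(\<Prod>j\<le>n. real h - \<nu> - real j) = (\<Prod>i<n + 1. ?f ((n - h) + i))"
    using assms by (simp add: lessThan_Suc_atMost of_nat_diff) (intro prod.cong, auto)
  have "fact h * ((real n + \<nu>) gchoose h) = (\<Prod>i<h. real n + \<nu> - real i)"
    by (simp add: gbinomial_mult_fact atLeast0LessThan)
  also have "\<dots> = (\<Prod>i<h. real n + \<nu> - real (h - Suc i))"
    by (rule prod.nat_diff_reindex[symmetric])
  also have "\<dots> = (\<Prod>i<h. (-1) * ?f ((n - h) + (n + 1) + i))"
    using assms by (intro prod.cong) (auto simp: of_nat_diff)
  also have "\<dots> = (-1) ^ h * (\<Prod>i<h. ?f ((n - h) + (n + 1) + i))"
    by (subst prod.distrib) simp
  finally have 3: "fact h * ((real n + \<nu>) gchoose h) = (-1) ^ h * (\<Prod>i<h. ?f ((n - h) + (n + 1) + i))" .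
  have "pade_coeff \<nu> n h * ((\<Prod>j\<in>{..n}-{h}. real h - real j) * (\<Prod>j\<le>n. real h - \<nu> - real j))
    = (-1) ^ (n - h) * ((fact (n - h) * ((real n - \<nu>) gchoose (n - h))) * (\<Prod>j\<le>n. real h - \<nu> - real j)
       * (fact h * ((real n + \<nu>) gchoose h)))"
    unfolding pade_coeff_def prod_diff_nat[OF assms] by (simp only: mult_ac)
  also have "\<dots> = ((-1) ^ (n - h) * (-1) ^ h) * ((\<Prod>i<n - h. ?f i) * (\<Prod>i<n + 1. ?f ((n - h) + i))
      * (\<Prod>i<h. ?f ((n - h) + (n + 1) + i)))"
    unfolding 1 2 3 by (simp only: mult_ac)
  also have "(\<Prod>i<n - h. ?f i) * (\<Prod>i<n + 1. ?f ((n - h) + i)) = prod ?f {..<(n - h) + (n + 1)}"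
    by (rule prod_lessThan_add[symmetric])
  also have "prod ?f {..<(n - h) + (n + 1)} * (\<Prod>i<h. ?f ((n - h) + (n + 1) + i)) = prod ?f {..<(n - h) + (n + 1) + h}"
    by (rule prod_lessThan_add[symmetric])
  also have "(n - h) + (n + 1) + h = 2 * n + 1" using assms by simp
  also have "(-1) ^ (n - h) * (-1) ^ h = ((-1) ^ n :: real)"
    using assms by (simp flip: power_add)
  finally show ?thesis .
qed

text \<open>Divided difference of s^j at the 2 n + 2 nodes h and h + \<nu>, which are distinct
  because 0 < \<nu> < 1; it vanishes for j < 2 n + 1.\<close>

lemma pade_power_sums:
  assumes \<nu>: "0 < \<nu>" "\<nu> < 1" and j: "j \<le> 2 * n"
  shows "(\<Sum>h\<le>n. pade_coeff \<nu> n h * real h ^ j) = (\<Sum>h\<le>n. pade_coeff (-\<nu>) n h * (real h + \<nu>) ^ j)"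
proof -
  define K where "K = (-1) ^ n * (\<Prod>i<2 * n + 1. real n - \<nu> - real i)"
  have nonint: "real a - \<nu> \<noteq> real b" "real a + \<nu> \<noteq> real b" for a b
  proof -
    have *: "of_int k \<noteq> \<nu>" for k :: int
    proof
      assume "of_int k = \<nu>"
      then have "real_of_int 0 < of_int k" "of_int k < real_of_int 1" using \<nu> by simp_all
      then show False by (simp only: of_int_less_iff)
    qed
    show "real a - \<nu> \<noteq> real b" "real a + \<nu> \<noteq> real b"
      using *[of "int a - int b"] *[of "int b - int a"] by auto
  qed
  have "real n - \<nu> - real i \<noteq> 0" for i
    using nonint(1)[of n i] by simp
  then have K0: "K \<noteq> 0" by (simp add: K_def del: prod.lessThan_Suc)
  \<comment> \<open>Replacing \<nu> by -\<nu> reverses the run of factors and negates each. Their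
    number is odd, whence the minus sign of the weights at the nodes h + \<nu>.\<close>
  have "(\<Prod>i<2 * n + 1. real n - (-\<nu>) - real i) = (\<Prod>i<2 * n + 1. real n + \<nu> - real (2 * n + 1 - Suc i))"
    unfolding diff_minus_eq_add by (rule prod.nat_diff_reindex[symmetric])
  also have "\<dots> = (\<Prod>i<2 * n + 1. (-1) * (real n - \<nu> - real i))"
    by (intro prod.cong) (auto simp: of_nat_diff)
  also have "\<dots> = - (\<Prod>i<2 * n + 1. real n - \<nu> - real i)"
    by (subst prod.distrib) simp
  finally have K': "(-1) ^ n * (\<Prod>i<2 * n + 1. real n - (-\<nu>) - real i) = - K" by (simp add: K_def)
  define S where "S = real ` {..n} \<union> (\<lambda>h. real h + \<nu>) ` {..n}"
  have disj: "real ` A \<inter> (\<lambda>h. real h + \<nu>) ` B = {}" for A B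
    by (auto simp: nonint(2) nonint(2)[THEN not_sym])
  have inj: "inj_on (\<lambda>h. real h + \<nu>) A" "inj_on real A" for A by (auto simp: inj_on_def)
  have cS: "card S = 2 * n + 2"
    unfolding S_def by (subst card_Un_disjoint) (auto simp: disj card_image inj)
  define W where "W = (\<lambda>x. \<Prod>t\<in>S-{x}. x - t)"
  have W1: "W (real h) = (\<Prod>j\<in>{..n}-{h}. real h - real j) * (\<Prod>j\<le>n. real h - \<nu> - real j)"
    if "h \<le> n" for h
  proof -
    have "S - {real h} = real ` ({..n} - {h}) \<union> (\<lambda>h. real h + \<nu>) ` {..n}"
      by (auto simp: S_def nonint(2) nonint(2)[THEN not_sym])
    then have "W (real h) = (\<Prod>t\<in>real ` ({..n} - {h}). real h - t) * (\<Prod>t\<in>(\<lambda>h. real h + \<nu>) ` {..n}. real h - t)"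
      unfolding W_def by (simp only:) (rule prod.union_disjoint, auto simp: disj)
    also have "(\<Prod>t\<in>real ` ({..n} - {h}). real h - t) = (\<Prod>j\<in>({..n} - {h}). real h - real j)"
      by (subst prod.reindex) (auto simp: inj intro!: prod.cong)
    also have "(\<Prod>t\<in>(\<lambda>h. real h + \<nu>) ` {..n}. real h - t) = (\<Prod>j\<in>{..n}. real h - \<nu> - real j)"
      by (subst prod.reindex) (auto simp: inj intro!: prod.cong)
    finally show ?thesis by (simp only: mult.commute)
  qed
  have W2: "W (real h + \<nu>) = (\<Prod>j\<in>{..n}-{h}. real h - real j) * (\<Prod>j\<le>n. real h - (-\<nu>) - real j)"
    if "h \<le> n" for h
  proof -
    have "S - {real h + \<nu>} = real ` {..n} \<union> (\<lambda>h. real h + \<nu>) ` ({..n} - {h})"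
      by (auto simp: S_def nonint(2) nonint(2)[THEN not_sym])
    then have "W (real h + \<nu>) = (\<Prod>t\<in>real ` {..n}. real h + \<nu> - t) * (\<Prod>t\<in>(\<lambda>h. real h + \<nu>) ` ({..n} - {h}). real h + \<nu> - t)"
      unfolding W_def by (simp only:) (rule prod.union_disjoint, auto simp: disj)
    also have "(\<Prod>t\<in>real ` {..n}. real h + \<nu> - t) = (\<Prod>j\<in>{..n}. real h - (-\<nu>) - real j)"
      by (subst prod.reindex) (auto simp: inj intro!: prod.cong)
    also have "(\<Prod>t\<in>(\<lambda>h. real h + \<nu>) ` ({..n} - {h}). real h + \<nu> - t) = (\<Prod>j\<in>({..n} - {h}). real h - real j)"
      by (subst prod.reindex) (auto simp: inj intro!: prod.cong)
    finally show ?thesis by (simp only: mult.commute)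
  qed
  have P1: "pade_coeff \<nu> n h = K / W (real h)" if "h \<le> n" for h
    using pade_coeff_weight[OF that, of \<nu>] K0 unfolding W1[OF that, symmetric] K_def[symmetric]
    by (auto simp: field_simps)
  have P2: "pade_coeff (-\<nu>) n h = - K / W (real h + \<nu>)" if "h \<le> n" for h
  proof -
    have "pade_coeff (-\<nu>) n h * W (real h + \<nu>) = - K"
      using pade_coeff_weight[OF that, of "-\<nu>"] unfolding W2[OF that, symmetric] K' .
    moreover from this have "W (real h + \<nu>) \<noteq> 0" using K0 by auto
    ultimately show ?thesis by (simp only: eq_divide_eq if_False if_True simp_thms)
  qed
  have "0 = K * (\<Sum>x\<in>S. x ^ j / W x)"
    using sum_power_div_prod_diff[of S j] j by (simp add: W_def cS) (simp add: S_def)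
  also have "(\<Sum>x\<in>S. x ^ j / W x) = (\<Sum>h\<le>n. real h ^ j / W (real h)) + (\<Sum>h\<le>n. (real h + \<nu>) ^ j / W (real h + \<nu>))"
    unfolding S_def by (subst sum.union_disjoint) (auto simp: disj sum.reindex inj)
  finally have "0 = K * (\<Sum>h\<le>n. real h ^ j / W (real h)) + K * (\<Sum>h\<le>n. (real h + \<nu>) ^ j / W (real h + \<nu>))"
    by (simp only: distrib_left)
  moreover have "(\<Sum>h\<le>n. pade_coeff \<nu> n h * real h ^ j) = K * (\<Sum>h\<le>n. real h ^ j / W (real h))"
    unfolding sum_distrib_left by (intro sum.cong) (auto simp: P1)
  moreover have "(\<Sum>h\<le>n. pade_coeff (-\<nu>) n h * (real h + \<nu>) ^ j) = - (K * (\<Sum>h\<le>n. (real h + \<nu>) ^ j / W (real h + \<nu>)))"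
    unfolding sum_distrib_left sum_negf[symmetric] by (intro sum.cong) (auto simp: P2)
  ultimately show ?thesis by simp
qed

lemma pade_coeff_abs_le:
  assumes "\<bar>\<nu>\<bar> \<le> 1" "h \<le> n"
  shows "\<bar>pade_coeff \<nu> n h\<bar> \<le> 4 ^ (n + 1)"
proof -
  have "\<bar>pade_coeff \<nu> n h\<bar> \<le> 2 ^ (n + 1) * 2 ^ (n + 1)"
    unfolding pade_coeff_def abs_mult
    using gbinomial_near_nat_le[of "-\<nu>" "n - h" n] gbinomial_near_nat_le[of \<nu> h n] assms
    by (intro mult_mono) auto
  also have "\<dots> = 4 ^ (n + 1)" by (simp flip: power_mult_distrib)
  finally show ?thesis .
qed

lemma pade_coeff_denominator:
  assumes p: "prime p" and h: "h \<le> n" and \<nu>: "\<nu> = 1 / real p \<or> \<nu> = - 1 / real p"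
  shows "real p ^ (2 * n) * pade_coeff \<nu> n h \<in> \<int>"
proof -
  obtain s :: int where s: "\<nu> = of_int s / real p"
    using \<nu> by (metis of_int_1 of_int_minus)
  have "2 * n = 2 * (n - h) + 2 * h" using h by simp
  then have "real p ^ (2 * n) * pade_coeff \<nu> n h
     = (real p ^ (2 * (n - h)) * ((of_int (int n) + of_int (- s) / real p) gchoose (n - h)))
       * (real p ^ (2 * h) * ((of_int (int n) + of_int s / real p) gchoose h))"
    unfolding pade_coeff_def s by (simp only: power_add) simp
  also have "\<dots> \<in> \<int>"
    by (intro Ints_mult gbinomial_fraction_denominator p)
  finally show ?thesis .
qed

text \<open>By hypothesis the Taylor coefficients of order below N vanish. In the others |z|^j <=
  |z|^N, as |z| <= 1.\<close>

lemma exp_sum_high_order: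
  fixes c :: "'i \<Rightarrow> complex" and x :: "'i \<Rightarrow> real"
  assumes I: "finite I" and van: "\<And>j. j < N \<Longrightarrow> (\<Sum>i\<in>I. c i * of_real (x i) ^ j) = 0" and z: "cmod z \<le> 1"
  shows "cmod (\<Sum>i\<in>I. c i * exp (z * of_real (x i))) \<le> cmod z ^ N * (\<Sum>i\<in>I. cmod (c i) * exp \<bar>x i\<bar>)"
proof -
  define f where "f = (\<lambda>j. \<Sum>i\<in>I. c i * ((z * of_real (x i)) ^ j /\<^sub>R fact j))"
  define g where "g = (\<lambda>j. \<Sum>i\<in>I. cmod (c i) * (\<bar>x i\<bar> ^ j /\<^sub>R fact j))"
  have f: "f sums (\<Sum>i\<in>I. c i * exp (z * of_real (x i)))"
    unfolding f_def by (intro sums_sum sums_mult exp_converges)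
  have g: "g sums (\<Sum>i\<in>I. cmod (c i) * exp \<bar>x i\<bar>)"
    unfolding g_def by (intro sums_sum sums_mult exp_converges)
  have le: "cmod (f j) \<le> cmod z ^ N * g j" for j
  proof (cases "j < N")
    case True
    have "f j = (z ^ j / fact j) * (\<Sum>i\<in>I. c i * of_real (x i) ^ j)"
      by (simp add: f_def sum_distrib_left power_mult_distrib scaleR_conv_of_real field_simps)
    then have "f j = 0" using van[OF True] by simp
    then show ?thesis by (auto simp: g_def intro!: mult_nonneg_nonneg sum_nonneg)
  next
    case False
    have "cmod (f j) \<le> (\<Sum>i\<in>I. cmod (c i * ((z * of_real (x i)) ^ j /\<^sub>R fact j)))"
      unfolding f_def by (rule norm_sum)
    also have "\<dots> = cmod z ^ j * g j"
      by (simp add: g_def sum_distrib_left norm_mult norm_power power_mult_distrib mult_ac)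
    also have "\<dots> \<le> cmod z ^ N * g j"
      using False z by (intro mult_right_mono power_decreasing) (auto simp: g_def intro!: sum_nonneg)
    finally show ?thesis .
  qed
  have "cmod (suminf f) \<le> (\<Sum>j. cmod z ^ N * g j)"
    by (rule norm_suminf_le[OF le]) (use g in \<open>auto intro: summable_mult sums_summable\<close>)
  then show ?thesis using f g by (simp add: sums_unique[symmetric] suminf_mult sums_summable)
qed

text \<open>For u = exp z, \<open>pade_poly \<nu> n\<close> and \<open>pade_poly (-\<nu>) n\<close>
  are numerator and denominator of the diagonal Pade approximant to the \<nu>-th power of u at u =
  1.\<close>

definition pade_poly :: "real \<Rightarrow> nat \<Rightarrow> complex poly" where
  "pade_poly \<nu> n = (\<Sum>h\<le>n. Polynomial.monom (of_real (pade_coeff \<nu> n h)) h)"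

lemma poly_pade_poly: "poly (pade_poly \<nu> n) u = (\<Sum>h\<le>n. of_real (pade_coeff \<nu> n h) * u ^ h)"
  by (simp add: pade_poly_def poly_sum poly_monom)

lemma degree_pade_poly_le: "degree (pade_poly \<nu> n) \<le> n"
  unfolding pade_poly_def by (intro degree_sum_le) (auto intro: order.trans[OF Polynomial.degree_monom_le])

lemma pade_poly_bound:
  assumes "\<bar>\<nu>\<bar> \<le> 1" "cmod u \<le> 1"
  shows "cmod (poly (pade_poly \<nu> n) u) \<le> 8 ^ (n + 1)"
proof -
  have "cmod (poly (pade_poly \<nu> n) u) \<le> (\<Sum>h\<le>n. cmod (of_real (pade_coeff \<nu> n h) * u ^ h))"
    unfolding poly_pade_poly by (rule norm_sum)
  also have "\<dots> \<le> (\<Sum>h\<le>n. 4 ^ (n + 1) * 1)"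
    unfolding norm_mult norm_power norm_of_real
    using assms by (intro sum_mono mult_mono pade_coeff_abs_le power_le_one) auto
  also have "\<dots> = real (n + 1) * 4 ^ (n + 1)" by simp
  also have "\<dots> \<le> 2 ^ (n + 1) * 4 ^ (n + 1)"
    by (intro mult_right_mono) (simp_all add: of_nat_less_two_power less_imp_le del: power_Suc of_nat_add of_nat_Suc)
  also have "\<dots> = 8 ^ (n + 1)" by (simp flip: power_mult_distrib)
  finally show ?thesis .
qed

lemma pade_remainder_bound:
  assumes \<nu>: "0 < \<nu>" "\<nu> < 1" and z: "cmod z \<le> 1"
  shows "cmod (poly (pade_poly \<nu> n) (exp z) - exp (z * of_real \<nu>) * poly (pade_poly (-\<nu>) n) (exp z))
     \<le> cmod z ^ (2 * n + 1) * (2 * 24 ^ (n + 1))"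
proof -
  \<comment> \<open>The flag \<open>True\<close> marks the nodes h, \<open>False\<close> the nodes h
    + \<nu>, whose weights enter negated.\<close>
  define I where "I = {..n} \<times> (UNIV :: bool set)"
  define c where "c = (\<lambda>(h, b). complex_of_real (if b then pade_coeff \<nu> n h else - pade_coeff (-\<nu>) n h))"
  define x where "x = (\<lambda>(h, b). if b then real h else real h + \<nu>)"
  have split: "(\<Sum>i\<in>I. F i) = (\<Sum>h\<le>n. F (h, True)) + (\<Sum>h\<le>n. F (h, False))" for F :: "nat \<times> bool \<Rightarrow> 'b :: comm_monoid_add"
    by (simp add: I_def sum.cartesian_product' UNIV_bool sum.distrib add.commute)
  have "(\<Sum>i\<in>I. c i * of_real (x i) ^ j) = 0" if "j < 2 * n + 1" for j
  proof -
    have "(\<Sum>i\<in>I. c i * of_real (x i) ^ j) = of_real ((\<Sum>h\<le>n. pade_coeff \<nu> n h * real h ^ j)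
        - (\<Sum>h\<le>n. pade_coeff (-\<nu>) n h * (real h + \<nu>) ^ j))"
      by (simp add: split c_def x_def sum_negf)
    then show ?thesis using pade_power_sums[OF \<nu>, of j n] that by simp
  qed
  then have "cmod (\<Sum>i\<in>I. c i * exp (z * of_real (x i))) \<le> cmod z ^ (2 * n + 1) * (\<Sum>i\<in>I. cmod (c i) * exp \<bar>x i\<bar>)"
    by (intro exp_sum_high_order z) (simp_all add: I_def)
  also have "(\<Sum>i\<in>I. c i * exp (z * of_real (x i)))
    = poly (pade_poly \<nu> n) (exp z) - exp (z * of_real \<nu>) * poly (pade_poly (-\<nu>) n) (exp z)"
    by (simp add: split c_def x_def poly_pade_poly sum_negf sum_distrib_left exp_of_nat2_mult[symmetric]
        exp_add ring_distribs mult_ac)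
  \<comment> \<open>24 = 2 * 4 * 3: 2^(n+1) bounds the number n + 1 of values h, 4^(n+1) the
    coefficients and 3^(n+1) the exponentials. The separate factor 2 counts the two kinds of
    nodes.\<close>
  also have "(\<Sum>i\<in>I. cmod (c i) * exp \<bar>x i\<bar>) \<le> (\<Sum>i\<in>I. 4 ^ (n + 1) * 3 ^ (n + 1))"
  proof (intro sum_mono mult_mono)
    fix i assume i: "i \<in> I"
    show "cmod (c i) \<le> 4 ^ (n + 1)"
      using i pade_coeff_abs_le[of \<nu> "fst i" n] pade_coeff_abs_le[of "-\<nu>" "fst i" n] \<nu>
      by (auto simp: c_def I_def)
    have "\<bar>x i\<bar> \<le> real (n + 1)" using i \<nu> by (auto simp: x_def I_def)
    then have "exp \<bar>x i\<bar> \<le> exp (real (n + 1))" by simp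
    also have "\<dots> = exp 1 ^ (n + 1)" by (metis exp_of_nat_mult mult.right_neutral)
    also have "\<dots> \<le> 3 ^ (n + 1)" using exp_le by (intro power_mono) auto
    finally show "exp \<bar>x i\<bar> \<le> 3 ^ (n + 1)" .
  qed auto
  also have "\<dots> = 2 * (real (n + 1) * (4 ^ (n + 1) * 3 ^ (n + 1)))"
    by (simp add: I_def card_cartesian_product)
  also have "\<dots> \<le> 2 * (2 ^ (n + 1) * (4 ^ (n + 1) * 3 ^ (n + 1)))"
    by (intro mult_left_mono mult_right_mono) (simp_all add: of_nat_less_two_power less_imp_le del: power_Suc of_nat_add of_nat_Suc)
  also have "2 ^ (n + 1) * (4 ^ (n + 1) * 3 ^ (n + 1)) = (24 :: real) ^ (n + 1)"
    by (simp flip: power_mult_distrib)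
  finally show ?thesis by (simp add: mult_left_mono)
qed

text \<open>The difference D of the two sides has degree at most 2 n + 1 and, being a combination of
  two remainders, vanishes at 1 to order at least 2 n + 1. As D is nonzero at 0, it is a nonzero
  multiple of (u - 1)^(2n+1). So consecutive approximants cannot agree at u.\<close>

lemma pade_poly_det_ne_0:
  assumes \<nu>: "0 < \<nu>" "\<nu> < 1" and u: "u \<noteq> 1"
  shows "poly (pade_poly \<nu> n) u * poly (pade_poly (-\<nu>) (n + 1)) u
       \<noteq> poly (pade_poly \<nu> (n + 1)) u * poly (pade_poly (-\<nu>) n) u"
proof -
  define D where "D = pade_poly \<nu> n * pade_poly (-\<nu>) (n + 1) - pade_poly \<nu> (n + 1) * pade_poly (-\<nu>) n"
  have at0: "poly (pade_poly s m) 0 = of_real ((real m - s) gchoose m)" for s m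
    by (simp add: poly_pade_poly pade_coeff_def power_0_left if_distrib cong: if_cong)
  have g0: "(real m - s) gchoose m \<noteq> 0" if "\<bar>s\<bar> < 1" for s m
  proof -
    have "(\<Prod>i<m. real m - s - real i) > 0"
    proof (rule prod_pos)
      fix i assume "i \<in> {..<m}"
      then have "real i + 1 \<le> real m" by auto
      then show "real m - s - real i > 0" using that by linarith
    qed
    then show ?thesis using gbinomial_mult_fact[of m "real m - s"]
      by (metis atLeast0LessThan less_irrefl mult_zero_right)
  qed
  have gS: "(real (n + 1) - s) gchoose (n + 1) = (real (n + 1) - s) / real (n + 1) * ((real n - s) gchoose n)" for s
    using gbinomial_factors[of "real n - s" n] by (simp add: algebra_simps)
  have "poly D 0 = of_real (((real n - \<nu>) gchoose n) * ((real n + \<nu>) gchoose n) * (2 * \<nu> / real (n + 1)))"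
  proof -
    have *: "a * ((d + \<nu>) / d * b) - ((d - \<nu>) / d * a) * b = a * b * (2 * \<nu> / d)"
      if "d \<noteq> 0" for a b d :: real using that by (simp add: field_simps)
    have "poly D 0 = of_real (((real n - \<nu>) gchoose n) * ((real (n + 1) + \<nu>) / real (n + 1) * ((real n + \<nu>) gchoose n))
      - ((real (n + 1) - \<nu>) / real (n + 1) * ((real n - \<nu>) gchoose n)) * ((real n + \<nu>) gchoose n))"
      unfolding D_def poly_diff poly_mult at0 gS by (simp only: of_real_mult of_real_diff diff_minus_eq_add)
    then show ?thesis by (subst (asm) *) auto
  qed
  moreover have "((real n - \<nu>) gchoose n) * ((real n + \<nu>) gchoose n) * (2 * \<nu> / real (n + 1)) \<noteq> 0"
    using g0[of \<nu> n] g0[of "-\<nu>" n] \<nu> by auto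
  ultimately have D0: "poly D 0 \<noteq> 0" by (metis of_real_eq_0_iff)
  then have "D \<noteq> 0" by auto
  define k where "k = Polynomial.order 1 D"
  obtain E where E: "D = [:-1, 1:] ^ k * E" "\<not> [:-1, 1:] dvd E"
    using order_decomp[OF \<open>D \<noteq> 0\<close>, of 1] unfolding k_def by auto
  have E1: "poly E 1 \<noteq> 0" using E(2) by (simp add: poly_eq_0_iff_dvd)
  define C where "C = 2 * 24 ^ (n + 2) * 8 ^ (n + 2) * (2 :: real)"
  \<comment> \<open>The order of vanishing at 1 is read off along u = exp (-t) for small t > 0,
    where the remainder bound applies.\<close>
  have Dle: "cmod (poly D (exp (- of_real t))) \<le> t ^ (2 * n + 1) * C" if t: "0 < t" "t \<le> 1" for t :: real
  proof -
    define z where "z = complex_of_real (- t)"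
    have z: "cmod z = t" using t by (simp add: z_def)
    have ez: "exp z = of_real (exp (- t))" unfolding z_def by (rule exp_of_real)
    have ez1: "cmod (exp z) \<le> 1" unfolding ez using t by simp
    define G where "G = (\<lambda>m. poly (pade_poly \<nu> m) (exp z) - exp (z * of_real \<nu>) * poly (pade_poly (-\<nu>) m) (exp z))"
    have G: "cmod (G m) \<le> t ^ (2 * n + 1) * (2 * 24 ^ (n + 2))" if "n \<le> m" "m \<le> n + 1" for m
    proof -
      have "cmod (G m) \<le> t ^ (2 * m + 1) * (2 * 24 ^ (m + 1))"
        unfolding G_def z[symmetric] using t z by (intro pade_remainder_bound \<nu>) simp
      also have "\<dots> \<le> t ^ (2 * n + 1) * (2 * 24 ^ (n + 2))"
        using t that by (intro mult_mono power_decreasing power_increasing) auto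
      finally show ?thesis .
    qed
    have B: "cmod (poly (pade_poly (-\<nu>) m) (exp z)) \<le> 8 ^ (n + 2)" if "m \<le> n + 1" for m
    proof -
      have "cmod (poly (pade_poly (-\<nu>) m) (exp z)) \<le> 8 ^ (m + 1)"
        using \<nu> ez1 by (intro pade_poly_bound) auto
      also have "\<dots> \<le> 8 ^ (n + 2)" using that by (intro power_increasing) auto
      finally show ?thesis .
    qed
    have "poly D (exp z) = G n * poly (pade_poly (-\<nu>) (n + 1)) (exp z) - G (n + 1) * poly (pade_poly (-\<nu>) n) (exp z)"
      by (simp add: D_def G_def algebra_simps)
    then have "cmod (poly D (exp z)) \<le> cmod (G n) * cmod (poly (pade_poly (-\<nu>) (n + 1)) (exp z))
        + cmod (G (n + 1)) * cmod (poly (pade_poly (-\<nu>) n) (exp z))"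
      by (metis norm_mult norm_triangle_ineq4)
    also have "\<dots> \<le> (t ^ (2 * n + 1) * (2 * 24 ^ (n + 2))) * 8 ^ (n + 2) + (t ^ (2 * n + 1) * (2 * 24 ^ (n + 2))) * 8 ^ (n + 2)"
      using t by (intro add_mono mult_mono G B) auto
    also have "\<dots> = t ^ (2 * n + 1) * C" by (simp add: C_def)
    finally show ?thesis by (simp add: z_def)
  qed
  have kn: "2 * n + 1 \<le> k"
  proof (rule ccontr)
    assume nk: "\<not> 2 * n + 1 \<le> k"
    \<comment> \<open>If the order k were at most 2 n, division by |u - 1|^k >= (t/2)^k would give
      E(u) = O(t), although E(1) is not 0.\<close>
    have le: "cmod (poly E (exp (- of_real t))) \<le> C * 2 ^ k * t" if t: "0 < t" "t \<le> 1" for t :: real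
    proof -
      define x where "x = exp (- complex_of_real t)"
      have x: "x = of_real (exp (- t))" unfolding x_def of_real_minus[symmetric] by (rule exp_of_real)
      have "1 + t \<le> exp t" by (rule exp_ge_add_one_self)
      then have "exp (- t) \<le> inverse (1 + t)"
        unfolding exp_minus using t by (intro le_imp_inverse_le) auto
      also have "\<dots> \<le> 1 - t / 2"
      proof -
        have "(1 - t / 2) * (1 + t) = 1 + t * (1 - t) / 2" by (simp add: field_simps)
        moreover have "t * (1 - t) \<ge> 0" using t by simp
        ultimately have "1 \<le> (1 - t / 2) * (1 + t)" by simp
        then show ?thesis using t by (simp add: inverse_eq_divide pos_divide_le_eq)
      qed
      finally have "t / 2 \<le> 1 - exp (- t)" by simp
      also have "1 - exp (- t) = cmod (x - 1)"
      proof -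
        have "x - 1 = of_real (exp (- t) - 1)" by (simp add: x)
        then show ?thesis using t by (simp only: norm_of_real) simp
      qed
      finally have "(t / 2) ^ k \<le> cmod (x - 1) ^ k" using t by (intro power_mono) auto
      then have "(t / 2) ^ k * cmod (poly E x) \<le> cmod (x - 1) ^ k * cmod (poly E x)"
        by (rule mult_right_mono) simp
      also have "\<dots> = cmod (poly D x)"
        by (simp add: E(1) norm_mult norm_power)
      also have "\<dots> \<le> t ^ (2 * n + 1) * C" unfolding x_def by (rule Dle[OF t])
      also have "\<dots> \<le> t ^ (k + 1) * C" using t nk
        by (intro mult_right_mono power_decreasing) (auto simp: C_def)
      finally have "t ^ k * cmod (poly E x) \<le> t ^ k * (C * 2 ^ k * t)"
      proof -
        assume "(t / 2) ^ k * cmod (poly E x) \<le> t ^ (k + 1) * C"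
        then have "2 ^ k * ((t / 2) ^ k * cmod (poly E x)) \<le> 2 ^ k * (t ^ (k + 1) * C)"
          by (rule mult_left_mono) simp
        then show ?thesis by (simp add: power_divide mult_ac)
      qed
      then show ?thesis unfolding x_def using t by simp
    qed
    define e where "e = (\<lambda>m. 1 / real (Suc m))"
    have e0: "e \<longlonglongrightarrow> 0" unfolding e_def by (rule LIMSEQ_Suc[OF lim_1_over_n])
    have "(\<lambda>m. cmod (poly E (exp (- of_real (e m))))) \<longlonglongrightarrow> cmod (poly E (exp (- of_real 0)))"
      by (intro tendsto_intros e0)
    moreover have "(\<lambda>m. C * 2 ^ k * e m) \<longlonglongrightarrow> C * 2 ^ k * 0" by (intro tendsto_intros e0)
    moreover have "cmod (poly E (exp (- of_real (e m)))) \<le> C * 2 ^ k * e m" for m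
      by (intro le) (auto simp: e_def)
    ultimately have "cmod (poly E (exp (- of_real 0))) \<le> C * 2 ^ k * 0"
      by (intro LIMSEQ_le) auto
    then show False using E1 by simp
  qed
  have "degree D \<le> 2 * n + 1"
    unfolding D_def
    using degree_pade_poly_le[of \<nu> n] degree_pade_poly_le[of \<nu> "n + 1"]
      degree_pade_poly_le[of "-\<nu>" n] degree_pade_poly_le[of "-\<nu>" "n + 1"]
    by (intro degree_diff_le order.trans[OF degree_mult_le]) auto
  moreover have "degree D = k + degree E"
    using E(1) \<open>D \<noteq> 0\<close> by (metis degree_linear_power degree_mult_eq mult_eq_0_iff)
  ultimately have "degree E = 0" using kn by simp
  then obtain c where c: "E = [:c:]" by (metis degree_eq_zeroE)
  have "poly D u = (u - 1) ^ k * c" by (simp add: E(1) c)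
  then have "poly D u \<noteq> 0" using u E1 c by simp
  then show ?thesis by (simp add: D_def)
qed

lemma norm_unit_quot: "w \<noteq> 0 \<Longrightarrow> cmod (unit_quot p w) = 1"
  by (simp add: unit_quot_def norm_mult norm_divide norm_power)

text \<open>p^(2n) clears the coefficients. As \<open>cnj (unit_quot p w)\<close> is a unit times
  cnj w / w, the powers of its p-th power up to the n-th have denominators dividing w^(p n).\<close>

lemma pade_poly_gauss:
  assumes p: "prime p" and \<nu>: "\<nu> = 1 / real p \<or> \<nu> = - 1 / real p" and w: "w \<in> gauss" "w \<noteq> 0"
  shows "of_nat p ^ (2 * n) * w ^ (p * n) * poly (pade_poly \<nu> n) (cnj (unit_quot p w) ^ p) \<in> gauss"
proof -
  have "of_nat p ^ (2 * n) * w ^ (p * n) * (of_real (pade_coeff \<nu> n h) * (cnj (unit_quot p w) ^ p) ^ h) \<in> gauss"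
    if h: "h \<le> n" for h
  proof -
    obtain a where a: "real p ^ (2 * n) * pade_coeff \<nu> n h = of_int a"
      using pade_coeff_denominator[OF p h \<nu>] by (auto elim: Ints_cases)
    have "p * n = p * h + p * (n - h)" using h by (simp flip: distrib_left)
    then have "w ^ (p * n) = w ^ (p * h) * w ^ (p * (n - h))" by (simp only: power_add)
    moreover have "(cnj (unit_quot p w) ^ p) ^ h = ((-\<i>) ^ p * cnj w) ^ (p * h) / w ^ (p * h)"
      by (simp add: unit_quot_def power_mult[symmetric] power_divide)
    ultimately have "w ^ (p * n) * (cnj (unit_quot p w) ^ p) ^ h = ((-\<i>) ^ p * cnj w) ^ (p * h) * w ^ (p * (n - h))"
      using w by simp
    then have "of_nat p ^ (2 * n) * w ^ (p * n) * (of_real (pade_coeff \<nu> n h) * (cnj (unit_quot p w) ^ p) ^ h)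
       = of_real (real p ^ (2 * n) * pade_coeff \<nu> n h) * (((-\<i>) ^ p * cnj w) ^ (p * h) * w ^ (p * (n - h)))"
      by (simp add: mult_ac)
    also have "\<dots> \<in> gauss" unfolding a using w by simp
    finally show ?thesis .
  qed
  then show ?thesis unfolding poly_pade_poly sum_distrib_left by (intro gauss_sum) simp
qed

subsection \<open>Finiteness for a fixed exponent\<close>

lemma near_root_angle:
  assumes "near_root p w" "p > 0"
  obtains r :: nat and \<phi> :: real where "r \<le> p" "unit_quot p w = cis \<phi>" "0 \<le> \<phi>" "\<phi> < 2 * pi"
    "\<bar>real p * \<phi> - 2 * pi * real r\<bar> \<le> 8 * real p / cmod w ^ (p - 1)"
proof -
  have "w \<noteq> 0" using assms(1) by (auto simp: near_root_def)
  then have "cmod (unit_quot p w) = 1" by (rule norm_unit_quot)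
  then obtain r \<phi> where "r \<le> p" "unit_quot p w = cis \<phi>" "0 \<le> \<phi>" "\<phi> < 2 * pi"
    "\<bar>real p * \<phi> - 2 * pi * real r\<bar> \<le> 4 * (2 * real p / cmod w ^ (p - 1))"
    using near_root_of_unity[OF _ assms(2)] assms(1) unfolding near_root_def by blast
  then show ?thesis using that by simp
qed

lemma unit_quot_near_cis:
  assumes "unit_quot p w = cis \<phi>" "\<bar>real p * \<phi> - 2 * pi * real r\<bar> \<le> 8 * real p / cmod w ^ (p - 1)" "p > 0"
  shows "\<bar>\<phi> - 2 * pi * real r / real p\<bar> \<le> 8 / cmod w ^ (p - 1)"
    "cmod (unit_quot p w - cis (2 * pi * real r / real p)) \<le> 8 / cmod w ^ (p - 1)"
proof -
  have "\<bar>\<phi> - 2 * pi * real r / real p\<bar> = \<bar>real p * \<phi> - 2 * pi * real r\<bar> / real p"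
    using assms(3) by (simp add: field_simps abs_if)
  also have "\<dots> \<le> (8 * real p / cmod w ^ (p - 1)) / real p"
    using assms by (intro divide_right_mono) auto
  also have "\<dots> = 8 / cmod w ^ (p - 1)" using assms(3) by simp
  finally show 1: "\<bar>\<phi> - 2 * pi * real r / real p\<bar> \<le> 8 / cmod w ^ (p - 1)" .
  then show "cmod (unit_quot p w - cis (2 * pi * real r / real p)) \<le> 8 / cmod w ^ (p - 1)"
    unfolding assms(1) using cmod_cis_diff_le order.trans by blast
qed

text \<open>Multiplied by p^(2n) w0^(p n) cnj w0 cnj w1, the form becomes a nonzero Gaussian
  integer.\<close>

lemma pade_form_lower_bound:
  assumes p: "prime p" and w: "w0 \<in> gauss" "w1 \<in> gauss" "w0 \<noteq> 0" "w1 \<noteq> 0"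
    and u: "u = cnj (unit_quot p w0) ^ p"
    and nz: "unit_quot p w0 * poly (pade_poly (1 / real p) n) u \<noteq> unit_quot p w1 * poly (pade_poly (-1 / real p) n) u"
  shows "1 \<le> real p ^ (2 * n) * (cmod w0 ^ (p * n + 1) * cmod w1) *
    cmod (unit_quot p w0 * poly (pade_poly (1 / real p) n) u - unit_quot p w1 * poly (pade_poly (-1 / real p) n) u)"
proof -
  let ?A = "poly (pade_poly (1 / real p) n) u" and ?B = "poly (pade_poly (-1 / real p) n) u"
  let ?S = "unit_quot p w0 * ?A - unit_quot p w1 * ?B"
  define M where "M = of_nat p ^ (2 * n) * w0 ^ (p * n) * (cnj w0 * cnj w1) * ?S"
  have p0: "real p > 0" using p by (simp add: prime_gt_0_nat)
  have cu: "cnj w0 * unit_quot p w0 = \<i> ^ p * w0" "cnj w1 * unit_quot p w1 = \<i> ^ p * w1"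
    using w by (auto simp: unit_quot_def)
  have "M = (of_nat p ^ (2 * n) * w0 ^ (p * n) * ?A) * ((cnj w0 * unit_quot p w0) * cnj w1)
      - (of_nat p ^ (2 * n) * w0 ^ (p * n) * ?B) * ((cnj w1 * unit_quot p w1) * cnj w0)"
    unfolding M_def by (simp only: right_diff_distrib mult_ac)
  then have "M = (of_nat p ^ (2 * n) * w0 ^ (p * n) * ?A) * (\<i> ^ p * w0 * cnj w1)
      - (of_nat p ^ (2 * n) * w0 ^ (p * n) * ?B) * (\<i> ^ p * w1 * cnj w0)"
    unfolding cu .
  moreover have "of_nat p ^ (2 * n) * w0 ^ (p * n) * ?A \<in> gauss" "of_nat p ^ (2 * n) * w0 ^ (p * n) * ?B \<in> gauss"
    unfolding u using w by (intro pade_poly_gauss[OF p]; simp)+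
  ultimately have "M \<in> gauss" using w by simp
  moreover have "M \<noteq> 0" using nz w p0 by (simp add: M_def)
  ultimately have "1 \<le> cmod M" by (rule gauss_norm_ge_1)
  then show ?thesis by (simp add: M_def norm_mult norm_power mult_ac)
qed

text \<open>With Y = |w0| = V^2 and Z = |w1|, a nonzero form \<open>S n\<close> would give 1 <=
  C^(n+1) Y^(p n + 1) Z (1 / Y^((p-1)(2n+1)) + 1 / Z^(p-1)). The window for Z, about Y^(2N), makes
  both terms smaller than 1/2 for n = N - 1 and n = N; for p = 5 this is roughly 5 n + 2 N < 8 n and
  5 n < 6 N. So both forms vanish, against \<open>pade_poly_det_ne_0\<close>.\<close>

lemma two_near_roots_false:
  fixes p N r :: nat
  assumes p: "prime p" "p > 3" and w0: "near_root p w0" and w1: "near_root p w1"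
    and \<phi>0: "unit_quot p w0 = cis \<phi>0" "\<bar>real p * \<phi>0 - 2 * pi * real r\<bar> \<le> 8 * real p / cmod w0 ^ (p - 1)"
    and \<phi>1: "unit_quot p w1 = cis \<phi>1" "\<bar>real p * \<phi>1 - 2 * pi * real r\<bar> \<le> 8 * real p / cmod w1 ^ (p - 1)"
    and V: "cmod w0 = V\<^sup>2" "V \<ge> 2 * (3072 * real p ^ 4)"
    and N: "N \<ge> 17" "V ^ (4 * (N - 1)) \<le> cmod w1" "cmod w1 < V ^ (4 * N)"
  shows False
proof -
  define Y Z where "Y = cmod w0" and "Z = cmod w1"
  \<comment> \<open>3072 = 8^2 * 2 * 24, with 8 p from the bound for \<Lambda> and 24^(n+1) from the
    Pade remainder; p^4 collects (8 p)^2 and the denominator p^(2n).\<close>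
  define C where "C = 3072 * real p ^ 4"
  have p5: "p \<ge> 5"
  proof -
    have "odd p" using p by (simp add: prime_odd_nat)
    then have "p \<noteq> 4" by auto
    then show ?thesis using p(2) by simp
  qed
  have "1 ^ 4 \<le> real p ^ 4" using p5 by (intro power_mono) auto
  then have C1: "C \<ge> 1" "C \<ge> 3072" by (auto simp: C_def)
  have V1: "V \<ge> 1" "V > 1" "V \<ge> 2 * C" using V(2) C1 by (auto simp: C_def)
  have YV: "Y = V\<^sup>2" using V by (simp add: Y_def)
  have Y1: "Y > 1" and Z1: "Z > 1" using w0 w1 by (auto simp: Y_def Z_def near_root_def)
  define \<nu> where "\<nu> = 1 / real p"
  have \<nu>: "0 < \<nu>" "\<nu> < 1" "-1 / real p = - \<nu>" using p5 by (auto simp: \<nu>_def)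
  define \<Lambda> where "\<Lambda> = real p * \<phi>0 - 2 * pi * real r"
  define z where "z = - (\<i> * complex_of_real \<Lambda>)"
  define u where "u = cnj (unit_quot p w0) ^ p"
  have zn: "cmod z = \<bar>\<Lambda>\<bar>" by (simp add: z_def norm_mult)
  have \<Lambda>: "\<bar>\<Lambda>\<bar> \<le> 8 * real p / Y ^ (p - 1)" using \<phi>0(2) by (simp add: \<Lambda>_def Y_def)
  have "8 * real p / Y ^ (p - 1) \<le> 1"
  proof -
    have "8 * real p \<le> C"
    proof -
      have "real p \<le> real p ^ 4" using p5 by (intro self_le_power) auto
      then show ?thesis unfolding C_def by linarith
    qed
    also have "C \<le> V" using V1 C1 by linarith
    also have "V \<le> Y" unfolding YV power2_eq_square using V1 by simp
    also have "Y \<le> Y ^ (p - 1)" using Y1 p5 by (intro self_le_power) auto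
    finally show ?thesis using Y1 by simp
  qed
  then have z1: "cmod z \<le> 1" unfolding zn using \<Lambda> by linarith
  have ez: "exp z = u"
  proof -
    have "exp z = cis (- \<Lambda>)" by (simp add: z_def cis_conv_exp)
    also have "\<dots> = cis (2 * pi * real r) * cis (real p * (- \<phi>0))"
      by (simp only: cis_mult) (simp add: \<Lambda>_def)
    also have "cis (2 * pi * real r) = 1" by (intro cis_multiple_2pi) auto
    also have "cis (real p * (- \<phi>0)) = u"
      unfolding u_def \<phi>0(1) cis_cnj by (rule Complex.DeMoivre[symmetric])
    finally show ?thesis by simp
  qed
  have u1: "u \<noteq> 1"
  proof
    assume "u = 1"
    then have "cnj (unit_quot p w0 ^ p) = cnj 1" by (simp add: u_def)
    then have "unit_quot p w0 ^ p = 1" by (simp only: complex_cnj_cancel_iff)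
    then show False using w0 by (simp add: near_root_def)
  qed
  have un: "cmod u = 1" by (simp add: u_def norm_power \<phi>0(1))
  define \<zeta> where "\<zeta> = cis (2 * pi * real r / real p)"
  have uz: "unit_quot p w0 * exp (z * of_real \<nu>) = \<zeta>"
  proof -
    have "z * of_real \<nu> = \<i> * of_real (- \<Lambda> * \<nu>)" by (simp add: z_def)
    then have "exp (z * of_real \<nu>) = cis (- \<Lambda> * \<nu>)" by (simp only: cis_conv_exp)
    then have "unit_quot p w0 * exp (z * of_real \<nu>) = cis (\<phi>0 + (- \<Lambda> * \<nu>))"
      by (simp only: \<phi>0(1) cis_mult)
    also have "\<phi>0 + (- \<Lambda> * \<nu>) = 2 * pi * real r / real p"
      using p5 by (simp add: \<Lambda>_def \<nu>_def field_simps)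
    finally show ?thesis by (simp add: \<zeta>_def)
  qed
  have d1: "cmod (unit_quot p w1 - \<zeta>) \<le> 8 / Z ^ (p - 1)"
    unfolding \<zeta>_def Z_def using p5 by (intro unit_quot_near_cis(2)[OF \<phi>1]) auto
  define A B where "A = (\<lambda>n. poly (pade_poly \<nu> n) u)" and "B = (\<lambda>n. poly (pade_poly (-\<nu>) n) u)"
  define S where "S = (\<lambda>n. unit_quot p w0 * A n - unit_quot p w1 * B n)"
  have main: "S n = 0" if n: "N \<le> n + 1" "n \<le> N" for n
  proof (rule ccontr)
    assume "S n \<noteq> 0"
    then have 1: "1 \<le> real p ^ (2 * n) * (Y ^ (p * n + 1) * Z) * cmod (S n)"
    proof -
      have ww: "w0 \<in> gauss" "w1 \<in> gauss" "w0 \<noteq> 0" "w1 \<noteq> 0"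
        using w0 w1 by (auto simp: near_root_def)
      have AB: "A n = poly (pade_poly (1 / real p) n) u" "B n = poly (pade_poly (-1 / real p) n) u"
        by (simp_all only: A_def B_def \<nu>(3)) (simp add: \<nu>_def)
      show ?thesis
        using pade_form_lower_bound[OF p(1) ww u_def, of n] \<open>S n \<noteq> 0\<close>
        unfolding AB[symmetric] S_def Y_def Z_def by (simp only: right_minus_eq simp_thms)
    qed
    \<comment> \<open>The form is split at \<zeta>: the first part is the Pade remainder, the second
      the distance between the root of unity and the quotient of w1.\<close>
    have "S n = unit_quot p w0 * (A n - exp (z * of_real \<nu>) * B n) + (\<zeta> - unit_quot p w1) * B n"
      by (simp add: S_def uz[symmetric] algebra_simps)
    then have "cmod (S n) \<le> cmod (unit_quot p w0) * cmod (A n - exp (z * of_real \<nu>) * B n) + cmod (unit_quot p w1 - \<zeta>) * cmod (B n)"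
      by (metis norm_triangle_ineq norm_mult norm_minus_commute)
    also have "\<dots> \<le> 1 * ((8 * real p / Y ^ (p - 1)) ^ (2 * n + 1) * (2 * 24 ^ (n + 1))) + 8 / Z ^ (p - 1) * 8 ^ (n + 1)"
    proof (intro add_mono mult_mono d1)
      have "cmod (A n - exp (z * of_real \<nu>) * B n) \<le> cmod z ^ (2 * n + 1) * (2 * 24 ^ (n + 1))"
        unfolding A_def B_def ez[symmetric] by (rule pade_remainder_bound[OF \<nu>(1,2) z1])
      also have "\<dots> \<le> (8 * real p / Y ^ (p - 1)) ^ (2 * n + 1) * (2 * 24 ^ (n + 1))"
        unfolding zn using \<Lambda> by (intro mult_right_mono power_mono) auto
      finally show "cmod (A n - exp (z * of_real \<nu>) * B n) \<le> \<dots>" .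
      show "cmod (B n) \<le> 8 ^ (n + 1)" unfolding B_def using \<nu> un by (intro pade_poly_bound) auto
      show "cmod (unit_quot p w0) \<le> 1" by (simp add: \<phi>0(1))
    qed (use Z1 in auto)
    finally have 2: "cmod (S n) \<le> (8 * real p / Y ^ (p - 1)) ^ (2 * n + 1) * (2 * 24 ^ (n + 1)) + 8 / Z ^ (p - 1) * 8 ^ (n + 1)"
      by simp
    define K where "K = 3072 * real p ^ 2"
    have pp: "real p ^ 2 \<ge> 1" using p5 by simp
    have "(8 * real p / Y ^ (p - 1)) ^ (2 * n + 1) * (2 * 24 ^ (n + 1)) = (8 * real p) ^ (2 * n + 1) * (2 * 24 ^ (n + 1)) / Y ^ ((p - 1) * (2 * n + 1))"
      by (simp only: power_divide times_divide_eq_left power_mult[of Y, symmetric])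
    also have "(8 * real p) ^ (2 * n + 1) * (2 * 24 ^ (n + 1)) \<le> (8 * real p) ^ (2 * (n + 1)) * (2 ^ (n + 1) * 24 ^ (n + 1))"
      using p5 by (intro mult_mono power_increasing) auto
    also have "\<dots> = K ^ (n + 1)"
      by (simp only: power_mult power_mult_distrib[symmetric] K_def) (simp add: power2_eq_square)
    finally have 3: "(8 * real p / Y ^ (p - 1)) ^ (2 * n + 1) * (2 * 24 ^ (n + 1)) \<le> K ^ (n + 1) / Y ^ ((p - 1) * (2 * n + 1))"
      using Y1 by (simp add: divide_right_mono)
    have "8 * 8 ^ (n + 1) \<le> 8 ^ (n + 1) * (8 :: real) ^ (n + 1)" by (intro mult_right_mono self_le_power) auto
    also have "\<dots> = 64 ^ (n + 1)" by (simp flip: power_mult_distrib)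
    also have "\<dots> \<le> K ^ (n + 1)" using pp by (intro power_mono) (auto simp: K_def)
    finally have "8 * 8 ^ (n + 1) / Z ^ (p - 1) \<le> K ^ (n + 1) / Z ^ (p - 1)"
      using Z1 by (intro divide_right_mono) auto
    then have 4: "8 / Z ^ (p - 1) * 8 ^ (n + 1) \<le> K ^ (n + 1) / Z ^ (p - 1)" by simp
    have 5: "cmod (S n) \<le> K ^ (n + 1) * (1 / Y ^ ((p - 1) * (2 * n + 1)) + 1 / Z ^ (p - 1))"
      using 2 3 4 by (simp add: distrib_left)
    have 6: "real p ^ (2 * n) * K ^ (n + 1) \<le> C ^ (n + 1)"
    proof -
      have "real p ^ (2 * n) * K ^ (n + 1) \<le> real p ^ (2 * (n + 1)) * K ^ (n + 1)"
        using p5 by (intro mult_right_mono power_increasing) (auto simp: K_def)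
      also have "\<dots> = C ^ (n + 1)"
      proof -
        have "(real p)\<^sup>2 * K = C" by (simp add: K_def C_def flip: power_add)
        then show ?thesis by (simp only: power_mult power_mult_distrib[symmetric])
      qed
      finally show ?thesis .
    qed
    have "1 \<le> real p ^ (2 * n) * (Y ^ (p * n + 1) * Z) * (K ^ (n + 1) * (1 / Y ^ ((p - 1) * (2 * n + 1)) + 1 / Z ^ (p - 1)))"
      using 1 5 Y1 Z1 by (smt (verit) mult_left_mono mult_nonneg_nonneg zero_le_power of_nat_0_le_iff)
    also have "\<dots> = (real p ^ (2 * n) * K ^ (n + 1)) * (Y ^ (p * n + 1) * Z * (1 / Y ^ ((p - 1) * (2 * n + 1)) + 1 / Z ^ (p - 1)))"
      by (simp only: mult_ac)
    also have "\<dots> \<le> C ^ (n + 1) * (Y ^ (p * n + 1) * Z * (1 / Y ^ ((p - 1) * (2 * n + 1)) + 1 / Z ^ (p - 1)))"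
      using 6 Y1 Z1 by (intro mult_right_mono) auto
    also have "\<dots> = C ^ (n + 1) * Y ^ (p * n + 1) * Z / Y ^ ((p - 1) * (2 * n + 1)) + C ^ (n + 1) * Y ^ (p * n + 1) * (Z / Z ^ (p - 1))"
      by (simp add: ring_distribs)
    also have "Z / Z ^ (p - 1) = 1 / Z ^ (p - 2)"
    proof -
      have "p - 1 = Suc (p - 2)" using p5 by simp
      then have "Z ^ (p - 1) = Z * Z ^ (p - 2)" by (simp only: power_Suc)
      then show ?thesis using Z1 by simp
    qed
    finally have 7: "1 \<le> C ^ (n + 1) * Y ^ (p * n + 1) * Z / Y ^ ((p - 1) * (2 * n + 1)) + C ^ (n + 1) * Y ^ (p * n + 1) / Z ^ (p - 2)"
      by simp
    \<comment> \<open>V^(n+1), half a power of Y for each step of n, absorbs the constants; this is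
      why sizes are measured in V = sqrt Y.\<close>
    have 8: "2 * C ^ (n + 1) \<le> V ^ (n + 1)"
    proof -
      have "2 * C ^ (n + 1) \<le> 2 ^ (n + 1) * C ^ (n + 1)"
        using C1 by (intro mult_right_mono self_le_power) auto
      also have "\<dots> = (2 * C) ^ (n + 1)" by (rule power_mult_distrib[symmetric])
      also have "\<dots> \<le> V ^ (n + 1)" using V1 C1 by (intro power_mono) auto
      finally show ?thesis .
    qed
    have "2 * (C ^ (n + 1) * Y ^ (p * n + 1) * Z) < Y ^ ((p - 1) * (2 * n + 1))"
    proof -
      have "2 * (C ^ (n + 1) * Y ^ (p * n + 1) * Z) = 2 * C ^ (n + 1) * Y ^ (p * n + 1) * Z" by simp
      also have "\<dots> \<le> V ^ (n + 1) * Y ^ (p * n + 1) * Z"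
        using 8 Y1 Z1 by (intro mult_right_mono) auto
      also have "\<dots> < V ^ (n + 1) * Y ^ (p * n + 1) * V ^ (4 * N)"
        using N(3) V1 Y1 by (intro mult_strict_left_mono) (auto simp: Z_def)
      also have "\<dots> = V ^ (n + 1 + 2 * (p * n + 1) + 4 * N)"
        unfolding YV by (simp only: power_mult[symmetric] power_add[symmetric])
      also have "\<dots> \<le> V ^ (2 * ((p - 1) * (2 * n + 1)))"
      proof (rule power_increasing)
        obtain j where j: "p = j + 5" using p5 by (metis add.commute le_Suc_ex)
        show "n + 1 + 2 * (p * n + 1) + 4 * N \<le> 2 * ((p - 1) * (2 * n + 1))"
          using n by (simp add: j algebra_simps)
      qed (use V1 in auto)
      also have "\<dots> = Y ^ ((p - 1) * (2 * n + 1))" unfolding YV by (simp only: power_mult)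
      finally show ?thesis .
    qed
    then have 9: "C ^ (n + 1) * Y ^ (p * n + 1) * Z / Y ^ ((p - 1) * (2 * n + 1)) < 1 / 2"
      using Y1 by (simp add: pos_divide_less_eq)
    have "2 * (C ^ (n + 1) * Y ^ (p * n + 1)) < Z ^ (p - 2)"
    proof -
      have "2 * (C ^ (n + 1) * Y ^ (p * n + 1)) = 2 * C ^ (n + 1) * Y ^ (p * n + 1)" by simp
      also have "\<dots> \<le> V ^ (n + 1) * Y ^ (p * n + 1)"
        using 8 Y1 by (intro mult_right_mono) auto
      also have "\<dots> = V ^ (n + 1 + 2 * (p * n + 1))"
        unfolding YV by (simp only: power_mult[symmetric] power_add[symmetric])
      also have "\<dots> < V ^ (4 * (N - 1) * (p - 2))"
      proof (rule power_strict_increasing)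
        obtain j where j: "p = j + 5" using p5 by (metis add.commute le_Suc_ex)
        \<comment> \<open>For p = 5 the inequality proved below reads 11 N + 3 < 12 (N - 1), which
          needs N > 15.\<close>
        obtain l where l: "N = l + 17" using N(1) by (metis add.commute le_Suc_ex)
        have "n + 1 + 2 * (p * n + 1) \<le> N + 1 + 2 * (p * N + 1)"
          using n by (intro add_mono mult_left_mono) auto
        also have "\<dots> < 4 * (N - 1) * (p - 2)" by (simp add: j l algebra_simps)
        finally show "n + 1 + 2 * (p * n + 1) < 4 * (N - 1) * (p - 2)" .
      qed (use V1 in auto)
      also have "\<dots> = (V ^ (4 * (N - 1))) ^ (p - 2)" by (simp only: power_mult)
      also have "\<dots> \<le> Z ^ (p - 2)" using N(2) V1 by (intro power_mono) (auto simp: Z_def)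
      finally show ?thesis .
    qed
    then have 10: "C ^ (n + 1) * Y ^ (p * n + 1) / Z ^ (p - 2) < 1 / 2"
      using Z1 by (simp add: pos_divide_less_eq)
    show False using 7 9 10 by linarith
  qed
  obtain n where n: "N = n + 1" using N(1) by (cases N) auto
  have "S n = 0" "S (n + 1) = 0" using main[of n] main[of "n + 1"] n by auto
  then have eqs: "unit_quot p w0 * A n = unit_quot p w1 * B n" "unit_quot p w0 * A (n + 1) = unit_quot p w1 * B (n + 1)"
    by (simp_all add: S_def)
  have "unit_quot p w0 * (A n * B (n + 1)) = (unit_quot p w0 * A n) * B (n + 1)" by simp
  also have "\<dots> = (unit_quot p w0 * A (n + 1)) * B n" unfolding eqs by simp
  finally have "unit_quot p w0 * (A n * B (n + 1)) = unit_quot p w0 * (A (n + 1) * B n)" by simp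
  moreover have "unit_quot p w0 \<noteq> 0" by (simp add: \<phi>0(1))
  ultimately have "A n * B (n + 1) = A (n + 1) * B n" by simp
  then show False using pade_poly_det_ne_0[OF \<nu>(1,2) u1, of n] by (simp add: A_def B_def)
qed

lemma finite_gauss_bounded: "finite {w \<in> gauss. cmod w \<le> R}"
proof -
  define b where "b = \<lceil>R\<rceil>"
  have "{w \<in> gauss. cmod w \<le> R} \<subseteq> (\<lambda>(x, y). Complex (of_int x) (of_int y)) ` ({-b..b} \<times> {-b..b})"
  proof
    fix w assume w: "w \<in> {w \<in> gauss. cmod w \<le> R}"
    then obtain x y where xy: "w = Complex (of_int x) (of_int y)" by (auto elim: gaussE)
    have "\<bar>of_int x\<bar> \<le> R" "\<bar>of_int y\<bar> \<le> R"
      using abs_Re_le_cmod[of w] abs_Im_le_cmod[of w] w by (auto simp: xy)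
    then have "real_of_int \<bar>x\<bar> \<le> R" "real_of_int \<bar>y\<bar> \<le> R" by simp_all
    then have "\<bar>x\<bar> \<le> b" "\<bar>y\<bar> \<le> b" unfolding b_def by linarith+
    then show "w \<in> (\<lambda>(x, y). Complex (of_int x) (of_int y)) ` ({-b..b} \<times> {-b..b})"
      by (auto simp: xy image_iff intro!: bexI[of _ "(x, y)"])
  qed
  then show ?thesis by (rule finite_subset) auto
qed

text \<open>Infinitely many near roots would include infinitely many with the same r, hence of
  unbounded norm. A large one serves as w0 and a much larger one as w1; N is the least exponent with
  |w1| < V^(4N).\<close>

lemma finite_near_root:
  assumes p: "prime p" "p > 3"
  shows "finite {w. near_root p w}"
proof (rule ccontr)
  assume inf: "infinite {w. near_root p w}"
  have p0: "p > 0" using p by simp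
  define Rel where "Rel = (\<lambda>w r. \<exists>\<phi>. unit_quot p w = cis \<phi> \<and> \<bar>real p * \<phi> - 2 * pi * real r\<bar> \<le> 8 * real p / cmod w ^ (p - 1))"
  have "\<exists>r\<in>{..p}. Rel w r" if "near_root p w" for w
    using near_root_angle[OF that p0] unfolding Rel_def by (metis atMost_iff)
  then obtain r where r: "infinite {w \<in> {w. near_root p w}. Rel w r}"
    using pigeonhole_infinite_rel[OF inf, of "{..p}" Rel] by auto
  have unb: "\<exists>w. near_root p w \<and> Rel w r \<and> cmod w > b" for b
  proof (rule ccontr)
    assume "\<not> ?thesis"
    then have "{w \<in> {w. near_root p w}. Rel w r} \<subseteq> {w \<in> gauss. cmod w \<le> b}"
      by (auto simp: near_root_def not_less)
    then show False using r finite_gauss_bounded finite_subset by blast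
  qed
  obtain w0 where w0: "near_root p w0" "Rel w0 r" "cmod w0 > (2 * (3072 * real p ^ 4))\<^sup>2"
    using unb by blast
  define V where "V = sqrt (cmod w0)"
  have V: "cmod w0 = V\<^sup>2" by (simp add: V_def)
  have V2: "V \<ge> 2 * (3072 * real p ^ 4)" unfolding V_def using w0(3) by (intro real_le_rsqrt) simp
  have "1 ^ 4 \<le> real p ^ 4" using p by (intro power_mono) auto
  then have V1: "V > 1" using V2 by simp
  obtain w1 where w1: "near_root p w1" "Rel w1 r" "cmod w1 > V ^ (4 * 16)"
    using unb by blast
  have "\<exists>N. cmod w1 < V ^ (4 * N)"
  proof -
    have "1 < V ^ 4" using V1 by simp
    then obtain N where "cmod w1 < (V ^ 4) ^ N" using real_arch_pow by blast
    then show ?thesis by (auto simp: power_mult)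
  qed
  then obtain N where N: "cmod w1 < V ^ (4 * N)" and least: "\<And>k. k < N \<Longrightarrow> \<not> cmod w1 < V ^ (4 * k)"
    using exists_least_iff[of "\<lambda>N. cmod w1 < V ^ (4 * N)"] by blast
  have "V ^ (4 * 16) < V ^ (4 * N)" using w1(3) N by linarith
  then have "4 * 16 < 4 * N" using V1 power_less_imp_less_exp by blast
  then have N17: "N \<ge> 17" by simp
  have "V ^ (4 * (N - 1)) \<le> cmod w1" using least[of "N - 1"] N17 by simp
  then show False
    using two_near_roots_false[OF p w0(1) w1(1) _ _ _ _ V V2 N17 _ N] w0(2) w1(2) unfolding Rel_def by blast
qed

subsection \<open>Auxiliary functions with small values\<close>

text \<open>Dirichlet's box principle: coefficients in [0, 2^M) form 2^(4 M^2) vectors. Each of the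
  M complex values falls into one of fewer than 2^(4M) square cells of side \<delta>, so two vectors
  share all cells, and their difference is d. Four unknowns per condition pay for two real
  coordinates of relative precision about 4^-M.\<close>

lemma small_integer_combination:
  fixes \<phi> :: "'i \<Rightarrow> nat \<Rightarrow> complex"
  assumes I: "finite I" "card I = 4 * M" and M: "M > 0" and G: "G > 0"
    and \<phi>: "\<And>i n. i \<in> I \<Longrightarrow> n < M \<Longrightarrow> cmod (\<phi> i n) \<le> G"
  obtains d :: "'i \<Rightarrow> int" where "\<forall>i\<in>I. \<bar>d i\<bar> \<le> 2 ^ M" "\<exists>i\<in>I. d i \<noteq> 0"
    "\<forall>n<M. cmod (\<Sum>i\<in>I. of_int (d i) * \<phi> i n) \<le> 8 * real (4 * M) * G / 2 ^ M"
proof -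
  define h :: int where "h = 2 ^ M"
  define N where "N = real (4 * M)"
  \<comment> \<open>Together with Q = 4^(M-1) chosen so that Q \<delta> = N 2^M G, the trivial bound
    for the values, while 2 Q + 1 < 4^M.\<close>
  define \<delta> where "\<delta> = 4 * N * G / 2 ^ M"
  define Q :: int where "Q = 2 ^ (2 * M - 2)"
  have N0: "N > 0" using M by (simp add: N_def)
  have \<delta>: "\<delta> > 0" using N0 G by (simp add: \<delta>_def)
  define A where "A = PiE I (\<lambda>_. {0..<h})"
  define S where "S = (\<lambda>(c :: 'i \<Rightarrow> int) n. \<Sum>i\<in>I. of_int (c i) * \<phi> i n)"
  define f where "f = (\<lambda>c. \<lambda>n\<in>{..<M}. (\<lfloor>Re (S c n) / \<delta>\<rfloor>, \<lfloor>Im (S c n) / \<delta>\<rfloor>))"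
  have Qh: "of_int Q * \<delta> = N * 2 ^ M * G"
  proof -
    have "(4 :: real) * 2 ^ (2 * M - 2) = 2 ^ (2 * M)"
      using M by (cases M) simp_all
    also have "\<dots> = 2 ^ M * 2 ^ M" by (simp add: mult_2 power_add)
    finally have "4 * 2 ^ (2 * M - 2) / 2 ^ M = (2 :: real) ^ M" by simp
    then show ?thesis by (simp add: Q_def \<delta>_def field_simps)
  qed
  have Sb: "cmod (S c n) \<le> of_int Q * \<delta>" if c: "c \<in> A" and n: "n < M" for c n
  proof -
    have "cmod (S c n) \<le> (\<Sum>i\<in>I. cmod (of_int (c i) * \<phi> i n))" unfolding S_def by (rule norm_sum)
    also have "\<dots> \<le> (\<Sum>i\<in>I. 2 ^ M * G)"
    proof (rule sum_mono)
      fix i assume i: "i \<in> I"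
      then have "c i \<in> {0..<h}" using c by (auto simp: A_def)
      then have "\<bar>c i\<bar> \<le> h" by auto
      then have "real_of_int \<bar>c i\<bar> \<le> real_of_int h" by (rule of_int_le_iff[THEN iffD2])
      then have "cmod (of_int (c i)) \<le> 2 ^ M" by (simp add: h_def)
      then show "cmod (of_int (c i) * \<phi> i n) \<le> 2 ^ M * G"
        unfolding norm_mult using \<phi>[OF i n] by (intro mult_mono) auto
    qed
    also have "\<dots> = of_int Q * \<delta>" unfolding Qh by (simp add: I N_def)
    finally show ?thesis .
  qed
  have cell: "\<lfloor>x / \<delta>\<rfloor> \<in> {-Q..Q}" if "\<bar>x\<bar> \<le> of_int Q * \<delta>" for x
  proof -
    have "x / \<delta> \<le> of_int Q" "of_int (-Q) \<le> x / \<delta>"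
      using that \<delta> by (auto simp: pos_divide_le_eq pos_le_divide_eq)
    then show ?thesis by (auto simp: floor_le_iff le_floor_iff)
  qed
  have "f ` A \<subseteq> PiE {..<M} (\<lambda>_. {-Q..Q} \<times> {-Q..Q})"
  proof
    fix g assume "g \<in> f ` A"
    then obtain c where c: "c \<in> A" "g = f c" by auto
    have "\<bar>Re (S c n)\<bar> \<le> of_int Q * \<delta>" "\<bar>Im (S c n)\<bar> \<le> of_int Q * \<delta>" if "n < M" for n
      using Sb[OF c(1) that] abs_Re_le_cmod[of "S c n"] abs_Im_le_cmod[of "S c n"] by linarith+
    then show "g \<in> PiE {..<M} (\<lambda>_. {-Q..Q} \<times> {-Q..Q})"
      unfolding c(2) f_def using cell by auto
  qed
  then have "card (f ` A) \<le> card (PiE {..<M} (\<lambda>_. {-Q..Q} \<times> {-Q..Q}))"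
    by (intro card_mono finite_PiE) auto
  also have "\<dots> = (card {-Q..Q} * card {-Q..Q}) ^ M"
    by (simp only: card_PiE finite_lessThan prod_constant card_cartesian_product card_lessThan)
  also have "\<dots> < card A"
  proof -
    have "Q \<ge> 0" by (simp add: Q_def)
    have "2 * Q + 1 < h\<^sup>2"
    proof -
      have "h\<^sup>2 = 4 * Q"
      proof -
        obtain m where m: "M = Suc m" using M by (cases M) auto
        have "Q = 2 ^ (m + m)" unfolding Q_def m by (rule arg_cong[of _ _ "power 2"]) simp
        then have "Q = 2 ^ m * 2 ^ m" by (simp only: power_add)
        then show ?thesis by (simp add: h_def m power2_eq_square)
      qed
      moreover have "Q \<ge> 1" by (simp add: Q_def)
      ultimately show ?thesis by simp
    qed
    then have "nat (2 * Q + 1) < nat (h\<^sup>2)" by (subst nat_mono_iff) (auto simp: h_def)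
    moreover have "card {-Q..Q} = nat (2 * Q + 1)" by (simp add: algebra_simps)
    moreover have "nat (h\<^sup>2) = nat h ^ 2" by (simp add: nat_power_eq h_def)
    ultimately have c1: "card {-Q..Q} < nat h ^ 2" by simp
    have "(card {-Q..Q} * card {-Q..Q}) < nat h ^ 2 * nat h ^ 2"
      using c1 by (intro mult_strict_mono') auto
    then have "(card {-Q..Q} * card {-Q..Q}) ^ M < (nat h ^ 2 * nat h ^ 2) ^ M"
      using M by (intro power_strict_mono) auto
    also have "\<dots> = nat h ^ card I"
      unfolding I(2) by (simp only: power_add[symmetric] power_mult[symmetric]) (simp add: mult.commute)
    also have "\<dots> = card A" unfolding A_def by (simp add: card_PiE I)
    finally show ?thesis .
  qed
  finally have "\<not> inj_on f A" by (rule pigeonhole)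
  then obtain c c' where cc: "c \<in> A" "c' \<in> A" "c \<noteq> c'" "f c = f c'" by (auto simp: inj_on_def)
  define d where "d = (\<lambda>i. c i - c' i)"
  have 1: "\<bar>d i\<bar> \<le> 2 ^ M" if "i \<in> I" for i
    using PiE_mem[OF cc(1)[unfolded A_def] that] PiE_mem[OF cc(2)[unfolded A_def] that]
    by (auto simp: d_def h_def)
  have 2: "\<exists>i\<in>I. d i \<noteq> 0"
    using cc(1-3) unfolding A_def d_def by (metis PiE_ext eq_iff_diff_eq_0)
  have 3: "cmod (\<Sum>i\<in>I. of_int (d i) * \<phi> i n) \<le> 8 * real (4 * M) * G / 2 ^ M" if n: "n < M" for n
  proof -
    have fl: "\<bar>x - y\<bar> \<le> \<delta>" if "\<lfloor>x / \<delta>\<rfloor> = \<lfloor>y / \<delta>\<rfloor>" for x y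
    proof -
      have "\<bar>x / \<delta> - y / \<delta>\<bar> \<le> 1" using that by linarith
      then have "\<bar>(x - y) / \<delta>\<bar> \<le> 1" by (simp add: diff_divide_distrib)
      then show ?thesis using \<delta> by (simp add: abs_divide)
    qed
    have "f c n = f c' n" using cc(4) by simp
    then have "\<bar>Re (S c n) - Re (S c' n)\<bar> \<le> \<delta>" "\<bar>Im (S c n) - Im (S c' n)\<bar> \<le> \<delta>"
      using n by (auto simp: f_def intro!: fl)
    then have "cmod (S c n - S c' n) \<le> \<delta> + \<delta>"
      using cmod_le[of "S c n - S c' n"] by simp
    also have "S c n - S c' n = (\<Sum>i\<in>I. of_int (d i) * \<phi> i n)"
      by (simp add: S_def d_def sum_subtractf[symmetric] algebra_simps)
    finally show ?thesis by (simp add: \<delta>_def N_def mult_ac)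
  qed
  show ?thesis using that[of d] 1 2 3 by blast
qed

text \<open>The first M Taylor coefficients, scaled to radius R, are made small by the box
  principle. The later ones are small by Cauchy's inequality on radius 4 R: integer coefficients up
  to 2^M times 4^-M give the same saving 2^-M.\<close>

lemma small_combination_on_disc:
  fixes f :: "'i \<Rightarrow> complex \<Rightarrow> complex"
  assumes I: "finite I" "card I = 4 * M" and M: "M > 0" and G: "G > 0" and R: "R > 0"
    and hol: "\<And>i. i \<in> I \<Longrightarrow> f i holomorphic_on UNIV"
    and bnd: "\<And>i z. i \<in> I \<Longrightarrow> cmod z = 4 * R \<Longrightarrow> cmod (f i z) \<le> G"
  obtains d :: "'i \<Rightarrow> int" where "\<forall>i\<in>I. \<bar>d i\<bar> \<le> 2 ^ M" "\<exists>i\<in>I. d i \<noteq> 0"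
    "\<forall>z. cmod z \<le> R \<longrightarrow> cmod (\<Sum>i\<in>I. of_int (d i) * f i z) \<le> 10 * real (4 * M) ^ 2 * G / 2 ^ M"
proof -
  define \<phi> where "\<phi> = (\<lambda>i n. (deriv ^^ n) (f i) 0 / fact n * of_real R ^ n)"
  have \<phi>: "cmod (\<phi> i n) \<le> G / 4 ^ n" if i: "i \<in> I" for i n
  proof -
    have "cmod ((deriv ^^ n) (f i) 0) \<le> fact n * G / (4 * R) ^ n"
    proof (rule Cauchy_inequality)
      show "f i holomorphic_on ball 0 (4 * R)" using hol[OF i] holomorphic_on_subset by blast
      show "continuous_on (cball 0 (4 * R)) (f i)"
        using hol[OF i] holomorphic_on_imp_continuous_on continuous_on_subset by blast
    qed (use R bnd[OF i] in auto)
    then have "cmod ((deriv ^^ n) (f i) 0) / fact n * R ^ n \<le> (fact n * G / (4 * R) ^ n) / fact n * R ^ n"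
      using R by (intro mult_right_mono divide_right_mono) auto
    then have "cmod (\<phi> i n) \<le> (fact n * G / (4 * R) ^ n) / fact n * R ^ n"
      using R by (simp add: \<phi>_def norm_mult norm_divide norm_power)
    also have "\<dots> = G / 4 ^ n" using R by (simp add: power_mult_distrib)
    finally show ?thesis .
  qed
  have \<phi>G: "cmod (\<phi> i n) \<le> G" if "i \<in> I" "n < M" for i n
  proof -
    have "G / 4 ^ n \<le> G / 1" using G by (intro divide_left_mono) auto
    then show ?thesis using \<phi>[OF that(1), of n] by simp
  qed
  obtain d where d: "\<forall>i\<in>I. \<bar>d i\<bar> \<le> 2 ^ M" "\<exists>i\<in>I. d i \<noteq> 0"
    "\<forall>n<M. cmod (\<Sum>i\<in>I. of_int (d i) * \<phi> i n) \<le> 8 * real (4 * M) * G / 2 ^ M"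
    by (rule small_integer_combination[OF I M G, of \<phi>]) (blast intro: \<phi>G)+
  have "cmod (\<Sum>i\<in>I. of_int (d i) * f i z) \<le> 10 * real (4 * M) ^ 2 * G / 2 ^ M" if z: "cmod z \<le> R" for z
  proof -
    define a where "a = (\<lambda>n. (\<Sum>i\<in>I. of_int (d i) * \<phi> i n) * (z / of_real R) ^ n)"
    define N where "N = real (4 * M)"
    have N1: "N \<ge> 1" using M by (simp add: N_def)
    have zR: "cmod (z / of_real R) \<le> 1" using z R by (simp add: norm_divide)
    have "(\<lambda>n. (deriv ^^ n) (f i) 0 / fact n * (z - 0) ^ n) sums f i z" if "i \<in> I" for i
      using hol[OF that] by (intro holomorphic_power_series[of _ _ "cmod z + 1"]) (auto intro: holomorphic_on_subset)
    then have fz: "(\<lambda>n. \<phi> i n * (z / of_real R) ^ n) sums f i z" if "i \<in> I" for i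
      using that R by (simp add: \<phi>_def power_divide)
    have asum: "a sums (\<Sum>i\<in>I. of_int (d i) * f i z)"
      unfolding a_def sum_distrib_right mult.assoc by (intro sums_sum sums_mult fz)
    have a1: "cmod (a n) \<le> 8 * N * G / 2 ^ M" if "n < M" for n
    proof -
      have "cmod (a n) \<le> (8 * N * G / 2 ^ M) * 1"
        unfolding a_def norm_mult norm_power using d(3) that zR N1 G
        by (intro mult_mono power_le_one) (auto simp: N_def)
      then show ?thesis by simp
    qed
    have a2: "cmod (a (n + M)) \<le> N * G / 2 ^ M * (1 / 4) ^ n" for n
    proof -
      have "cmod (\<Sum>i\<in>I. of_int (d i) * \<phi> i (n + M)) \<le> (\<Sum>i\<in>I. cmod (of_int (d i) * \<phi> i (n + M)))"
        by (rule norm_sum)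
      also have "\<dots> \<le> (\<Sum>i\<in>I. 2 ^ M * (G / 4 ^ (n + M)))"
      proof (rule sum_mono)
        fix i assume i: "i \<in> I"
        have "real_of_int \<bar>d i\<bar> \<le> real_of_int (2 ^ M)" using d(1)[rule_format, OF i] by (rule of_int_le_iff[THEN iffD2])
        then have "cmod (of_int (d i)) \<le> 2 ^ M" by simp
        then show "cmod (of_int (d i) * \<phi> i (n + M)) \<le> 2 ^ M * (G / 4 ^ (n + M))"
          unfolding norm_mult using \<phi>[OF i] by (intro mult_mono) auto
      qed
      also have "\<dots> = N * G / 2 ^ M * (1 / 4) ^ n"
      proof -
        have "(4 :: real) ^ M = 2 ^ M * 2 ^ M" by (simp flip: power_mult_distrib)
        then show ?thesis by (simp add: I N_def power_add power_divide)
      qed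
      finally have *: "cmod (\<Sum>i\<in>I. of_int (d i) * \<phi> i (n + M)) \<le> N * G / 2 ^ M * (1 / 4) ^ n" .
      have "cmod (a (n + M)) \<le> (N * G / 2 ^ M * (1 / 4) ^ n) * 1"
        unfolding a_def norm_mult norm_power using * zR N1 G
        by (intro mult_mono power_le_one) auto
      then show ?thesis by simp
    qed
    have geo: "(\<lambda>n. N * G / 2 ^ M * (1 / 4) ^ n) sums (N * G / 2 ^ M * (1 / (1 - 1 / 4)))"
      by (intro sums_mult geometric_sums) simp
    have "cmod (\<Sum>n. a (n + M)) \<le> (\<Sum>n. N * G / 2 ^ M * (1 / 4) ^ n)"
      by (rule norm_suminf_le[OF a2]) (use geo in \<open>auto intro: sums_summable\<close>)
    also have "\<dots> \<le> 2 * N * G / 2 ^ M"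
      unfolding sums_unique[OF geo, symmetric] using N1 G by (simp add: divide_right_mono field_simps)
    finally have tail: "cmod (\<Sum>n. a (n + M)) \<le> 2 * N * G / 2 ^ M" .
    have "cmod (\<Sum>n<M. a n) \<le> (\<Sum>n<M. 8 * N * G / 2 ^ M)"
      using a1 by (intro order.trans[OF norm_sum] sum_mono) auto
    also have "\<dots> = real M * (8 * N * G / 2 ^ M)" by simp
    also have "\<dots> \<le> N * (8 * N * G / 2 ^ M)"
      using N1 G by (intro mult_right_mono) (auto simp: N_def)
    finally have head: "cmod (\<Sum>n<M. a n) \<le> N * (8 * N * G / 2 ^ M)" .
    have "(\<Sum>i\<in>I. of_int (d i) * f i z) = (\<Sum>n. a (n + M)) + (\<Sum>n<M. a n)"
      using asum by (metis sums_unique sums_summable suminf_split_initial_segment)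
    then have "cmod (\<Sum>i\<in>I. of_int (d i) * f i z) = cmod ((\<Sum>n. a (n + M)) + (\<Sum>n<M. a n))"
      by (simp only:)
    then have "cmod (\<Sum>i\<in>I. of_int (d i) * f i z) \<le> 2 * N * G / 2 ^ M + N * (8 * N * G / 2 ^ M)"
      using norm_triangle_ineq[of "\<Sum>n. a (n + M)" "\<Sum>n<M. a n"] head tail by linarith
    also have "2 * N * G / 2 ^ M \<le> N * (2 * N * G / 2 ^ M)"
      using mult_right_mono[OF N1, of "2 * N * G / 2 ^ M"] N1 G by simp
    also have "N * (2 * N * G / 2 ^ M) + N * (8 * N * G / 2 ^ M) = 10 * N ^ 2 * G / 2 ^ M"
      by (simp add: field_simps power2_eq_square)
    finally show ?thesis by (simp add: N_def)
  qed
  then show ?thesis using that[of d] d(1,2) by blast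
qed

subsection \<open>A zero estimate\<close>

lemma coeff_mult_degree_bounds:
  assumes "degree p \<le> a" "degree q \<le> b"
  shows "Polynomial.coeff (p * q) (a + b) = Polynomial.coeff p a * Polynomial.coeff q b"
proof -
  have "Polynomial.coeff (p * q) (a + b) = (\<Sum>i\<le>a + b. if i = a then Polynomial.coeff p a * Polynomial.coeff q b else 0)"
    unfolding coeff_mult
  proof (rule sum.cong)
    fix i assume "i \<in> {..a + b}"
    show "Polynomial.coeff p i * Polynomial.coeff q (a + b - i) = (if i = a then Polynomial.coeff p a * Polynomial.coeff q b else 0)"
    proof (cases i a rule: linorder_cases)
      case less
      then have "Polynomial.coeff q (a + b - i) = 0" using assms by (intro coeff_eq_0) auto
      then show ?thesis using less by simp
    next
      case greater
      then have "Polynomial.coeff p i = 0" using assms by (intro coeff_eq_0) auto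
      then show ?thesis using greater by simp
    qed auto
  qed simp
  then show ?thesis by simp
qed

lemma coeff_prod_degree_bounds:
  fixes q :: "'i \<Rightarrow> 'a :: comm_semiring_1 poly"
  assumes "finite I" "\<And>i. i \<in> I \<Longrightarrow> degree (q i) \<le> e i"
  shows "Polynomial.coeff (prod q I) (sum e I) = (\<Prod>i\<in>I. Polynomial.coeff (q i) (e i)) \<and> degree (prod q I) \<le> sum e I"
  using assms
proof (induction I rule: finite_induct)
  case (insert x F)
  then have IH: "Polynomial.coeff (prod q F) (sum e F) = (\<Prod>i\<in>F. Polynomial.coeff (q i) (e i))"
    "degree (prod q F) \<le> sum e F" by auto
  have dx: "degree (q x) \<le> e x" using insert by auto
  show ?case using insert(1,2) IH coeff_mult_degree_bounds[OF dx IH(2)]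
      degree_mult_le[of "q x" "prod q F"] dx by auto
qed auto

text \<open>A kernel vector of the transpose is the coefficient vector of a polynomial of degree
  below m with m distinct roots.\<close>

lemma det_generalized_vandermonde_ne_0:
  fixes x a :: "nat \<Rightarrow> 'a :: field"
  assumes inj: "inj_on x {..<m}" and a: "\<And>k. k < m \<Longrightarrow> a k \<noteq> 0"
  shows "det (mat m m (\<lambda>(j, k). x k ^ j * a k)) \<noteq> 0"
proof
  define A where "A = mat m m (\<lambda>(j, k). x k ^ j * a k)"
  assume "det (mat m m (\<lambda>(j, k). x k ^ j * a k)) = 0"
  then have "det A\<^sup>T = 0" unfolding A_def[symmetric] by (subst det_transpose[of _ m]) (auto simp: A_def)
  then obtain v where v: "v \<in> carrier_vec m" "v \<noteq> 0\<^sub>v m" "A\<^sup>T *\<^sub>v v = 0\<^sub>v m"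
    using det_0_iff_vec_prod_zero_field[of "A\<^sup>T" m] by (auto simp: A_def)
  define Q where "Q = (\<Sum>j<m. Polynomial.monom (v $ j) j)"
  have co: "Polynomial.coeff Q j = v $ j" if "j < m" for j
    using that by (simp add: Q_def coeff_sum)
  have roots: "poly Q (x k) = 0" if k: "k < m" for k
  proof -
    have "0 = (A\<^sup>T *\<^sub>v v) $ k" using v k by simp
    also have "\<dots> = (\<Sum>j<m. x k ^ j * a k * v $ j)"
      using k v(1) by (simp add: A_def scalar_prod_def atLeast0LessThan)
    also have "\<dots> = a k * poly Q (x k)"
      by (simp add: Q_def poly_sum poly_monom sum_distrib_left mult_ac)
    finally show ?thesis using a[OF k] by simp
  qed
  have "Q = 0"
  proof (rule ccontr)
    assume "Q \<noteq> 0"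
    then have "m > 0" by (auto simp: Q_def intro: gr0I)
    have "degree Q \<le> m - 1" unfolding Q_def
      by (intro degree_sum_le) (auto intro: order.trans[OF Polynomial.degree_monom_le])
    have "m = card (x ` {..<m})" using inj by (simp add: card_image)
    also have "\<dots> \<le> card {z. poly Q z = 0}"
      using roots \<open>Q \<noteq> 0\<close> by (intro card_mono poly_roots_finite) auto
    also have "\<dots> \<le> degree Q" using \<open>Q \<noteq> 0\<close> by (rule card_poly_roots_bound)
    finally show False using \<open>degree Q \<le> m - 1\<close> \<open>m > 0\<close> by simp
  qed
  then have "v = 0\<^sub>v m" using co v(1) by (intro eq_vecI) auto
  then show False using v by simp
qed

text \<open>The determinant of the system of shifts \<open>P (X + r j, \<omega>\<^sup>j Y)\<close>, \<open>j < m\<close>, is a nonzero polynomial in \<open>X\<close>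
  of low degree, yet it vanishes wherever all the shifts have a common zero.\<close>

lemma exponential_polynomial_zero_estimate:
  fixes P :: "nat \<Rightarrow> complex poly" and \<omega> :: complex
  assumes deg: "\<And>l. l < L \<Longrightarrow> degree (P l) \<le> K"
    and \<omega>: "inj_on (\<lambda>l. \<omega> ^ l) {..<L}" "\<omega> \<noteq> 0"
    and zero: "\<And>s t. s < S \<Longrightarrow> t < T \<Longrightarrow> (\<Sum>l<L. poly (P l) (of_nat (r * s + p * t)) * \<omega> ^ (l * s)) = 0"
    and cop: "coprime r p" and S: "S \<le> p" "L \<le> S" and count: "K * L < (S - L) * T"
    and l: "l < L"
  shows "P l = 0"
proof (rule ccontr)
  assume Pl: "P l \<noteq> 0"
  \<comment> \<open>Only the nonzero P l enter, so that all leading coefficients in \<open>W\<close>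
    are nonzero.\<close>
  define A where "A = {l\<in>{..<L}. P l \<noteq> 0}"
  define m where "m = card A"
  have finA: "finite A" by (simp add: A_def)
  have m0: "m > 0" using Pl l finA by (auto simp: m_def A_def card_gt_0_iff)
  have "m \<le> card {..<L}" unfolding m_def A_def by (intro card_mono) auto
  then have mL: "m \<le> L" by simp
  obtain f where f: "bij_betw f {..<m} A"
    using ex_bij_betw_nat_finite[OF finA] by (auto simp: m_def atLeast0LessThan)
  have fA: "f k < L" "P (f k) \<noteq> 0" if "k < m" for k
    using bij_betwE[OF f] that by (auto simp: A_def)
  define sh where "sh = (\<lambda>j k. pcompose (P (f k)) [:of_nat (r * j), 1:])"
  define Q where "Q = (\<lambda>j k. Polynomial.smult (\<omega> ^ (j * f k)) (sh j k))"
  define Mx where "Mx = mat m m (\<lambda>(j, k). Q j k)"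
  define e where "e = (\<lambda>k. degree (P (f k)))"
  have degsh: "degree (sh j k) = e k" and lcsh: "Polynomial.coeff (sh j k) (e k) = lead_coeff (P (f k))" for j k
  proof -
    show d: "degree (sh j k) = e k" by (simp add: sh_def e_def degree_pcompose)
    have "lead_coeff (sh j k) = lead_coeff (P (f k)) * lead_coeff [:of_nat (r * j), 1:] ^ degree (P (f k))"
      unfolding sh_def by (rule lead_coeff_comp) simp
    then show "Polynomial.coeff (sh j k) (e k) = lead_coeff (P (f k))" by (simp add: d)
  qed
  have degQ: "degree (Q j k) \<le> e k" for j k
    unfolding Q_def degsh[of j k, symmetric] by (rule Polynomial.degree_smult_le)
  have cQ: "Polynomial.coeff (Q j k) (e k) = (\<omega> ^ f k) ^ j * lead_coeff (P (f k))" for j k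
    by (simp add: Q_def lcsh power_mult[symmetric] mult.commute)
  define D where "D = det Mx"
  have Mc: "Mx \<in> carrier_mat m m" by (simp add: Mx_def)
  have Dsum: "D = (\<Sum>\<pi> | \<pi> permutes {0..<m}. signof \<pi> * (\<Prod>i = 0..<m. Q i (\<pi> i)))"
    unfolding D_def det_def'[OF Mc] by (intro sum.cong prod.cong arg_cong2[of _ _ _ _ times])
      (auto simp: Mx_def permutes_in_image)
  have esum: "(\<Sum>i = 0..<m. e (\<pi> i)) = sum e {0..<m}" if "\<pi> permutes {0..<m}" for \<pi>
    using sum.permute[OF that, of e] by (simp add: o_def)
  define W where "W = mat m m (\<lambda>(j, k). (\<omega> ^ f k) ^ j * lead_coeff (P (f k)))"
  have Wc: "W \<in> carrier_mat m m" by (simp add: W_def)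
  \<comment> \<open>The shifts keep the leading coefficients, and the degree in column k does not
    depend on the row. So all permutations contribute to the same top degree, and the coefficient
    there is a generalized Vandermonde determinant.\<close>
  have "Polynomial.coeff D (sum e {0..<m}) = det W"
  proof -
    have "Polynomial.coeff (signof \<pi> * (\<Prod>i = 0..<m. Q i (\<pi> i))) (sum e {0..<m})
        = signof \<pi> * (\<Prod>i = 0..<m. W $$ (i, \<pi> i))" if \<pi>: "\<pi> permutes {0..<m}" for \<pi>
    proof -
      have "Polynomial.coeff (\<Prod>i = 0..<m. Q i (\<pi> i)) (\<Sum>i = 0..<m. e (\<pi> i)) = (\<Prod>i = 0..<m. Polynomial.coeff (Q i (\<pi> i)) (e (\<pi> i)))"
        using coeff_prod_degree_bounds[of "{0..<m}" "\<lambda>i. Q i (\<pi> i)" "\<lambda>i. e (\<pi> i)"] degQ by auto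
      also have "\<dots> = (\<Prod>i = 0..<m. W $$ (i, \<pi> i))"
        using permutes_in_image[OF \<pi>] by (intro prod.cong) (auto simp: W_def cQ)
      finally show ?thesis unfolding esum[OF \<pi>] by (simp add: sign_def)
    qed
    then show ?thesis unfolding Dsum det_def'[OF Wc] coeff_sum by (intro sum.cong) auto
  qed
  moreover have "det W \<noteq> 0"
    unfolding W_def
  proof (rule det_generalized_vandermonde_ne_0)
    show "inj_on (\<lambda>k. \<omega> ^ f k) {..<m}"
      using comp_inj_on[OF bij_betw_imp_inj_on[OF f], of "\<lambda>l. \<omega> ^ l"] \<omega>(1) f
      by (auto simp: o_def bij_betw_def A_def intro: inj_on_subset)
  qed (use fA in auto)
  ultimately have D0: "D \<noteq> 0" by auto
  have degD: "degree D \<le> K * m"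
    unfolding D_def
  proof (rule degree_det_le[OF _ Mc])
    fix i j assume ij: "i < m" "j < m"
    have "degree (Q i j) \<le> K" using degQ[of i j] deg[OF fA(1)[OF ij(2)]] by (simp add: e_def)
    then show "degree (Mx $$ (i, j)) \<le> K" using ij by (simp add: Mx_def)
  qed
  \<comment> \<open>s < S - L leaves room for the shifts s + j with j < m <= L. At such a point the
    powers of \<omega> form a nonzero kernel vector of the evaluated matrix.\<close>
  define X where "X = (\<lambda>(s, t). of_nat (r * s + p * t) :: complex) ` ({..<S - L} \<times> {..<T})"
  have X_root: "poly D x = 0" if x: "x \<in> X" for x
  proof -
    obtain s t where st: "s < S - L" "t < T" "x = of_nat (r * s + p * t)" using x by (auto simp: X_def simp del: of_nat_add of_nat_mult)
    define B where "B = map_mat (\<lambda>q. poly q x) Mx"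
    have Bc: "B \<in> carrier_mat m m" using Mc by (simp add: B_def)
    define v where "v = vec m (\<lambda>k. \<omega> ^ (s * f k))"
    have "v $ 0 \<noteq> 0\<^sub>v m $ 0" using m0 \<omega>(2) by (simp add: v_def)
    then have v0: "v \<noteq> 0\<^sub>v m" by auto
    have "B *\<^sub>v v = 0\<^sub>v m"
    proof (rule eq_vecI)
      fix j assume "j < dim_vec (0\<^sub>v m)"
      then have j: "j < m" by simp
      have sj: "s + j < S" using st(1) j mL by linarith
      have "(B *\<^sub>v v) $ j = (\<Sum>k<m. poly (Q j k) x * \<omega> ^ (s * f k))"
        using j Bc by (simp add: B_def v_def Mx_def scalar_prod_def atLeast0LessThan)
      also have "\<dots> = (\<Sum>k<m. poly (P (f k)) (of_nat (r * (s + j) + p * t)) * \<omega> ^ (f k * (s + j)))"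
        by (intro sum.cong) (auto simp: Q_def sh_def poly_pcompose st(3) algebra_simps power_add)
      also have "\<dots> = (\<Sum>l\<in>A. poly (P l) (of_nat (r * (s + j) + p * t)) * \<omega> ^ (l * (s + j)))"
        by (rule sum.reindex_bij_betw[OF f])
      also have "\<dots> = (\<Sum>l<L. poly (P l) (of_nat (r * (s + j) + p * t)) * \<omega> ^ (l * (s + j)))"
        by (intro sum.mono_neutral_left) (auto simp: A_def)
      also have "\<dots> = 0" by (rule zero[OF sj st(2)])
      finally show "(B *\<^sub>v v) $ j = 0\<^sub>v m $ j" using j by simp
    qed (use Bc in auto)
    moreover have "v \<in> carrier_vec m" by (simp add: v_def)
    ultimately have "det B = 0"
      using det_0_iff_vec_prod_zero_field[OF Bc] v0 by blast
    interpret ph: comm_ring_hom "\<lambda>q. poly q x" by unfold_locales auto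
    have "det B = poly D x" unfolding B_def D_def by (rule ph.hom_det)
    then show ?thesis using \<open>det B = 0\<close> by simp
  qed
  \<comment> \<open>r is invertible modulo p and s < p, so r s + p t determines s, and then
    t.\<close>
  have injX: "inj_on (\<lambda>(s, t). of_nat (r * s + p * t) :: complex) ({..<S - L} \<times> {..<T})"
  proof (rule inj_onI, clarsimp)
    fix s t s' t'
    assume a: "s < S - L" "t < T" "s' < S - L" "t' < T"
      and "of_nat r * of_nat s + of_nat p * of_nat t = of_nat r * of_nat s' + of_nat p * (of_nat t' :: complex)"
    then have eq: "r * s + p * t = r * s' + p * t'" by (metis of_nat_add of_nat_eq_iff of_nat_mult)
    then have "[r * s = r * s'] (mod p)" by (metis cong_def mod_mult_self2)
    then have "[s = s'] (mod p)" using cop by (simp add: cong_mult_lcancel_nat)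
    moreover have "s < p" "s' < p" using a S by auto
    ultimately have "s = s'" by (simp add: cong_less_modulus_unique_nat)
    moreover have "p > 0" using \<open>s < p\<close> by simp
    ultimately show "s = s' \<and> t = t'" using eq by simp
  qed
  have "(S - L) * T = card X" unfolding X_def card_image[OF injX] by (simp add: card_cartesian_product)
  also have "\<dots> \<le> card {x. poly D x = 0}" using X_root D0 by (intro card_mono poly_roots_finite) auto
  also have "\<dots> \<le> degree D" using D0 by (rule card_poly_roots_bound)
  also have "\<dots> \<le> K * L" using degD mL by (meson mult_le_mono2 order.trans)
  finally show False using count by simp
qed

subsection \<open>Bounding the exponent\<close>

lemma power_div_fact_le_exp:
  fixes x :: real
  assumes "x \<ge> 0"
  shows "x ^ k / fact k \<le> exp x"
proof -
  have s: "(\<lambda>n. x ^ n /\<^sub>R fact n) sums exp x" by (rule exp_converges)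
  have "(\<Sum>n\<in>{k}. x ^ n /\<^sub>R fact n) \<le> (\<Sum>n. x ^ n /\<^sub>R fact n)"
    using assms s by (intro sum_le_suminf) (auto intro: sums_summable)
  then show ?thesis using sums_unique[OF s] by (simp add: divide_inverse mult.commute)
qed

definition basis_fun :: "nat \<Rightarrow> nat \<Rightarrow> nat \<Rightarrow> complex \<Rightarrow> complex" where
  "basis_fun p k l z = (\<Prod>i<k. of_nat p * z - of_nat i) / fact k * exp (2 * of_real pi * \<i> * of_nat l * z)"

lemma basis_fun_holomorphic: "basis_fun p k l holomorphic_on UNIV"
  unfolding basis_fun_def[abs_def]
proof (rule holomorphic_on_mult)
  have "(\<lambda>z. \<Prod>i<k. of_nat p * z - of_nat i :: complex) holomorphic_on UNIV"
    by (rule holomorphic_on_prod) (intro holomorphic_intros)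
  then show "(\<lambda>z. (\<Prod>i<k. of_nat p * z - of_nat i) / (fact k :: complex)) holomorphic_on UNIV"
    by (rule holomorphic_on_divide) auto
  have "(\<lambda>z. 2 * of_real pi * \<i> * of_nat l * z) holomorphic_on UNIV"
    by (rule holomorphic_on_mult) auto
  then show "(\<lambda>z. exp (2 * of_real pi * \<i> * of_nat l * z)) holomorphic_on UNIV"
    by (rule holomorphic_on_exp')
qed

lemma basis_fun_bound:
  fixes R :: real
  assumes p: "p > 0" and k: "k \<le> K" and l: "l \<le> L" and z: "cmod z \<le> 4 * R"
  shows "cmod (basis_fun p k l z) \<le> (8 * real p) ^ K * exp (R + real K + 32 * real L * R)"
proof -
  have R0: "R \<ge> 0" using z norm_ge_zero[of z] by linarith
  define a where "a = 4 * real p * R + real K"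
  have a0: "a \<ge> 0" using R0 by (simp add: a_def)
  have "cmod (\<Prod>i<k. of_nat p * z - of_nat i) = (\<Prod>i<k. cmod (of_nat p * z - of_nat i))"
    by (rule prod_norm[symmetric])
  also have "\<dots> \<le> (\<Prod>i<k. a)"
  proof (intro prod_mono conjI)
    fix i assume i: "i \<in> {..<k}"
    have "cmod (of_nat p * z - of_nat i) \<le> real p * cmod z + real i"
      using norm_triangle_ineq4[of "of_nat p * z" "of_nat i"] by (simp add: norm_mult)
    also have "\<dots> \<le> real p * (4 * R) + real K"
      using z i k by (intro add_mono mult_left_mono) auto
    finally show "cmod (of_nat p * z - of_nat i) \<le> a" by (simp add: a_def mult_ac)
  qed auto
  finally have 1: "cmod (\<Prod>i<k. of_nat p * z - of_nat i) \<le> a ^ k" by simp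
  \<comment> \<open>Pulling out (8 p)^k leaves x^k / k! <= exp x with x = a / (8 p) <= R + K; so k!
    absorbs all growth except (8 p)^K.\<close>
  have "a ^ k / fact k = (8 * real p) ^ k * ((a / (8 * real p)) ^ k / fact k)"
    using p by (simp add: power_divide power_mult_distrib)
  also have "\<dots> \<le> (8 * real p) ^ K * exp (R + real K)"
  proof (intro mult_mono)
    show "(8 * real p) ^ k \<le> (8 * real p) ^ K" using p k by (intro power_increasing) auto
    have "(a / (8 * real p)) ^ k / fact k \<le> exp (a / (8 * real p))"
      using a0 by (intro power_div_fact_le_exp) auto
    also have "a / (8 * real p) \<le> R + real K"
    proof -
      have "a \<le> (R + real K) * (8 * real p)"
      proof -
        have "1 \<le> real p" using p by simp
        then have "real K * 1 \<le> real K * (8 * real p)" by (intro mult_left_mono) auto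
        moreover have "4 * real p * R \<le> R * (8 * real p)" using R0 by (simp add: mult_right_mono)
        ultimately show ?thesis by (simp add: a_def ring_distribs)
      qed
      then show ?thesis using p by (simp add: pos_divide_le_eq)
    qed
    finally show "(a / (8 * real p)) ^ k / fact k \<le> exp (R + real K)" by simp
  qed (use a0 in auto)
  finally have 2: "a ^ k / fact k \<le> (8 * real p) ^ K * exp (R + real K)" .
  have "Re (2 * of_real pi * \<i> * of_nat l * z) \<le> cmod (2 * of_real pi * \<i> * of_nat l * z)"
    by (rule complex_Re_le_cmod)
  also have "\<dots> = 2 * pi * real l * cmod z" by (simp add: norm_mult)
  also have "\<dots> \<le> (2 * 4) * real L * (4 * R)"
    using l z R0 pi_less_4 by (intro mult_mono) auto
  finally have 3: "cmod (exp (2 * of_real pi * \<i> * of_nat l * z)) \<le> exp (32 * real L * R)"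
    by (simp only: norm_exp_eq_Re exp_le_cancel_iff)
  have "cmod (basis_fun p k l z) = cmod (\<Prod>i<k. of_nat p * z - of_nat i) / fact k * cmod (exp (2 * of_real pi * \<i> * of_nat l * z))"
    unfolding basis_fun_def norm_mult norm_divide by simp
  also have "\<dots> \<le> a ^ k / fact k * exp (32 * real L * R)"
    using 1 3 a0 by (intro mult_mono divide_right_mono) auto
  also have "\<dots> \<le> (8 * real p) ^ K * exp (R + real K) * exp (32 * real L * R)"
    using 2 by (intro mult_right_mono) auto
  also have "\<dots> = (8 * real p) ^ K * exp (R + real K + 32 * real L * R)"
    by (simp only: exp_add mult.assoc)
  finally show ?thesis .
qed

lemma prod_of_nat_minus: "(\<Prod>i<k. of_nat x - of_nat i) / fact k = (of_nat (x choose k) :: complex)"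
proof -
  have "(\<Prod>i<k. of_nat x - of_nat i :: complex) = fact k * (of_nat x gchoose k)"
    by (simp only: gbinomial_mult_fact atLeast0LessThan)
  then show ?thesis by (simp add: binomial_gbinomial)
qed

lemma basis_fun_at_point:
  assumes p: "p > 0"
  shows "basis_fun p k l (of_nat (r * s + p * t) / of_nat p)
    = of_nat ((r * s + p * t) choose k) * cis (2 * pi * real r / real p) ^ (l * s)"
proof -
  define x where "x = r * s + p * t"
  have 1: "2 * of_real pi * \<i> * of_nat l * (of_nat x / of_nat p)
    = \<i> * of_real (real (l * s) * (2 * pi * real r / real p) + 2 * pi * real (l * t))"
    using p by (simp add: x_def field_simps)
  have "exp (2 * of_real pi * \<i> * of_nat l * (of_nat x / of_nat p)) = cis (real (l * s) * (2 * pi * real r / real p)) * cis (2 * pi * real (l * t))"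
    unfolding 1 cis_conv_exp[symmetric] cis_mult ..
  also have "cis (2 * pi * real (l * t)) = 1" by (intro cis_multiple_2pi) auto
  also have "cis (real (l * s) * (2 * pi * real r / real p)) = cis (2 * pi * real r / real p) ^ (l * s)"
    by (rule Complex.DeMoivre[symmetric])
  finally have 2: "exp (2 * of_real pi * \<i> * of_nat l * (of_nat x / of_nat p)) = cis (2 * pi * real r / real p) ^ (l * s)" by simp
  have 3: "of_nat p * (of_nat x / of_nat p) = (of_nat x :: complex)" using p by simp
  show ?thesis unfolding basis_fun_def x_def[symmetric] 2 3 prod_of_nat_minus ..
qed

text \<open>If u^l = 1 with 0 < l < L, then l \<phi> = 2 pi k, and l p times the distance from
  \<phi> to 2 pi r / p equals 2 pi |k p - r l|. As p divides neither r nor l, this integer is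
  nonzero, and the distance would be too large.\<close>

lemma unit_quot_powers_inj:
  assumes p: "prime p" and r: "0 < r" "r < p" and L: "L \<le> p"
    and \<phi>: "unit_quot p w = cis \<phi>" "\<bar>\<phi> - 2 * pi * real r / real p\<bar> \<le> 8 / Y"
    and Y: "2 * real L * real p < Y"
  shows "inj_on (\<lambda>l. unit_quot p w ^ l) {..<L}"
proof -
  have False if ab: "a < b" "b < L" "unit_quot p w ^ a = unit_quot p w ^ b" for a b
  proof -
    define l where "l = b - a"
    have l: "0 < l" "l < L" "b = a + l" using ab by (auto simp: l_def)
    have "unit_quot p w ^ a * unit_quot p w ^ l = unit_quot p w ^ a"
      using ab(3) l(3) by (simp add: power_add)
    then have "unit_quot p w ^ l = 1" using \<phi>(1) by simp
    then have "cis (real l * \<phi>) = 1" by (simp add: \<phi>(1) Complex.DeMoivre)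
    then have "cos (real l * \<phi>) = 1" by (metis cis.sel(1) one_complex.sel(1))
    then obtain k :: int where k: "real l * \<phi> = of_int k * (2 * pi)" by (auto simp: cos_one_2pi_int)
    have p0: "real p > 0" using p by (simp add: prime_gt_0_nat)
    define n where "n = k * int p - int r * int l"
    have "n \<noteq> 0"
    proof
      assume "n = 0"
      then have "int p dvd int (r * l)" by (metis dvd_triv_right eq_iff_diff_eq_0 n_def of_nat_mult)
      then have "p dvd r * l" by (simp only: int_dvd_int_iff)
      then have "p dvd r \<or> p dvd l" using p by (simp add: prime_dvd_mult_iff)
      then show False using r l L by (auto dest: dvd_imp_le)
    qed
    then have "\<bar>n\<bar> \<ge> 1" by linarith
    then have n1: "real_of_int \<bar>n\<bar> \<ge> 1" by linarith
    have "real l * real p * (\<phi> - 2 * pi * real r / real p) = real p * (real l * \<phi>) - 2 * pi * real r * real l"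
      using p0 by (simp add: field_simps)
    also have "\<dots> = 2 * pi * of_int n" unfolding k n_def by (simp add: algebra_simps)
    finally have "\<bar>real l * real p * (\<phi> - 2 * pi * real r / real p)\<bar> = \<bar>2 * pi * of_int n\<bar>"
      by (simp only:)
    then have "real l * real p * \<bar>\<phi> - 2 * pi * real r / real p\<bar> = 2 * pi * \<bar>of_int n\<bar>"
      by (simp only: abs_mult abs_of_nat abs_numeral abs_of_pos[OF pi_gt_zero])
    then have four: "4 \<le> real L * real p * 8 / Y"
    proof -
      assume eq: "real l * real p * \<bar>\<phi> - 2 * pi * real r / real p\<bar> = 2 * pi * \<bar>of_int n\<bar>"
      have "2 * pi * \<bar>of_int n\<bar> \<ge> 2 * 2 * 1" using n1 pi_ge_two by (intro mult_mono) auto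
      moreover have "real l * real p * \<bar>\<phi> - 2 * pi * real r / real p\<bar> \<le> real L * real p * (8 / Y)"
        using l \<phi>(2) by (intro mult_mono) auto
      ultimately have "4 \<le> real L * real p * (8 / Y)" using eq by linarith
      then show ?thesis by simp
    qed
    have "0 < Y"
    proof -
      have "0 < 2 * real L * real p" using l p0 by simp
      then show ?thesis using Y by linarith
    qed
    then have "4 * Y \<le> real L * real p * 8" using four by (simp add: pos_le_divide_eq)
    then show False using Y by linarith
  qed
  then show ?thesis by (intro inj_onI) (metis lessThan_iff linorder_neqE_nat)
qed

definition binomial_comb :: "nat \<Rightarrow> (nat \<Rightarrow> int) \<Rightarrow> complex poly" where
  "binomial_comb K d = (\<Sum>k<K. Polynomial.smult (of_int (d k) / fact k) (\<Prod>i<k. [:- of_nat i, 1:]))"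

lemma poly_binomial_comb: "poly (binomial_comb K d) (of_nat x) = (\<Sum>k<K. of_int (d k) * of_nat (x choose k))"
  unfolding binomial_comb_def poly_sum
proof (rule sum.cong)
  fix k
  have "poly (Polynomial.smult (of_int (d k) / fact k) (\<Prod>i<k. [:- of_nat i, 1 :: complex:])) (of_nat x)
     = of_int (d k) * ((\<Prod>i<k. of_nat x - of_nat i) / fact k)"
    by (simp add: poly_prod)
  then show "poly (Polynomial.smult (of_int (d k) / fact k) (\<Prod>i<k. [:- of_nat i, 1 :: complex:])) (of_nat x)
     = of_int (d k) * of_nat (x choose k)"
    unfolding prod_of_nat_minus .
qed simp

lemma degree_binomial_comb: "degree (binomial_comb K d) \<le> K"
  unfolding binomial_comb_def
proof (intro degree_sum_le)
  fix k assume k: "k \<in> {..<K}"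
  have "degree (\<Prod>i<k. [:- of_nat i, 1 :: complex:]) \<le> (\<Sum>i<k. degree [:- of_nat i, 1 :: complex:])"
    using degree_prod_sum_le[of "{..<k}" "\<lambda>i. [:- of_nat i, 1 :: complex:]"] by (simp add: o_def)
  also have "\<dots> = k" by simp
  finally show "degree (Polynomial.smult (of_int (d k) / fact k) (\<Prod>i<k. [:- of_nat i, 1 :: complex:])) \<le> K"
    using k by (intro order.trans[OF Polynomial.degree_smult_le]) auto
qed auto

text \<open>Evaluation at x = k involves only d j with j <= k: a triangular system with ones on the
  diagonal.\<close>

lemma binomial_comb_eq_0D:
  assumes "binomial_comb K d = 0" "k < K"
  shows "d k = 0"
  using assms(2)
proof (induction k rule: less_induct)
  case (less k)
  have "0 = (\<Sum>j<K. of_int (d j) * of_nat (k choose j) :: complex)"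
    unfolding poly_binomial_comb[symmetric] assms(1) by simp
  also have "\<dots> = (\<Sum>j<K. if j = k then of_int (d k) else 0)"
  proof (rule sum.cong)
    fix j assume "j \<in> {..<K}"
    then show "of_int (d j) * of_nat (k choose j) = (if j = k then of_int (d k) else (0 :: complex))"
      using less by (cases j k rule: linorder_cases) auto
  qed simp
  also have "\<dots> = of_int (d k)" using less by simp
  finally show ?case by simp
qed

text \<open>K and L bound the degrees, S and T the ranges of the points. \<open>i1\<close> and
  \<open>i2\<close> keep two errors below 1/2 after multiplication by the denominator, of size at
  most |w|^(L S): the small value of the function on the disc, and the replacement of the root of
  unity by \<open>unit_quot p w\<close>. The resulting Gaussian integer is 0, and
  \<open>count\<close> feeds the zero estimate.\<close>

lemma near_root_params_false:
  fixes p L S T K M r :: nat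
  assumes p: "prime p" "p > 3" and w: "near_root p w"
    and \<phi>: "unit_quot p w = cis \<phi>" "\<bar>real p * \<phi> - 2 * pi * real r\<bar> \<le> 8 * real p / cmod w ^ (p - 1)"
    and r: "0 < r" "r < p"
    and KL: "K * L = 4 * M" and M: "M > 0" and S: "S \<le> p" "L \<le> S" and count: "K * L < (S - L) * T"
    and R: "R = real (S + T)" and G: "G = (8 * real p) ^ K * exp (R + real K + 32 * real L * R)"
    and i1: "20 * real (K * L) ^ 2 * G * cmod w ^ (L * S) < 2 ^ M"
    and i2: "16 * real (K * L) * 2 ^ M * G * real (L * S) * cmod w ^ (L * S) < cmod w ^ (p - 1)"
  shows False
proof -
  define D where "D = cmod w"
  define \<omega> where "\<omega> = unit_quot p w"
  define \<zeta> where "\<zeta> = cis (2 * pi * real r / real p)"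
  define I where "I = {..<K} \<times> {..<L}"
  define f where "f = (\<lambda>(k, l). basis_fun p k l)"
  have p0: "p > 0" using p by simp
  have wg: "w \<in> gauss" "w \<noteq> 0" and D1: "D > 1" using w by (auto simp: near_root_def D_def)
  have KL0: "K > 0" "L > 0" using KL M by (auto intro: Nat.gr0I)
  have S0: "S > 0" using KL0 S by simp
  have R0: "R > 0" using S0 by (simp add: R)
  have "(1 :: real) * 1 \<le> (8 * real p) ^ K * exp (R + real K + 32 * real L * R)"
    using p0 R0 by (intro mult_mono one_le_power) auto
  then have G1: "G \<ge> 1" by (simp add: G)
  have G8: "8 * real p \<le> G"
  proof -
    have "8 * real p = (8 * real p) ^ 1 * 1" by simp
    also have "\<dots> \<le> (8 * real p) ^ K * exp (R + real K + 32 * real L * R)"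
      using p0 R0 KL0 by (intro mult_mono power_increasing) auto
    finally show ?thesis by (simp only: G)
  qed
  have fI: "finite I" "card I = 4 * M" by (auto simp: I_def card_cartesian_product KL)
  have bnd: "cmod (f i z) \<le> G" if "i \<in> I" "cmod z \<le> 4 * R" for i z
    using that basis_fun_bound[OF p0, of "fst i" K "snd i" L z R] by (auto simp: I_def f_def G)
  obtain d where d: "\<forall>i\<in>I. \<bar>d i\<bar> \<le> 2 ^ M" "\<exists>i\<in>I. d i \<noteq> 0"
    "\<forall>z. cmod z \<le> R \<longrightarrow> cmod (\<Sum>i\<in>I. of_int (d i) * f i z) \<le> 10 * real (4 * M) ^ 2 * G / 2 ^ M"
  proof (rule small_combination_on_disc[OF fI M _ R0, of G f])
    show "f i holomorphic_on UNIV" if "i \<in> I" for i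
      by (cases i) (auto simp: f_def intro: basis_fun_holomorphic)
  qed (use G1 bnd in auto)
  have near: "\<bar>\<phi> - 2 * pi * real r / real p\<bar> \<le> 8 / D ^ (p - 1)" "cmod (\<omega> - \<zeta>) \<le> 8 / D ^ (p - 1)"
    using unit_quot_near_cis[OF \<phi> p0] by (auto simp: \<omega>_def \<zeta>_def D_def)
  have \<omega>1: "cmod \<omega> = 1" by (simp add: \<omega>_def \<phi>)
  have zero: "(\<Sum>(k, l)\<in>I. of_int (d (k, l)) * of_nat ((r * s + p * t) choose k) * \<omega> ^ (l * s)) = 0" (is "?V = 0")
    if st: "s < S" "t < T" for s t
  proof (rule ccontr)
    assume V0: "?V \<noteq> 0"
    define x where "x = r * s + p * t"
    define z where "z = (of_nat x / of_nat p :: complex)"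
    have "real x \<le> real p * R"
    proof -
      have "real x = real r * real s + real p * real t" by (simp add: x_def)
      also have "\<dots> \<le> real p * real S + real p * real T"
        using r st by (intro add_mono mult_mono) auto
      finally show ?thesis by (simp add: R distrib_left)
    qed
    then have zR: "cmod z \<le> R" using p0 by (simp add: z_def norm_divide field_simps)
    have fz: "f (k, l) z = of_nat (x choose k) * \<zeta> ^ (l * s)" for k l
      unfolding f_def z_def x_def \<zeta>_def by (simp only: case_prod_conv basis_fun_at_point[OF p0])
    have "cmod (\<Sum>(k, l)\<in>I. of_int (d (k, l)) * of_nat (x choose k) * (\<omega> ^ (l * s) - \<zeta> ^ (l * s)))
       \<le> (\<Sum>i\<in>I. 2 ^ M * G * (real (L * S) * (8 / D ^ (p - 1))))"
    proof (rule order.trans[OF norm_sum sum_mono])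
      fix i assume i: "i \<in> I"
      obtain k l where kl: "i = (k, l)" "k < K" "l < L" using i by (auto simp: I_def)
      have "real_of_int \<bar>d i\<bar> \<le> real_of_int (2 ^ M)" using d(1)[rule_format, OF i] by (rule of_int_le_iff[THEN iffD2])
      then have 1: "cmod (of_int (d i)) \<le> 2 ^ M" by simp
      \<comment> \<open>As |\<zeta>| = 1, the binomial coefficient inherits the bound for the
        function value.\<close>
      have "cmod (f i z) \<le> G" using bnd[OF i] zR R0 by simp
      then have 2: "cmod (of_nat (x choose k) :: complex) \<le> G"
        unfolding kl(1) fz by (simp add: norm_mult norm_power \<zeta>_def)
      have "cmod (\<omega> ^ (l * s) - \<zeta> ^ (l * s)) \<le> real (l * s) * cmod (\<omega> - \<zeta>)"
        using \<omega>1 by (intro norm_power_diff) (auto simp: \<zeta>_def)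
      also have "\<dots> \<le> real (L * S) * (8 / D ^ (p - 1))"
        using near(2) kl st by (intro mult_mono) (auto intro!: mult_mono simp del: of_nat_mult)
      finally have "cmod (of_int (d i)) * cmod (of_nat (x choose k) :: complex) * cmod (\<omega> ^ (l * s) - \<zeta> ^ (l * s))
          \<le> 2 ^ M * G * (real (L * S) * (8 / D ^ (p - 1)))"
        using 1 2 G1 by (intro mult_mono) auto
      then show "cmod (case i of (k, l) \<Rightarrow> of_int (d (k, l)) * of_nat (x choose k) * (\<omega> ^ (l * s) - \<zeta> ^ (l * s)))
          \<le> 2 ^ M * G * (real (L * S) * (8 / D ^ (p - 1)))"
        unfolding kl(1) case_prod_conv norm_mult .
    qed
    also have "\<dots> = 8 * real (K * L) * 2 ^ M * G * real (L * S) / D ^ (p - 1)"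
      unfolding sum_constant fI(2) KL[symmetric] by simp
    finally have e1: "cmod (\<Sum>(k, l)\<in>I. of_int (d (k, l)) * of_nat (x choose k) * (\<omega> ^ (l * s) - \<zeta> ^ (l * s)))
       \<le> 8 * real (K * L) * 2 ^ M * G * real (L * S) / D ^ (p - 1)" .
    have e2: "cmod (\<Sum>i\<in>I. of_int (d i) * f i z) \<le> 10 * real (K * L) ^ 2 * G / 2 ^ M"
      using d(3) zR unfolding KL by blast
    have "?V = (\<Sum>(k, l)\<in>I. of_int (d (k, l)) * of_nat (x choose k) * (\<omega> ^ (l * s) - \<zeta> ^ (l * s)))
       + (\<Sum>i\<in>I. of_int (d i) * f i z)"
      unfolding x_def[symmetric] sum.distrib[symmetric]
      by (intro sum.cong) (auto simp: fz algebra_simps)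
    then have Vle: "cmod ?V \<le> 8 * real (K * L) * 2 ^ M * G * real (L * S) / D ^ (p - 1) + 10 * real (K * L) ^ 2 * G / 2 ^ M"
      using norm_triangle_mono[OF e1 e2] by (simp only:)
    \<comment> \<open>The exponents l s do not exceed L s, so this power is a common
      denominator.\<close>
    define c where "c = cnj w ^ (L * s)"
    have "c * ?V = (\<Sum>(k, l)\<in>I. of_int (d (k, l)) * of_nat (x choose k) * ((\<i> ^ p * w) ^ (l * s) * cnj w ^ ((L - l) * s)))"
      unfolding sum_distrib_left
    proof (rule sum.cong)
      fix i assume "i \<in> I"
      then obtain k l where kl: "i = (k, l)" "k < K" "l < L" by (auto simp: I_def)
      have "L * s = l * s + (L - l) * s" using kl by (simp flip: add_mult_distrib)
      then have "c = cnj w ^ (l * s) * cnj w ^ ((L - l) * s)" unfolding c_def by (simp only: power_add)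
      moreover have "\<omega> ^ (l * s) * cnj w ^ (l * s) = (\<i> ^ p * w) ^ (l * s)"
        using wg by (simp add: \<omega>_def unit_quot_def flip: power_mult_distrib)
      ultimately have "c * \<omega> ^ (l * s) = (\<i> ^ p * w) ^ (l * s) * cnj w ^ ((L - l) * s)"
        by (metis mult.assoc mult.commute)
      then show "c * (case i of (k, l) \<Rightarrow> of_int (d (k, l)) * of_nat ((r * s + p * t) choose k) * \<omega> ^ (l * s))
        = (case i of (k, l) \<Rightarrow> of_int (d (k, l)) * of_nat (x choose k) * ((\<i> ^ p * w) ^ (l * s) * cnj w ^ ((L - l) * s)))"
        unfolding kl(1) case_prod_conv x_def[symmetric] by (metis mult.left_commute)
    qed simp
    also have "\<dots> \<in> gauss" using wg by (intro gauss_sum) auto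
    finally have "c * ?V \<in> gauss" .
    then have "1 \<le> cmod (c * ?V)" using V0 wg by (intro gauss_norm_ge_1) (auto simp: c_def)
    also have "\<dots> = D ^ (L * s) * cmod ?V" by (simp add: c_def norm_mult norm_power D_def)
    also have "\<dots> \<le> D ^ (L * S) * (8 * real (K * L) * 2 ^ M * G * real (L * S) / D ^ (p - 1) + 10 * real (K * L) ^ 2 * G / 2 ^ M)"
      using Vle D1 st by (intro mult_mono power_increasing) auto
    also have "\<dots> = (16 * real (K * L) * 2 ^ M * G * real (L * S) * D ^ (L * S)) / D ^ (p - 1) / 2
        + (20 * real (K * L) ^ 2 * G * D ^ (L * S)) / 2 ^ M / 2"
      by (simp add: distrib_left mult_ac)
    also have "\<dots> < 1 / 2 + 1 / 2"
      using i1 i2 D1 by (intro add_strict_mono divide_strict_right_mono) (simp_all add: D_def[symmetric] pos_divide_less_eq)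
    finally show False by simp
  qed
  have inj: "inj_on (\<lambda>l. \<omega> ^ l) {..<L}"
    unfolding \<omega>_def
  proof (rule unit_quot_powers_inj[OF p(1) r _ \<phi>(1) near(1)])
    show "L \<le> p" using S by simp
    \<comment> \<open>Distinct powers need only 2 L p < |w|^(p-1), which follows from
      \<open>i2\<close> because G >= 8 p.\<close>
    have "2 * real L * real p \<le> 8 * real p * real L" by simp
    also have "\<dots> \<le> G * real (L * S)"
    proof (intro mult_mono G8)
      show "real L \<le> real (L * S)" using S0 by (simp only: of_nat_le_iff) simp
    qed (use G1 in auto)
    also have "\<dots> = 1 * 1 * 1 * G * real (L * S) * 1" by simp
    also have "\<dots> \<le> 16 * real (K * L) * 2 ^ M * G * real (L * S) * D ^ (L * S)"
    proof -
      have "1 * 1 \<le> real K * real L" using KL0 by (intro mult_mono) auto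
      then show ?thesis using G1 D1 by (intro mult_mono) auto
    qed
    also have "\<dots> < D ^ (p - 1)" using i2 by (simp only: D_def)
    finally show "2 * real L * real p < D ^ (p - 1)" .
  qed
  define P where "P = (\<lambda>l. binomial_comb K (\<lambda>k. d (k, l)))"
  have "P l = 0" if "l < L" for l
  proof (rule exponential_polynomial_zero_estimate[where K = K and S = S and T = T and \<omega> = \<omega> and r = r and p = p and L = L])
    show "coprime r p" using p r by (metis coprime_commute prime_imp_coprime nat_dvd_not_less)
    show "(\<Sum>l<L. poly (P l) (of_nat (r * s + p * t)) * \<omega> ^ (l * s)) = 0" if "s < S" "t < T" for s t
    proof -
      have "(\<Sum>l<L. poly (P l) (of_nat (r * s + p * t)) * \<omega> ^ (l * s))
         = (\<Sum>l<L. \<Sum>k<K. of_int (d (k, l)) * of_nat ((r * s + p * t) choose k) * \<omega> ^ (l * s))"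
        unfolding P_def poly_binomial_comb sum_distrib_right ..
      also have "\<dots> = (\<Sum>(k, l)\<in>I. of_int (d (k, l)) * of_nat ((r * s + p * t) choose k) * \<omega> ^ (l * s))"
        unfolding I_def by (subst sum.swap) (rule sum.cartesian_product)
      finally show ?thesis using zero[OF that] by simp
    qed
  qed (use inj \<omega>1 S count that in \<open>auto simp: P_def degree_binomial_comb\<close>)
  then have "d i = 0" if "i \<in> I" for i
    using that by (auto simp: I_def P_def dest: binomial_comb_eq_0D)
  then show False using d(2) by blast
qed

text \<open>8 * 10^7 = 20 * 2000^2 is the polynomial factor that arises when K L = 2000 n.\<close>

lemma square_le_exp:
  fixes n :: real
  assumes "n \<ge> 2500"
  shows "8 * 10 ^ 7 * n\<^sup>2 \<le> exp n"
proof -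
  have "(1 + n / real 8) ^ 8 \<le> exp n"
    using assms by (intro exp_ge_one_plus_x_over_n_power_n) auto
  moreover have "(n / 8) ^ 8 \<le> (1 + n / real 8) ^ 8" using assms by (intro power_mono) auto
  moreover have "(312 :: real) ^ 6 * (n / 8) ^ 2 \<le> (n / 8) ^ 6 * (n / 8) ^ 2"
    using assms by (intro mult_right_mono power_mono) auto
  moreover have "(n / 8) ^ 6 * (n / 8) ^ 2 = (n / 8) ^ 8" by (simp flip: power_add)
  moreover have "8 * 10 ^ 7 * n\<^sup>2 \<le> (312 :: real) ^ 6 * (n / 8) ^ 2"
    by (simp add: power_divide)
  ultimately show ?thesis by linarith
qed

text \<open>|w|^2 is an integer greater than 1. The lower bound for ln |w| lets multiples of ln |w|
  dominate absolute constants.\<close>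

lemma near_root_norm_ge:
  assumes "near_root p w"
  shows "(cmod w)\<^sup>2 \<ge> 2" "ln (cmod w) \<ge> 1 / 3"
proof -
  have w: "w \<in> gauss" "cmod w > 1" using assms by (auto simp: near_root_def)
  obtain n where n: "(cmod w)\<^sup>2 = real n" using gauss_norm_sq[OF w(1)] .
  have "1\<^sup>2 < (cmod w)\<^sup>2" using w by (intro power_strict_mono) auto
  then show 1: "(cmod w)\<^sup>2 \<ge> 2" unfolding n by simp
  have "ln 2 \<le> ln ((cmod w)\<^sup>2)" using 1 by (intro ln_mono) auto
  also have "\<dots> = 2 * ln (cmod w)" using w by (simp add: ln_realpow)
  finally show "ln (cmod w) \<ge> 1 / 3" using ln2_ge_two_thirds by linarith
qed

text \<open>For r = 0 or r = p the root of unity is 1. But cnj w times (u - 1) is a nonzero Gaussian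
  integer, so |u - 1| >= 1 / |w|, whence |w|^(p-2) <= 8, whereas |w|^8 >= 16.\<close>

lemma near_root_index_range:
  assumes p: "p \<ge> 10" and w: "near_root p w" and \<phi>: "unit_quot p w = cis \<phi>"
    "\<bar>real p * \<phi> - 2 * pi * real r\<bar> \<le> 8 * real p / cmod w ^ (p - 1)" and r: "r \<le> p"
  shows "0 < r" "r < p"
proof -
  have ne: "cis (2 * pi * real r / real p) \<noteq> 1"
  proof
    assume 1: "cis (2 * pi * real r / real p) = 1"
    have p0: "p > 0" using p by simp
    have wg: "w \<in> gauss" "w \<noteq> 0" "cmod w > 1" using w by (auto simp: near_root_def)
    have "unit_quot p w \<noteq> 1" using w by (auto simp: near_root_def)
    then have nz: "cnj w * (unit_quot p w - 1) \<noteq> 0" using wg by simp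
    have "cnj w * (unit_quot p w - 1) = \<i> ^ p * w - cnj w"
      using wg by (simp add: unit_quot_def field_simps)
    then have "cnj w * (unit_quot p w - 1) \<in> gauss" using wg by simp
    then have "1 \<le> cmod (cnj w * (unit_quot p w - 1))" using nz by (rule gauss_norm_ge_1)
    also have "\<dots> \<le> cmod w * (8 / cmod w ^ (p - 1))"
      using unit_quot_near_cis(2)[OF \<phi> p0] unfolding 1 norm_mult by (intro mult_mono) auto
    finally have "cmod w ^ (p - 1) \<le> 8 * cmod w" using wg by (simp add: pos_le_divide_eq)
    moreover have "p - 1 = Suc (p - 2)" using p by simp
    ultimately have "cmod w ^ (p - 2) \<le> 8" using wg by simp
    moreover have "cmod w ^ 8 \<le> cmod w ^ (p - 2)" using wg p by (intro power_increasing) auto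
    moreover have "((cmod w)\<^sup>2) ^ 4 \<ge> 2 ^ 4" using near_root_norm_ge(1)[OF w] by (intro power_mono) auto
    ultimately show False by (simp flip: power_mult)
  qed
  have "r \<noteq> 0"
  proof
    assume "r = 0"
    then show False using ne by simp
  qed
  moreover have "r \<noteq> p"
  proof
    assume "r = p"
    then have "2 * pi * real r / real p = 2 * pi" using p by simp
    then show False using ne by (simp only: cis_2pi)
  qed
  ultimately show "0 < r" "r < p" using r by auto
qed

text \<open>In units of n = T L, the logarithms of G and |w|^(L S) are at most 86 and 1, that of 2^M
  lies between 300 and 500, and polynomial factors cost at most 1. So \<open>i1\<close> holds, and
  \<open>i2\<close> reduces to 588 n < (p - 1) ln |w|.\<close>

lemma near_root_large_exponent_false:
  assumes p: "prime p" "p \<ge> 10" and w: "near_root p w"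
    and L: "100 * (1 + ln (8 * real p)) \<le> real L" "5 * 10 ^ 6 * (real L)\<^sup>2 + 1 \<le> real p"
  shows False
proof -
  define D where "D = cmod w"
  define lD where "lD = ln D"
  have D1: "D > 1" using w by (simp add: D_def near_root_def)
  have lD: "lD \<ge> 1 / 3" using near_root_norm_ge(2)[OF w] by (simp add: lD_def D_def)
  have De: "D ^ k = exp (real k * lD)" for k
    using D1 by (simp add: lD_def exp_of_nat_mult)
  define lp where "lp = ln (8 * real p)"
  have L1: "100 * (1 + lp) \<le> real L" using L(1) by (simp only: lp_def)
  have "lp \<ge> 0" using p by (simp add: lp_def)
  then have "100 \<le> 100 * (1 + lp)" by simp
  from this L1 have L100: "real L \<ge> 100" by (rule order.trans)
  \<comment> \<open>As ln |w| >= 1/3, the constant 7500 yields T >= 2500 L = S; it also yields T >=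
    S ln |w|, so |w|^(L S) <= exp n.\<close>
  define T where "T = nat \<lceil>7500 * real L * lD\<rceil>"
  have "7500 * real L * lD \<ge> 0" using lD by simp
  then have T: "7500 * real L * lD \<le> real T" "real T \<le> 7500 * real L * lD + 1"
    by (simp_all add: T_def)
  have Ll: "real L * (1 / 3) \<le> real L * lD" using lD by (intro mult_left_mono) auto
  have T1: "2500 * real L \<le> real T" using T(1) Ll by simp
  have "100 * (1 / 3) \<le> real L * lD" using L100 lD by (intro mult_mono) auto
  then have T2: "real T \<le> 7503 * (real L * lD)" using T(2) by linarith
  define n where "n = real T * real L"
  have T0: "real T \<ge> 2500" using T1 L100 by simp
  have TLn: "real T \<le> n"
    using mult_left_mono[of 1 "real L" "real T"] L100 by (simp add: n_def)
  have nn: "n \<ge> 2500" using TLn T0 by linarith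
  \<comment> \<open>K L = 2000 n must stay below (S - L) T = 2499 n for the zero estimate; M = K L /
    4 is dictated by the box principle.\<close>
  define K S M where "K = 2000 * T" and "S = 2500 * L" and "M = 500 * T * L"
  have KL: "K * L = 4 * M" by (simp add: K_def M_def)
  have rKL: "real (K * L) = 2000 * n" by (simp add: K_def n_def)
  have rM: "real M = 500 * n" by (simp add: M_def n_def)
  have LSn: "real (L * S) \<le> n"
    using mult_right_mono[OF T1, of "real L"] by (simp add: S_def n_def mult_ac)
  define R where "R = real (S + T)"
  have R2: "R \<le> 2 * real T" using T1 by (simp add: R_def S_def)
  define G where "G = (8 * real p) ^ K * exp (R + real K + 32 * real L * R)"
  have "(8 * real p) ^ K = exp (real K * lp)"
    using p by (simp add: exp_of_nat_mult lp_def)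
  then have "G = exp (real K * lp + (R + real K + 32 * real L * R))"
    by (simp add: G_def exp_add)
  moreover have "real K * lp + (R + real K + 32 * real L * R) \<le> 86 * n"
  proof -
    \<comment> \<open>L >= 100 (1 + ln (8 p)) reduces this cost to K L / 100 - K = 20 n - K. With 32
      L R <= 64 n and R <= 2 n the sum is 86 n.\<close>
    have "real K * lp \<le> real K * (real L / 100 - 1)"
      using L1 by (intro mult_left_mono) auto
    also have "\<dots> = 20 * n - real K" by (simp add: K_def n_def algebra_simps)
    finally have 1: "real K * lp \<le> 20 * n - real K" .
    have "32 * real L * R \<le> 32 * real L * (2 * real T)" using R2 by (intro mult_left_mono) auto
    then have "32 * real L * R \<le> 64 * n" by (simp add: n_def mult_ac)
    then show ?thesis using 1 R2 TLn by linarith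
  qed
  ultimately have G: "G \<le> exp (86 * n)" by simp
  have G0: "G > 0" using p by (simp add: G_def)
  have DLS: "D ^ (L * S) \<le> exp n"
  proof -
    have "real (L * S) * lD = real L * (2500 * real L * lD)" by (simp add: S_def mult_ac)
    also have "\<dots> \<le> real L * real T" using T(1) lD by (intro mult_left_mono) auto
    finally show ?thesis unfolding De by (simp add: n_def mult.commute)
  qed
  have sq: "8 * 10 ^ 7 * n\<^sup>2 \<le> exp n" by (rule square_le_exp[OF nn])
  have e2: "exp (2 / 3) \<le> (2 :: real)"
    using ln2_ge_two_thirds by (metis exp_le_cancel_iff exp_ln zero_less_numeral)
  have M2: "exp (300 * n) \<le> 2 ^ M" "2 ^ M \<le> exp (500 * n)"
  proof -
    have "exp (2 / 3 :: real) ^ M \<le> 2 ^ M" using e2 by (intro power_mono) auto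
    moreover have "exp (2 / 3 :: real) ^ M = exp (real M * (2 / 3))" by (rule exp_of_nat_mult[symmetric])
    moreover have "exp (300 * n) \<le> exp (real M * (2 / 3))" using nn by (simp add: rM)
    ultimately show "exp (300 * n) \<le> 2 ^ M" by linarith
    have "(2 :: real) ^ M \<le> exp 1 ^ M" using exp_ge_add_one_self[of 1] by (intro power_mono) auto
    also have "\<dots> = exp (real M * 1)" by (rule exp_of_nat_mult[symmetric])
    finally show "2 ^ M \<le> exp (500 * n)" by (simp add: rM)
  qed
  have i1: "20 * real (K * L) ^ 2 * G * D ^ (L * S) < 2 ^ M"
  proof -
    have "20 * real (K * L) ^ 2 * G * D ^ (L * S) \<le> exp n * exp (86 * n) * exp n"
      using sq G DLS G0 D1 unfolding rKL by (intro mult_mono) (auto simp: power_mult_distrib)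
    also have "\<dots> = exp (88 * n)" by (simp flip: exp_add)
    also have "\<dots> < exp (300 * n)" using nn by simp
    finally show ?thesis using M2(1) by linarith
  qed
  have i2: "16 * real (K * L) * 2 ^ M * G * real (L * S) * D ^ (L * S) < D ^ (p - 1)"
  proof -
    have "16 * real (K * L) * 2 ^ M * G * real (L * S) * D ^ (L * S)
        = (32000 * n * real (L * S)) * 2 ^ M * G * D ^ (L * S)"
      unfolding rKL by (simp add: mult_ac)
    also have "\<dots> \<le> exp n * exp (500 * n) * exp (86 * n) * exp n"
    proof (intro mult_mono G DLS M2(2))
      have "32000 * n * real (L * S) \<le> 32000 * n * n" using LSn nn by (intro mult_left_mono) auto
      also have "\<dots> \<le> 8 * 10 ^ 7 * n\<^sup>2" by (simp add: power2_eq_square)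
      also note sq
      finally show "32000 * n * real (L * S) \<le> exp n" .
    qed (use G0 D1 nn in auto)
    also have "\<dots> = exp (588 * n)" by (simp flip: exp_add)
    also have "\<dots> < exp (real (p - 1) * lD)"
    proof -
      \<comment> \<open>7503 absorbs the rounding of T, and 588 * 7503 = 4411764 stays below the 5 *
        10^6 of the hypothesis on p.\<close>
      have "588 * n \<le> 588 * (7503 * (real L * lD) * real L)"
        unfolding n_def using T2 by (intro mult_left_mono mult_right_mono) auto
      also have "\<dots> = 4411764 * (real L)\<^sup>2 * lD" by (simp add: power2_eq_square mult_ac)
      also have "\<dots> < 5 * 10 ^ 6 * (real L)\<^sup>2 * lD"
        using lD L100 by (intro mult_strict_right_mono) auto
      also have "\<dots> \<le> real (p - 1) * lD"
        using L(2) p lD by (intro mult_right_mono) (auto simp: of_nat_diff)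
      finally show ?thesis by simp
    qed
    finally show ?thesis unfolding De .
  qed
  have "p > 0" using p by simp
  obtain r \<phi> where r: "r \<le> p" "unit_quot p w = cis \<phi>"
    "\<bar>real p * \<phi> - 2 * pi * real r\<bar> \<le> 8 * real p / cmod w ^ (p - 1)"
    using near_root_angle[OF w \<open>p > 0\<close>] by blast
  note rr = near_root_index_range[OF p(2) w r(2,3,1)]
  have L0: "L > 0" "T > 0" using L100 T0 by (auto intro!: Nat.gr0I)
  show False
  proof (rule near_root_params_false[OF p(1) _ w r(2,3) rr KL _ _ _ _ R_def G_def])
    show "S \<le> p"
    proof -
      have "2500 * real L \<le> 5 * 10 ^ 6 * (real L)\<^sup>2"
        using mult_right_mono[of 1 "real L" "real L"] L100 by (simp add: power2_eq_square)
      then have "real S \<le> real p" using L(2) by (simp add: S_def)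
      then show ?thesis by simp
    qed
    have "(S - L) * T = 2499 * (T * L)" by (simp add: S_def algebra_simps)
    moreover have "K * L = 2000 * (T * L)" by (simp add: K_def)
    ultimately show "K * L < (S - L) * T" using L0 by simp
  qed (use p i1 i2 L0 in \<open>auto simp: D_def M_def S_def\<close>)
qed

lemma near_root_exponent_bounded: "\<exists>p0. \<forall>p w. prime p \<longrightarrow> p \<ge> p0 \<longrightarrow> \<not> near_root p w"
proof -
  have "eventually (\<lambda>x::real. 5 * 10 ^ 6 * (100 * (1 + ln (8 * x)) + 1)\<^sup>2 + 1 \<le> x) at_top"
    by real_asymp
  then have "eventually (\<lambda>p::nat. 5 * 10 ^ 6 * (100 * (1 + ln (8 * real p)) + 1)\<^sup>2 + 1 \<le> real p) sequentially"
    by (rule eventually_compose_filterlim[OF _ filterlim_real_sequentially])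
  then obtain p1 where p1: "\<And>p. p \<ge> p1 \<Longrightarrow> 5 * 10 ^ 6 * (100 * (1 + ln (8 * real p)) + 1)\<^sup>2 + 1 \<le> real p"
    unfolding eventually_sequentially by blast
  have "\<not> near_root p w" if p: "prime p" "p \<ge> max p1 10" for p w
  proof
    assume w: "near_root p w"
    define A where "A = 100 * (1 + ln (8 * real p))"
    define L where "L = nat \<lceil>A\<rceil>"
    have "ln (8 * real p) \<ge> 0" using p by simp
    then have A0: "A \<ge> 0" by (simp add: A_def)
    then have L: "A \<le> real L" "real L \<le> A + 1" by (simp_all add: L_def)
    have "5 * 10 ^ 6 * (real L)\<^sup>2 \<le> 5 * 10 ^ 6 * (A + 1)\<^sup>2"
      using L A0 by (intro mult_left_mono power_mono) auto
    moreover have "5 * 10 ^ 6 * (A + 1)\<^sup>2 + 1 \<le> real p" using p1[of p] p by (simp add: A_def)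
    ultimately have "5 * 10 ^ 6 * (real L)\<^sup>2 + 1 \<le> real p" by linarith
    then show False using near_root_large_exponent_false[OF p(1) _ w] L(1) p by (simp add: A_def)
  qed
  then show ?thesis by blast
qed

theorem theorem1:
  shows "finite {(x::nat, y::nat, m::nat, q::nat, p::nat).
            x > 0 \<and> y > 0 \<and> coprime x y \<and> m > 0 \<and>
            prime p \<and> p > 3 \<and> prime q \<and> odd q \<and>
            x ^ 2 + q ^ (2 * m) = 2 * y ^ p \<and>
            \<not> (\<exists>t::int. int y = t ^ 2 + (t + 1) ^ 2)}"
    (is "finite ?S")
proof -
  obtain p0 where p0: "\<And>p w. prime p \<Longrightarrow> p \<ge> p0 \<Longrightarrow> \<not> near_root p w"
    using near_root_exponent_bounded by blast
  \<comment> \<open>Possible values of y = |w|^2 for a given p. Once p and y range over finite sets,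
    x, q and m are bounded by x^2 + q^(2m) = 2 y^p.\<close>
  define Y where "Y = (\<lambda>p. (\<lambda>w. nat \<lfloor>(cmod w)\<^sup>2\<rfloor>) ` {w. near_root p w})"
  define Q where "Q = Sigma {p. prime p \<and> p > 3 \<and> p < p0} Y"
  have "finite Q"
    unfolding Q_def Y_def by (intro finite_SigmaI finite_imageI finite_near_root) auto
  have "?S \<subseteq> (\<Union>(p, y)\<in>Q. {..2 * y ^ p} \<times> {y} \<times> {..2 * y ^ p} \<times> {..2 * y ^ p} \<times> {p})"
  proof clarify
    fix x y m q p :: nat
    assume *: "x > 0" "y > 0" "coprime x y" "m > 0" "prime p" "p > 3" "prime q" "odd q"
      "x ^ 2 + q ^ (2 * m) = 2 * y ^ p" "\<nexists>t::int. int y = t ^ 2 + (t + 1) ^ 2"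
    obtain w where w: "near_root p w" "(cmod w)\<^sup>2 = real y"
      using solution_imp_near_root[OF *(9,3,5-8,4,10)] .
    have "y \<in> Y p" unfolding Y_def using w by (intro image_eqI[of _ _ w]) auto
    moreover have "p < p0" using p0[OF *(5), of w] w(1) by (meson not_le)
    ultimately have Q: "(p, y) \<in> Q" using *(5,6) by (simp add: Q_def)
    have "x \<le> x ^ 2" using *(1) by (simp add: power2_eq_square)
    moreover have "q \<le> q ^ (2 * m)" using *(4,7) by (intro self_le_power) (auto simp: prime_gt_0_nat Suc_leI)
    moreover have "m \<le> q ^ (2 * m)"
    proof -
      have "2 * m < 2 ^ (2 * m)" by (rule less_exp)
      also have "\<dots> \<le> q ^ (2 * m)" using *(7) by (intro power_mono prime_ge_2_nat) auto
      finally show ?thesis by simp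
    qed
    ultimately have "x \<le> 2 * y ^ p" "q \<le> 2 * y ^ p" "m \<le> 2 * y ^ p"
      unfolding *(9)[symmetric] by linarith+
    then show "(x, y, m, q, p) \<in> (\<Union>(p, y)\<in>Q. {..2 * y ^ p} \<times> {y} \<times> {..2 * y ^ p} \<times> {..2 * y ^ p} \<times> {p})"
      by (intro UN_I[OF Q]) simp
  qed
  moreover have "finite (\<Union>(p, y)\<in>Q. {..2 * y ^ p} \<times> {y} \<times> {..2 * y ^ p} \<times> {..2 * y ^ p} \<times> {p})"
    using \<open>finite Q\<close> by auto
  ultimately show ?thesis by (rule finite_subset)
qed

end
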